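(* Let $p_0$ be the unique real root of the polynomial $4x^3-7x^2+5x-1$ (so $p_0\approx 0.312$). Then: (i) If $p\in(0,p_0)$ is a constant, or if $p=n^{\gamma}$ where $\gamma\in(-1/3,0)$ is a constant, then $bp(G_{n,p})=n-\alpha(G_{n,p})$ with high probability. (ii) For every constant $p$ with $p_0\le p<1/2$ there is a constant $C_p>0$ such that $bp(G_{n,p})\ge n-C_p\,\alpha(G_{n,p})$ with high probability, i.e. $bp(G_{n,p})=n-O(\alpha(G_{n,p}))$ whp. (iii) For every constant $p$ with $p_0<p<1/2$ there exists a constant $c_p>0$ such that $bp(G_{n,p})\le n-(1+c_p)\alpha(G_{n,p})$ with high probability.
   Context: $G_{n,p}$ is the Erdős–Rényi random graph on vertex set $[n]$ in which each pair is an edge independently with probability $p$. "With high probability" (whp) means with probability tending to $1$ as $n\to\infty$. For a graph $G$, $\alpha(G)$ is the maximum size of an independent set, and the biclique partition number $bp(G)$ is the minimum number of pairwise edge-disjoint complete bipartite subgraphs (bicliques) of $G$ such that every edge of $G$ lies in exactly one of them. *)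

theory Defs
  imports "HOL-Probability.Probability"
begin

text \<open>Graphs on vertex set {0..<n}: a graph is its edge set, a set of 2-element subsets.\<close>

definition all_edges :: "nat \<Rightarrow> nat set set" where
  "all_edges n = {{i, j} | i j. i < j \<and> j < n}"

definition Gnp :: "nat \<Rightarrow> real \<Rightarrow> nat set set pmf" where
  "Gnp n p = map_pmf (\<lambda>f. {e \<in> all_edges n. f e})
                     (Pi_pmf (all_edges n) False (\<lambda>_. bernoulli_pmf p))"

definition independent :: "nat set set \<Rightarrow> nat set \<Rightarrow> bool" where
  "independent E S \<longleftrightarrow> (\<forall>u\<in>S. \<forall>v\<in>S. u \<noteq> v \<longrightarrow> {u, v} \<notin> E)"

definition alpha :: "nat \<Rightarrow> nat set set \<Rightarrow> nat" where
  "alpha n E = Max {card S | S. S \<subseteq> {..<n} \<and> independent E S}"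

definition biclique_edges :: "nat set \<times> nat set \<Rightarrow> nat set set" where
  "biclique_edges AB = {{a, b} | a b. a \<in> fst AB \<and> b \<in> snd AB}"

definition is_biclique :: "nat \<Rightarrow> nat set set \<Rightarrow> nat set \<times> nat set \<Rightarrow> bool" where
  "is_biclique n E AB \<longleftrightarrow> fst AB \<subseteq> {..<n} \<and> snd AB \<subseteq> {..<n} \<and>
     fst AB \<noteq> {} \<and> snd AB \<noteq> {} \<and> fst AB \<inter> snd AB = {} \<and> biclique_edges AB \<subseteq> E"

definition is_biclique_partition :: "nat \<Rightarrow> nat set set \<Rightarrow> (nat set \<times> nat set) list \<Rightarrow> bool" where
  "is_biclique_partition n E L \<longleftrightarrow>
     (\<forall>i < length L. is_biclique n E (L ! i)) \<and>
     (\<forall>i < length L. \<forall>j < length L. i \<noteq> j \<longrightarrow>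
        biclique_edges (L ! i) \<inter> biclique_edges (L ! j) = {}) \<and>
     (\<Union>i < length L. biclique_edges (L ! i)) = E"

definition bp :: "nat \<Rightarrow> nat set set \<Rightarrow> nat" where
  "bp n E = Min {length L | L. is_biclique_partition n E L}"

definition p0 :: real where
  "p0 = (THE x::real. 4 * x ^ 3 - 7 * x ^ 2 + 5 * x - 1 = 0)"

definition whp :: "(nat \<Rightarrow> real) \<Rightarrow> (nat \<Rightarrow> nat set set \<Rightarrow> bool) \<Rightarrow> bool" where
  "whp p P \<longleftrightarrow> (\<lambda>n. measure_pmf.prob (Gnp n (p n)) {E. P n E}) \<longlonglongrightarrow> 1"

end

theory Submission
  imports Defs "HOL-Real_Asymp.Real_Asymp"
begin

text \<open>
  Let \<open>U\<close> be a vertex set, minimal in size, such that the induced graph has a partition into at most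
  \<open>|U| - r\<close> bicliques. No biclique of such a partition is a star, since deleting its centre would give a
  smaller set. Hence \<open>n - bp(G) \<ge> r\<close> iff there is such a starless core, and (i) and (ii) amount to
  excluding cores with too large a surplus \<open>r\<close>.

  For (i) a plain first moment over pairs of a core and its partition suffices: an additional biclique with
  a side of size 2 multiplies the expected number by roughly \<open>n (1-p)^(|U|/2 + r/2) (1 + (p/(1-p))^2)^|U|\<close>,
  which is small iff \<open>(1-2p+2p^2)^2 < (1-p)^3\<close>, that is, iff \<open>p < p0\<close>. The second moment method supplies
  the matching lower bound on the independence number.

  For (ii) one fixes only the small sides of the bicliques, up to \<open>|U|\<close> of them. In expectation a
  constant proportion of the edges cannot be covered by bicliques with these sides, and by the bounded
  differences inequality this fails with probability \<open>exp(-c |U|^2)\<close>, which beats the number of choices once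
  \<open>|U|\<close> is a large multiple of \<open>log n\<close>. Bicliques with both sides large cover only a small proportion.

  For (iii) take an independent set slightly smaller than the maximum together with a few pairs of
  vertices, the two vertices of a pair having the same neighbours in the independent set. Each pair saves
  one biclique, and beyond \<open>p0\<close> the second moment method finds more pairs than the vertices given up.
\<close>

section \<open>Random subsets of a finite set\<close>

text \<open>One comparison produces p0 on both sides. Write s for the independence number and q for
  1 - 2p + 2p^2; to leading order n is (1-p)^(-s/2). Below p0, the factor n (1-p)^(r/2) of an
  additional biclique is then of lower order, and ((1-p)^(1/2) (1 + (p/(1-p))^2))^|U| is left, whose
  base has square q^2 / (1-p)^3. Above p0, removing one vertex from a nearly maximal independent set
  multiplies the expected number of choices by about n, while adding a twin pair multiplies it by
  n^2 q^s. The two trades balance when q^s is n^(-3), that is, q^2 = (1-p)^3. The exponent -1/3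
  comes from the second moment: s is 1/p up to logarithms, and the bound for independent s-sets that
  differ in few vertices is small only if s^3 is small against n. In (ii), fixing both sides of
  every biclique would give as many as exp(c u^2) choices with u = |U|, no fewer than concentration
  can pay for; small sides of bounded size admit only exp(O(u ln u)).\<close>

definition bexp :: "'a set \<Rightarrow> real \<Rightarrow> ('a set \<Rightarrow> real) \<Rightarrow> real" where
  "bexp A p f = (\<Sum>E\<in>Pow A. p ^ card E * (1 - p) ^ card (A - E) * f E)"

lemma bexp_empty [simp]: "bexp {} p f = f {}"
  by (simp add: bexp_def)

text \<open>Reveals the element \<open>x\<close> first. \<open>bexp\<close> is a finite sum so that
  this recursion, and with it induction on the ground set, yields independence, pattern
  probabilities and concentration without measure theory.\<close>

lemma bexp_insert:
  assumes "finite A" "x \<notin> A"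
  shows "bexp (insert x A) p f = p * bexp A p (\<lambda>E. f (insert x E)) + (1 - p) * bexp A p f"
proof -
  have disj: "Pow A \<inter> insert x ` Pow A = {}" using assms by auto
  have inj: "inj_on (insert x) (Pow A)" using assms by (auto simp: inj_on_def)
  have c1: "card (insert x E) = Suc (card E)" "A - insert x E = A - E"
    "card (insert x A - E) = Suc (card (A - E))" if "E \<subseteq> A" for E
  proof -
    have "finite E" "x \<notin> E" using that assms finite_subset by auto
    thus "card (insert x E) = Suc (card E)" by simp
    show "A - insert x E = A - E" using assms by auto
    have "insert x A - E = insert x (A - E)" using \<open>x \<notin> E\<close> by auto
    thus "card (insert x A - E) = Suc (card (A - E))" using assms by simp
  qed
  have "bexp (insert x A) p f =
     (\<Sum>E\<in>Pow A. p ^ card E * (1 - p) ^ card (insert x A - E) * f E) +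
     (\<Sum>E\<in>insert x ` Pow A. p ^ card E * (1 - p) ^ card (insert x A - E) * f E)"
    unfolding bexp_def Pow_insert using assms by (intro sum.union_disjoint disj) auto
  also have "(\<Sum>E\<in>insert x ` Pow A. p ^ card E * (1 - p) ^ card (insert x A - E) * f E) =
      (\<Sum>E\<in>Pow A. p * (p ^ card E * (1 - p) ^ card (A - E) * f (insert x E)))"
    by (subst sum.reindex[OF inj]) (use assms in \<open>auto intro!: sum.cong simp: c1 Diff_insert0\<close>)
  also have "(\<Sum>E\<in>Pow A. p ^ card E * (1 - p) ^ card (insert x A - E) * f E) =
     (\<Sum>E\<in>Pow A. (1 - p) * (p ^ card E * (1 - p) ^ card (A - E) * f E))"
    by (auto intro!: sum.cong simp: c1)
  finally show ?thesis by (simp add: bexp_def sum_distrib_left)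
qed

lemma bexp_const [simp]: "finite A \<Longrightarrow> bexp A p (\<lambda>_. c) = c"
  by (induction A rule: finite_induct) (simp_all add: bexp_insert algebra_simps)

lemma bexp_cong:
  "A = B \<Longrightarrow> (\<And>E. E \<subseteq> A \<Longrightarrow> f E = g E) \<Longrightarrow> bexp A p f = bexp B p g"
  unfolding bexp_def by (intro sum.cong) auto

lemma bexp_mono:
  assumes "0 \<le> p" "p \<le> 1" "\<And>E. E \<subseteq> A \<Longrightarrow> f E \<le> g E"
  shows "bexp A p f \<le> bexp A p g"
  unfolding bexp_def using assms by (intro sum_mono mult_left_mono) auto

lemma bexp_nonneg:
  assumes "0 \<le> p" "p \<le> 1" "\<And>E. E \<subseteq> A \<Longrightarrow> 0 \<le> f E"
  shows "0 \<le> bexp A p f"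
  unfolding bexp_def using assms by (intro sum_nonneg) auto

lemma bexp_add: "bexp A p (\<lambda>E. f E + g E) = bexp A p f + bexp A p g"
  by (simp add: bexp_def algebra_simps sum.distrib)

lemma bexp_diff: "bexp A p (\<lambda>E. f E - g E) = bexp A p f - bexp A p g"
  by (simp add: bexp_def algebra_simps sum_subtractf)

lemma bexp_cmult: "bexp A p (\<lambda>E. c * f E) = c * bexp A p f"
  by (simp add: bexp_def algebra_simps sum_distrib_left)

lemma bexp_sum: "bexp A p (\<lambda>E. \<Sum>i\<in>I. f i E) = (\<Sum>i\<in>I. bexp A p (f i))"
  unfolding bexp_def sum_distrib_left by (rule sum.swap)

text \<open>Induction on \<open>A\<close> with \<open>f\<close> arbitrary: revealing
  \<open>x\<close> replaces \<open>f\<close> by its two restrictions, for \<open>x\<close> inside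
  and outside the random set.\<close>

lemma bexp_indep2:
  assumes "finite A" "finite B" "A \<inter> B = {}"
  shows "bexp (A \<union> B) p (\<lambda>E. f (E \<inter> A) * g (E \<inter> B)) = bexp A p f * bexp B p g"
  using assms
proof (induction A arbitrary: f rule: finite_induct)
  case empty
  have "bexp B p (\<lambda>E. f {} * g (E \<inter> B)) = bexp B p (\<lambda>E. f {} * g E)"
    by (rule bexp_cong) (auto simp: Int_absorb2)
  thus ?case by (simp add: bexp_cmult)
next
  case (insert x A)
  have x: "x \<notin> A \<union> B" "finite (A \<union> B)" "A \<inter> B = {}" using insert by auto
  have 1: "bexp (A \<union> B) p (\<lambda>E. f (insert x E \<inter> insert x A) * g (insert x E \<inter> B)) =
      bexp (A \<union> B) p (\<lambda>E. f (insert x (E \<inter> A)) * g (E \<inter> B))"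
    using x by (intro bexp_cong) (auto intro!: arg_cong2[where f = "(*)"] arg_cong[where f = f] arg_cong[where f = g])
  have 2: "bexp (A \<union> B) p (\<lambda>E. f (E \<inter> insert x A) * g (E \<inter> B)) =
      bexp (A \<union> B) p (\<lambda>E. f (E \<inter> A) * g (E \<inter> B))"
    using x by (intro bexp_cong refl arg_cong2[where f = "(*)"] arg_cong[where f = f]) auto
  have "bexp (insert x A \<union> B) p (\<lambda>E. f (E \<inter> insert x A) * g (E \<inter> B)) =
     p * bexp (A \<union> B) p (\<lambda>E. f (insert x E \<inter> insert x A) * g (insert x E \<inter> B)) +
     (1 - p) * bexp (A \<union> B) p (\<lambda>E. f (E \<inter> insert x A) * g (E \<inter> B))"
    unfolding Un_insert_left using x by (intro bexp_insert) auto
  also have "\<dots> = p * (bexp A p (\<lambda>E. f (insert x E)) * bexp B p g) + (1 - p) * (bexp A p f * bexp B p g)"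
    unfolding 1 2 using insert.IH[of f] insert.IH[of "\<lambda>E. f (insert x E)"] insert.prems x(3) by presburger
  also have "\<dots> = bexp (insert x A) p f * bexp B p g"
    using insert.hyps by (simp add: bexp_insert distrib_right mult.assoc)
  finally show ?case .
qed

lemma bexp_restrict:
  assumes "finite A" "B \<subseteq> A"
  shows "bexp A p (\<lambda>E. f (E \<inter> B)) = bexp B p f"
proof -
  have "bexp (B \<union> (A - B)) p (\<lambda>E. f (E \<inter> B) * 1) = bexp B p f * bexp (A - B) p (\<lambda>_. 1)"
    using assms by (intro bexp_indep2[of B "A - B" p f "\<lambda>_. 1"]) (auto intro: finite_subset)
  moreover have "B \<union> (A - B) = A" using assms by auto
  ultimately show ?thesis using assms by simp
qed

text \<open>Splits off one factor at a time: it depends on \<open>Q i\<close> only, the remaining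
  product on the union \<open>B\<close> of the other sets, and these are disjoint.\<close>

lemma bexp_prod_indep:
  assumes "finite I" "finite A" "\<And>i. i \<in> I \<Longrightarrow> Q i \<subseteq> A" "disjoint_family_on Q I"
  shows "bexp A p (\<lambda>E. \<Prod>i\<in>I. f i (E \<inter> Q i)) = (\<Prod>i\<in>I. bexp A p (\<lambda>E. f i (E \<inter> Q i)))"
  using assms
proof (induction I rule: finite_induct)
  case (insert i I)
  define B where "B = (\<Union>j\<in>I. Q j)"
  have d: "Q i \<inter> B = {}" using insert.prems insert.hyps
    by (auto simp: B_def disjoint_family_on_def)
  have sub: "Q i \<subseteq> A" "B \<subseteq> A" using insert.prems by (auto simp: B_def)
  have fin: "finite (Q i)" "finite B" using sub insert.prems(1) by (blast intro: finite_subset)+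
  define F where "F E = f i (E \<inter> Q i)" for E
  define G where "G E = (\<Prod>j\<in>I. f j (E \<inter> Q j))" for E
  have GI: "G (E \<inter> B) = G E" for E
    unfolding G_def by (intro prod.cong refl arg_cong[where f = "f _"]) (auto simp: B_def)
  have FI: "F (E \<inter> Q i) = F E" for E by (simp add: F_def Int_assoc)
  have "bexp A p (\<lambda>E. \<Prod>j\<in>insert i I. f j (E \<inter> Q j)) = bexp A p (\<lambda>E. F E * G E)"
    using insert.hyps by (simp add: F_def G_def)
  also have "\<dots> = bexp A p (\<lambda>E. F (E \<inter> (Q i \<union> B) \<inter> Q i) * G (E \<inter> (Q i \<union> B) \<inter> B))"
  proof (intro bexp_cong refl)
    fix E
    have "E \<inter> (Q i \<union> B) \<inter> Q i = E \<inter> Q i" "E \<inter> (Q i \<union> B) \<inter> B = E \<inter> B" by auto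
    thus "F E * G E = F (E \<inter> (Q i \<union> B) \<inter> Q i) * G (E \<inter> (Q i \<union> B) \<inter> B)" by (simp only: FI GI)
  qed
  also have "\<dots> = bexp (Q i \<union> B) p (\<lambda>E. F (E \<inter> Q i) * G (E \<inter> B))"
    using sub insert.prems by (intro bexp_restrict) auto
  also have "\<dots> = bexp (Q i) p F * bexp B p G"
    using d fin by (intro bexp_indep2) auto
  also have "bexp (Q i) p F = bexp A p (\<lambda>E. f i (E \<inter> Q i))"
    using bexp_restrict[of A "Q i" p F] sub insert.prems(1) unfolding FI by (simp only: F_def)
  also have "bexp B p G = bexp A p G"
    using bexp_restrict[of A B p G] sub insert.prems(1) unfolding GI by simp
  also have "bexp A p G = (\<Prod>j\<in>I. bexp A p (\<lambda>E. f j (E \<inter> Q j)))"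
    unfolding G_def using insert.prems
    by (intro insert.IH) (auto simp: disjoint_family_on_def)
  finally show ?case using insert.hyps by simp
qed (use assms in simp)

text \<open>The exact probabilities of the development are brought to this form: some edges
  prescribed as present, others as absent.\<close>

lemma bexp_pattern:
  assumes "finite A" "F1 \<subseteq> A" "F0 \<subseteq> A" "F1 \<inter> F0 = {}"
  shows "bexp A p (\<lambda>E. of_bool (F1 \<subseteq> E \<and> F0 \<inter> E = {})) = p ^ card F1 * (1 - p) ^ card F0"
  using assms
proof (induction A arbitrary: F1 F0 rule: finite_induct)
  case (insert x A)
  note fin = finite_subset[OF _ insert.hyps(1)]
  consider "x \<in> F1" "x \<notin> F0" | "x \<notin> F1" "x \<in> F0" | "x \<notin> F1" "x \<notin> F0" using insert.prems by auto
  thus ?case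
  proof cases
    case 1
    have 2: "bexp A p (\<lambda>E. of_bool (F1 \<subseteq> insert x E \<and> F0 \<inter> insert x E = {})) =
        bexp A p (\<lambda>E. of_bool (F1 - {x} \<subseteq> E \<and> F0 \<inter> E = {}))"
      using 1 by (intro bexp_cong refl arg_cong[where f = of_bool]) auto
    have 3: "bexp A p (\<lambda>E. of_bool (F1 \<subseteq> E \<and> F0 \<inter> E = {})) = bexp A p (\<lambda>E. 0)"
      using 1 insert.hyps by (intro bexp_cong) auto
    have "card F1 = Suc (card (F1 - {x}))"
      using 1 insert.prems insert.hyps by (metis card_Suc_Diff1 finite.insertI finite_subset)
    moreover have "F1 - {x} \<subseteq> A" "F0 \<subseteq> A" "(F1 - {x}) \<inter> F0 = {}" using 1 insert.prems by auto
    ultimately show ?thesis using insert.hyps insert.IH[of "F1 - {x}" F0]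
      unfolding bexp_insert[OF insert.hyps(1,2)] 2 3 by simp
  next
    case 2
    have 3: "bexp A p (\<lambda>E. of_bool (F1 \<subseteq> insert x E \<and> F0 \<inter> insert x E = {})) = bexp A p (\<lambda>E. 0)"
      using 2 by (intro bexp_cong) auto
    have 4: "bexp A p (\<lambda>E. of_bool (F1 \<subseteq> E \<and> F0 \<inter> E = {})) =
        bexp A p (\<lambda>E. of_bool (F1 \<subseteq> E \<and> (F0 - {x}) \<inter> E = {}))"
      using 2 insert.hyps by (intro bexp_cong refl arg_cong[where f = of_bool]) auto
    have "card F0 = Suc (card (F0 - {x}))"
      using 2 insert.prems insert.hyps by (metis card_Suc_Diff1 finite.insertI finite_subset)
    moreover have "F1 \<subseteq> A" "F0 - {x} \<subseteq> A" "F1 \<inter> (F0 - {x}) = {}" using 2 insert.prems by auto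
    ultimately show ?thesis using insert.hyps insert.IH[of F1 "F0 - {x}"]
      unfolding bexp_insert[OF insert.hyps(1,2)] 3 4 by simp
  next
    case 3
    have "F1 \<subseteq> A" "F0 \<subseteq> A" using 3 insert.prems by auto
    moreover have "bexp A p (\<lambda>E. of_bool (F1 \<subseteq> insert x E \<and> F0 \<inter> insert x E = {})) =
        bexp A p (\<lambda>E. of_bool (F1 \<subseteq> E \<and> F0 \<inter> E = {}))"
      using 3 by (intro bexp_cong refl arg_cong[where f = of_bool]) auto
    ultimately show ?thesis using insert.IH[of F1 F0] insert.hyps insert.prems
      by (simp add: bexp_insert algebra_simps)
  qed
qed simp

section \<open>Transfer to the random graph\<close>

lemma prob_Bernoulli_subset:
  assumes "finite A" "0 \<le> p" "p \<le> 1"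
  shows "measure_pmf.prob (map_pmf (\<lambda>f. {e \<in> A. f e}) (Pi_pmf A False (\<lambda>_. bernoulli_pmf p))) {E. P E} =
    bexp A p (\<lambda>E. of_bool (P E))"
proof -
  let ?M = "Pi_pmf A False (\<lambda>_. bernoulli_pmf p)"
  have pt: "measure_pmf.prob ?M {f. {e \<in> A. f e} = E} = p ^ card E * (1 - p) ^ card (A - E)"
    if "E \<subseteq> A" for E
  proof -
    have "{f. {e \<in> A. f e} = E} = Pi A (\<lambda>e. {e \<in> E})"
      using that by (auto simp: Pi_def)
    hence "measure_pmf.prob ?M {f. {e \<in> A. f e} = E} =
        (\<Prod>e\<in>A. measure_pmf.prob (bernoulli_pmf p) {e \<in> E})"
      using assms by (simp add: measure_Pi_pmf_Pi)
    also have "\<dots> = (\<Prod>e\<in>A. if e \<in> E then p else 1 - p)"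
      using assms by (intro prod.cong refl) (auto simp: measure_pmf_single)
    also have "\<dots> = p ^ card E * (1 - p) ^ card (A - E)"
      using that assms by (subst prod.If_cases) (auto simp: Int_absorb1 Diff_eq)
    finally show ?thesis .
  qed
  have "measure_pmf.prob (map_pmf (\<lambda>f. {e \<in> A. f e}) ?M) {E. P E} =
      measure_pmf.prob ?M (\<Union>E\<in>{E\<in>Pow A. P E}. {f. {e \<in> A. f e} = E})"
    unfolding measure_map_pmf
    by (rule arg_cong[where f = "measure_pmf.prob ?M"]) auto
  also have "\<dots> = (\<Sum>E\<in>{E\<in>Pow A. P E}. measure_pmf.prob ?M {f. {e \<in> A. f e} = E})"
    using assms by (intro measure_pmf.finite_measure_finite_Union) (auto simp: disjoint_family_on_def)
  also have "\<dots> = (\<Sum>E\<in>{E\<in>Pow A. P E}. p ^ card E * (1 - p) ^ card (A - E))"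
    by (intro sum.cong refl pt) auto
  also have "\<dots> = bexp A p (\<lambda>E. of_bool (P E))"
    unfolding bexp_def using assms by (intro sum.mono_neutral_cong_left) auto
  finally show ?thesis .
qed

abbreviation pr :: "nat \<Rightarrow> real \<Rightarrow> (nat set set \<Rightarrow> bool) \<Rightarrow> real" where
  "pr n p P \<equiv> bexp (all_edges n) p (\<lambda>E. of_bool (P E))"

lemma all_edges_eq: "all_edges n = {e. e \<subseteq> {..<n} \<and> card e = 2}"
proof (intro equalityI subsetI)
  fix e assume "e \<in> {e. e \<subseteq> {..<n} \<and> card e = 2}"
  then obtain i j where ij: "e = {i, j}" "i \<noteq> j" "e \<subseteq> {..<n}" by (auto simp: card_2_iff)
  show "e \<in> all_edges n"
  proof (cases "i < j")
    case True thus ?thesis using ij by (auto simp: all_edges_def)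
  next
    case False
    hence "e = {j, i} \<and> j < i \<and> i < n" using ij by auto
    thus ?thesis unfolding all_edges_def by blast
  qed
qed (auto simp: all_edges_def)

lemma finite_all_edges [simp]: "finite (all_edges n)"
  unfolding all_edges_eq by (rule finite_subset[of _ "Pow {..<n}"]) auto

lemma finite_edge_set: "E \<subseteq> all_edges n \<Longrightarrow> finite E"
  by (rule finite_subset[OF _ finite_all_edges])

lemma prob_Gnp:
  assumes "0 \<le> p" "p \<le> 1"
  shows "measure_pmf.prob (Gnp n p) {E. P E} = pr n p P"
  unfolding Gnp_def using assms by (intro prob_Bernoulli_subset) auto

lemma pr_mono:
  assumes "0 \<le> p" "p \<le> 1" "\<And>E. E \<subseteq> all_edges n \<Longrightarrow> P E \<Longrightarrow> Q E"
  shows "pr n p P \<le> pr n p Q"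
  using assms by (intro bexp_mono) auto

lemma pr_nonneg: "0 \<le> p \<Longrightarrow> p \<le> 1 \<Longrightarrow> 0 \<le> pr n p P"
  by (intro bexp_nonneg) auto

lemma pr_disj: 
  assumes "0 \<le> p" "p \<le> 1"
  shows "pr n p (\<lambda>E. P E \<or> Q E) \<le> pr n p P + pr n p Q"
  unfolding bexp_add[symmetric] using assms by (intro bexp_mono) auto

lemma pr_UN_le:
  assumes "0 \<le> p" "p \<le> 1" "finite I"
  shows "pr n p (\<lambda>E. \<exists>i\<in>I. P i E) \<le> (\<Sum>i\<in>I. pr n p (P i))"
proof -
  have "of_bool (\<exists>i\<in>I. P i E) \<le> (\<Sum>i\<in>I. of_bool (P i E) :: real)" for E
  proof (cases "\<exists>i\<in>I. P i E")
    case True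
    then obtain i where "i \<in> I" "P i E" by auto
    thus ?thesis using member_le_sum[of i I "\<lambda>i. of_bool (P i E) :: real"] assms by auto
  qed (auto intro: sum_nonneg)
  thus ?thesis unfolding bexp_sum[symmetric] using assms by (intro bexp_mono)
qed

lemma whpI:
  assumes "\<forall>\<^sub>F n in sequentially. 0 \<le> p n \<and> p n \<le> 1"
    and "\<forall>\<^sub>F n in sequentially. pr n (p n) (\<lambda>E. \<not> P n E) \<le> f n"
    and "f \<longlonglongrightarrow> 0"
  shows "whp p P"
  unfolding whp_def
proof (rule tendsto_sandwich[where f = "\<lambda>n. 1 - f n" and h = "\<lambda>_. 1"])
  show "\<forall>\<^sub>F n in sequentially. 1 - f n \<le> measure_pmf.prob (Gnp n (p n)) {E. P n E}"
    using assms(1,2)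
  proof eventually_elim
    case (elim n)
    have "1 - pr n (p n) (\<lambda>E. \<not> P n E) = bexp (all_edges n) (p n) (\<lambda>E. 1 - of_bool (\<not> P n E))"
      by (simp add: bexp_diff)
    also have "\<dots> = pr n (p n) (P n)" by (intro bexp_cong) auto
    finally show ?case using elim by (simp add: prob_Gnp)
  qed
  show "(\<lambda>n. 1 - f n) \<longlonglongrightarrow> 1" using tendsto_diff[OF tendsto_const assms(3), of 1] by simp
qed auto

text \<open>Chebyshev for the number \<open>X\<close> of indices with \<open>P i\<close>: where X =
  0, the square of X - \<mu> equals \<mu>^2. Serves for independent sets and for twin configurations
  alike.\<close>

lemma second_moment_none:
  assumes "finite A" "0 \<le> p" "p \<le> 1" "finite I" and expected_indep: "\<mu> = (\<Sum>i\<in>I. bexp A p (\<lambda>E. of_bool (P i E)))" "0 < \<mu>"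
  shows "bexp A p (\<lambda>E. of_bool (\<forall>i\<in>I. \<not> P i E)) \<le>
    (\<Sum>i\<in>I. \<Sum>j\<in>I. bexp A p (\<lambda>E. of_bool (P i E \<and> P j E))) / \<mu>\<^sup>2 - 1"
proof -
  define X :: "'a set \<Rightarrow> real" where "X E = (\<Sum>i\<in>I. of_bool (P i E))" for E
  have EX: "bexp A p X = \<mu>" unfolding X_def expected_indep(1) by (rule bexp_sum)
  have sq: "(X E)\<^sup>2 = (\<Sum>i\<in>I. \<Sum>j\<in>I. of_bool (P i E \<and> P j E))" for E
    unfolding X_def power2_eq_square sum_product by (intro sum.cong refl) auto
  have EX2: "bexp A p (\<lambda>E. (X E)\<^sup>2) = (\<Sum>i\<in>I. \<Sum>j\<in>I. bexp A p (\<lambda>E. of_bool (P i E \<and> P j E)))"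
    unfolding sq bexp_sum ..
  have "\<mu>\<^sup>2 * bexp A p (\<lambda>E. of_bool (\<forall>i\<in>I. \<not> P i E)) =
      bexp A p (\<lambda>E. \<mu>\<^sup>2 * of_bool (\<forall>i\<in>I. \<not> P i E))" by (simp add: bexp_cmult)
  also have "\<dots> \<le> bexp A p (\<lambda>E. (X E - \<mu>)\<^sup>2)"
    using assms(2,3) by (intro bexp_mono) (auto simp: X_def)
  also have "\<dots> = bexp A p (\<lambda>E. (X E)\<^sup>2 - 2 * \<mu> * X E + \<mu>\<^sup>2)"
    by (intro bexp_cong) (auto simp: power2_eq_square algebra_simps)
  also have "\<dots> = bexp A p (\<lambda>E. (X E)\<^sup>2) - \<mu>\<^sup>2"
    using assms(1) by (simp add: bexp_add bexp_diff bexp_cmult EX power2_eq_square)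
  finally show ?thesis using expected_indep(2) unfolding EX2 by (simp add: field_simps)
qed

section \<open>Biclique partitions\<close>

lemma biclique_edges_Pair: "biclique_edges (A, B) = {{a, b} | a b. a \<in> A \<and> b \<in> B}"
  by (simp add: biclique_edges_def)

lemma biclique_edges_swap: "biclique_edges (B, A) = biclique_edges (A, B)"
  unfolding biclique_edges_Pair by (auto simp: insert_commute)

lemma card_biclique_edges:
  assumes "finite A" "finite B" "A \<inter> B = {}"
  shows "card (biclique_edges (A, B)) = card A * card B"
proof -
  have "biclique_edges (A, B) = (\<lambda>(a, b). {a, b}) ` (A \<times> B)"
    unfolding biclique_edges_Pair by auto
  moreover have "inj_on (\<lambda>(a, b). {a, b}) (A \<times> B)"
    using assms by (auto simp: inj_on_def doubleton_eq_iff)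
  ultimately show ?thesis by (simp add: card_image card_cartesian_product)
qed

lemma bpart_Nil: "is_biclique_partition n E [] \<longleftrightarrow> E = {}"
  by (auto simp: is_biclique_partition_def)

text \<open>Replaces the indexed definition by a recursion on the list, on which the inductions over
  partitions below rest.\<close>

lemma bpart_Cons:
  "is_biclique_partition n E (x # L) \<longleftrightarrow>
     is_biclique n E x \<and> is_biclique_partition n (E - biclique_edges x) L"
proof
  assume *: "is_biclique_partition n E (x # L)"
  hence x: "is_biclique n E x" unfolding is_biclique_partition_def by (metis length_Cons nth_Cons_0 zero_less_Suc)
  have bic: "is_biclique n E (L ! i)" if "i < length L" for i
    using * that unfolding is_biclique_partition_def by (metis Suc_less_eq length_Cons nth_Cons_Suc)
  have dx: "biclique_edges (L ! i) \<inter> biclique_edges x = {}" if "i < length L" for i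
  proof -
    have "Suc i < length (x # L)" "0 < length (x # L)" "Suc i \<noteq> 0" using that by auto
    hence "biclique_edges ((x # L) ! Suc i) \<inter> biclique_edges ((x # L) ! 0) = {}"
      using * unfolding is_biclique_partition_def by blast
    thus ?thesis by simp
  qed
  have dd: "biclique_edges (L ! i) \<inter> biclique_edges (L ! j) = {}"
    if "i < length L" "j < length L" "i \<noteq> j" for i j
  proof -
    have "Suc i < length (x # L)" "Suc j < length (x # L)" "Suc i \<noteq> Suc j" using that by auto
    hence "biclique_edges ((x # L) ! Suc i) \<inter> biclique_edges ((x # L) ! Suc j) = {}"
      using * unfolding is_biclique_partition_def by blast
    thus ?thesis by simp
  qed
  have "(\<Union>i < length (x # L). biclique_edges ((x # L) ! i)) = E"
    using * unfolding is_biclique_partition_def by blast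
  hence un: "biclique_edges x \<union> (\<Union>i < length L. biclique_edges (L ! i)) = E"
    by (simp add: lessThan_Suc_eq_insert_0 image_image)
  have "is_biclique_partition n (E - biclique_edges x) L"
    unfolding is_biclique_partition_def
  proof (intro conjI allI impI)
    fix i assume i: "i < length L"
    show "is_biclique n (E - biclique_edges x) (L ! i)"
      using bic[OF i] dx[OF i] unfolding is_biclique_def by blast
  next
    show "(\<Union>i < length L. biclique_edges (L ! i)) = E - biclique_edges x"
      using un dx by blast
  qed (use dd in blast)
  with x show "is_biclique n E x \<and> is_biclique_partition n (E - biclique_edges x) L" by blast
next
  assume *: "is_biclique n E x \<and> is_biclique_partition n (E - biclique_edges x) L"
  hence un: "(\<Union>i < length L. biclique_edges (L ! i)) = E - biclique_edges x"
    unfolding is_biclique_partition_def by blast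
  have sub: "biclique_edges x \<subseteq> E" using * by (simp add: is_biclique_def)
  show "is_biclique_partition n E (x # L)"
    unfolding is_biclique_partition_def
  proof (intro conjI allI impI)
    fix i assume i: "i < length (x # L)"
    show "is_biclique n E ((x # L) ! i)"
      using * i unfolding is_biclique_partition_def is_biclique_def by (cases i) auto
    fix j assume j: "j < length (x # L)" "i \<noteq> j"
    show "biclique_edges ((x # L) ! i) \<inter> biclique_edges ((x # L) ! j) = {}"
    proof (cases i)
      case 0
      then obtain j' where "j = Suc j'" "j' < length L" using j by (cases j) auto
      thus ?thesis using un 0 by auto
    next
      case (Suc i')
      show ?thesis
      proof (cases j)
        case 0
        thus ?thesis using un Suc i by auto
      next
        case (Suc j')
        thus ?thesis using \<open>i = Suc i'\<close> i j * unfolding is_biclique_partition_def by auto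
      qed
    qed
  next
    show "(\<Union>i < length (x # L). biclique_edges ((x # L) ! i)) = E"
      using un sub by (auto simp: lessThan_Suc_eq_insert_0 image_image)
  qed
qed

lemma bpart_memD:
  "is_biclique_partition n E L \<Longrightarrow> x \<in> set L \<Longrightarrow> is_biclique n E x"
  by (auto simp: is_biclique_partition_def in_set_conv_nth)

lemma bpart_Union:
  "is_biclique_partition n E L \<Longrightarrow> (\<Union>x\<in>set L. biclique_edges x) = E"
  unfolding is_biclique_partition_def by (auto simp: set_conv_nth)

lemma biclique_edges_nonempty: "is_biclique n E x \<Longrightarrow> biclique_edges x \<noteq> {}"
  by (auto simp: is_biclique_def biclique_edges_def)

text \<open>The bicliques are nonempty and edge-disjoint. The bound makes the set of lengths finite,
  so that the \<open>Min\<close> in \<open>bp\<close> is attained.\<close>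

lemma bpart_length_le:
  assumes "finite E" "is_biclique_partition n E L"
  shows "length L \<le> card E"
  using assms
proof (induction L arbitrary: E)
  case (Cons x L)
  have x: "is_biclique n E x" "is_biclique_partition n (E - biclique_edges x) L"
    using Cons.prems by (auto simp: bpart_Cons)
  have sub: "biclique_edges x \<subseteq> E" using x by (simp add: is_biclique_def)
  have "length L \<le> card (E - biclique_edges x)" using Cons x by auto
  also have "\<dots> < card E"
    using sub biclique_edges_nonempty[OF x(1)] Cons.prems by (intro psubset_card_mono) auto
  finally show ?case by simp
qed simp

lemma bpart_exists:
  assumes "E \<subseteq> all_edges n"
  shows "\<exists>L. is_biclique_partition n E L"
  using finite_edge_set[OF assms] assms
proof (induction E rule: finite_induct)
  case empty
  show ?case using bpart_Nil by blast
next
  case (insert e E)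
  then obtain L where L: "is_biclique_partition n E L" by auto
  obtain i j where ij: "e = {i, j}" "i < j" "j < n" using insert.prems by (auto simp: all_edges_def)
  have be: "biclique_edges ({i}, {j}) = {e}" using ij by (auto simp: biclique_edges_def)
  have "insert e E - {e} = E" using insert by auto
  hence "is_biclique_partition n (insert e E) (({i}, {j}) # L)"
    unfolding bpart_Cons be using L ij be by (auto simp: is_biclique_def)
  thus ?case by blast
qed

lemma finite_bpart_lengths:
  assumes "E \<subseteq> all_edges n"
  shows "finite {length L | L. is_biclique_partition n E L}"
  by (rule finite_subset[of _ "{..card E}"])
     (use bpart_length_le finite_edge_set[OF assms] in auto)

lemma bp_le:
  assumes "E \<subseteq> all_edges n" "is_biclique_partition n E L"
  shows "bp n E \<le> length L"
  unfolding bp_def using finite_bpart_lengths[OF assms(1)] assms(2) by (intro Min_le) auto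

lemma bp_attained:
  assumes "E \<subseteq> all_edges n"
  obtains L where "is_biclique_partition n E L" "length L = bp n E"
proof -
  have "bp n E \<in> {length L | L. is_biclique_partition n E L}"
    unfolding bp_def using finite_bpart_lengths[OF assms] bpart_exists[OF assms] by (intro Min_in) auto
  thus ?thesis using that by auto
qed

lemma bpart_star:
  assumes "E \<subseteq> all_edges n" "v < n" "is_biclique_partition n {e \<in> E. v \<notin> e} L"
  shows "\<exists>L'. is_biclique_partition n E L' \<and> length L' \<le> Suc (length L)"
proof (cases "{e \<in> E. v \<in> e} = {}")
  \<comment> \<open>An isolated \<open>v\<close> gets no star, since both sides of a biclique must
    be nonempty; hence only an upper bound on the length.\<close>
  case True
  hence "{e \<in> E. v \<notin> e} = E" by auto
  thus ?thesis using assms by (intro exI[of _ L]) auto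
next
  case False
  define B where "B = {w. {v, w} \<in> E}"
  have ed: "\<exists>w. e = {v, w} \<and> w \<noteq> v \<and> w < n" if e: "e \<in> E" "v \<in> e" for e
  proof -
    obtain i j where "e = {i, j}" "i < j" "j < n" using e assms(1) unfolding all_edges_def by blast
    thus ?thesis using e by (cases "v = i") (auto simp: insert_commute)
  qed
  have "biclique_edges ({v}, B) = {e \<in> E. v \<in> e}"
    unfolding biclique_edges_Pair B_def using ed by auto
  moreover have "B \<subseteq> {..<n}" "v \<notin> B" "B \<noteq> {}"
  proof -
    show "B \<subseteq> {..<n}" using assms(1) unfolding B_def all_edges_eq by blast
    have "{v, v} \<notin> all_edges n" by (simp add: all_edges_eq)
    thus "v \<notin> B" using assms(1) unfolding B_def by blast
    show "B \<noteq> {}" using False ed unfolding B_def by blast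
  qed
  ultimately have "is_biclique n E ({v}, B)" "E - biclique_edges ({v}, B) = {e \<in> E. v \<notin> e}"
    using assms by (auto simp: is_biclique_def)
  hence "is_biclique_partition n E (({v}, B) # L)" using assms by (simp add: bpart_Cons)
  thus ?thesis by force
qed

lemma bpart_stars:
  assumes "finite W" "W \<subseteq> {..<n}" "E \<subseteq> all_edges n" "is_biclique_partition n {e \<in> E. e \<inter> W = {}} L"
  shows "\<exists>L'. is_biclique_partition n E L' \<and> length L' \<le> length L + card W"
  using assms
proof (induction W arbitrary: E rule: finite_induct)
  case empty
  thus ?case by auto
next
  case (insert v W)
  have "{e \<in> E. e \<inter> insert v W = {}} = {e \<in> {e \<in> E. v \<notin> e}. e \<inter> W = {}}" by auto
  then obtain L' where L': "is_biclique_partition n {e \<in> E. v \<notin> e} L'" "length L' \<le> length L + card W"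
    using insert.IH[of "{e \<in> E. v \<notin> e}"] insert.prems by auto
  then obtain L'' where "is_biclique_partition n E L''" "length L'' \<le> Suc (length L')"
    using bpart_star[of E n v L'] insert.prems by auto
  thus ?case using L' insert.hyps by force
qed

text \<open>One star for each vertex outside \<open>U\<close> covers every edge that is not inside
  \<open>U\<close>. All upper bounds on \<open>bp\<close> come from here; the additive form avoids
  truncated subtraction.\<close>

lemma bp_le_delete:
  assumes "U \<subseteq> {..<n}" "E \<subseteq> all_edges n" "is_biclique_partition n {e \<in> E. e \<subseteq> U} L"
  shows "bp n E + card U \<le> n + length L"
proof -
  have "{e \<in> E. e \<inter> ({..<n} - U) = {}} = {e \<in> E. e \<subseteq> U}"
    using assms(2) unfolding all_edges_eq by auto
  then obtain L' where "is_biclique_partition n E L'" "length L' \<le> length L + card ({..<n} - U)"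
    using bpart_stars[of "{..<n} - U" n E L] assms by auto
  moreover have "card ({..<n} - U) = n - card U" using assms(1)
    by (simp add: card_Diff_subset finite_subset)
  moreover have "card U \<le> n" using card_mono[OF _ assms(1)] by simp
  ultimately show ?thesis using bp_le[OF assms(2)] by fastforce
qed

lemma alpha_props:
  shows alpha_ge: "S \<subseteq> {..<n} \<Longrightarrow> independent E S \<Longrightarrow> card S \<le> alpha n E"
    and alpha_attained: "\<exists>S\<subseteq>{..<n}. independent E S \<and> card S = alpha n E"
proof -
  have fin: "finite {card S | S. S \<subseteq> {..<n} \<and> independent E S}"
    by (rule finite_subset[of _ "{..n}"]) (auto intro: card_mono[of "{..<n}", simplified])
  show "card S \<le> alpha n E" if "S \<subseteq> {..<n}" "independent E S"
    unfolding alpha_def using fin that by (intro Max_ge) auto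
  have "independent E {}" by (simp add: independent_def)
  hence "{card S | S. S \<subseteq> {..<n} \<and> independent E S} \<noteq> {}" by blast
  from Max_in[OF fin this] show "\<exists>S\<subseteq>{..<n}. independent E S \<and> card S = alpha n E"
    unfolding alpha_def by auto
qed

lemma alpha_le: "alpha n E \<le> n"
proof -
  obtain S where "S \<subseteq> {..<n}" "card S = alpha n E" using alpha_attained by blast
  thus ?thesis using card_mono[of "{..<n}" S] by simp
qed

lemma independent_iff:
  assumes "E \<subseteq> all_edges n"
  shows "independent E S \<longleftrightarrow> {e \<in> E. e \<subseteq> S} = {}"
proof -
  have "card e = 2" if "e \<in> E" for e using that assms by (auto simp: all_edges_eq)
  thus ?thesis unfolding independent_def by (auto simp: card_2_iff; fastforce)
qed

lemma bp_le_alpha: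
  assumes "E \<subseteq> all_edges n"
  shows "bp n E \<le> n - alpha n E"
proof -
  obtain S where S: "S \<subseteq> {..<n}" "independent E S" "card S = alpha n E" using alpha_attained by blast
  have "is_biclique_partition n {e \<in> E. e \<subseteq> S} []" using S independent_iff[OF assms] by (simp add: bpart_Nil)
  from bp_le_delete[OF S(1) assms this] S show ?thesis by simp
qed

section \<open>Deleting vertices and starless cores\<close>

lemma bpart_delete_vertex:
  assumes "is_biclique_partition n E L"
  shows "\<exists>L'. is_biclique_partition n {e \<in> E. v \<notin> e} L' \<and> length L' \<le> length L \<and>
     ((\<exists>x\<in>set L. fst x = {v} \<or> snd x = {v}) \<longrightarrow> length L' < length L)"
  using assms
proof (induction L arbitrary: E)
  case Nil
  thus ?case by (intro exI[of _ "[]"]) (auto simp: bpart_Nil)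
next
  case (Cons x L)
  obtain A B where AB: "x = (A, B)" by (cases x)
  have x: "is_biclique n E x" "is_biclique_partition n (E - biclique_edges x) L"
    using Cons.prems by (auto simp: bpart_Cons)
  obtain L' where L': "is_biclique_partition n {e \<in> E - biclique_edges x. v \<notin> e} L'" "length L' \<le> length L"
     "(\<exists>x\<in>set L. fst x = {v} \<or> snd x = {v}) \<longrightarrow> length L' < length L"
    using Cons.IH[OF x(2)] by blast
  let ?x = "(A - {v}, B - {v})"
  have be: "biclique_edges ?x = {e \<in> biclique_edges x. v \<notin> e}"
    unfolding AB biclique_edges_Pair by auto
  have sub: "biclique_edges x \<subseteq> E" using x by (simp add: is_biclique_def)
  show ?case
  \<comment> \<open>A biclique that loses a whole side is dropped. A star centred at
    \<open>v\<close> always does, which gives the strict inequality.\<close>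
  proof (cases "A - {v} = {} \<or> B - {v} = {}")
    case True
    hence "biclique_edges ?x = {}" unfolding biclique_edges_Pair by auto
    hence "{e \<in> E - biclique_edges x. v \<notin> e} = {e \<in> E. v \<notin> e}" using be by auto
    thus ?thesis using L' by (intro exI[of _ L']) auto
  next
    case False
    have "is_biclique n {e \<in> E. v \<notin> e} ?x"
      using x False sub be unfolding AB is_biclique_def by auto
    moreover have "{e \<in> E. v \<notin> e} - biclique_edges ?x = {e \<in> E - biclique_edges x. v \<notin> e}"
      unfolding be by auto
    ultimately have "is_biclique_partition n {e \<in> E. v \<notin> e} (?x # L')" using L' by (simp add: bpart_Cons)
    moreover have "\<not> (fst x = {v} \<or> snd x = {v})" using False AB by auto
    ultimately show ?thesis using L' by (intro exI[of _ "?x # L'"]) auto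
  qed
qed

lemma bpart_swap:
  assumes "is_biclique_partition n E L"
  shows "is_biclique_partition n E (map (\<lambda>(A, B). if card A \<le> card B then (A, B) else (B, A)) L)"
  using assms
proof (induction L arbitrary: E)
  case (Cons x L)
  obtain A B where x: "x = (A, B)" by (cases x)
  show ?case using Cons by (auto simp: bpart_Cons x biclique_edges_swap[of B A] is_biclique_def)
qed simp

text \<open>Listing the smaller side first lets \<open>s\<close> bound both sides and organises the
  sums over bicliques by the size of the small side.\<close>

definition biq :: "nat set \<Rightarrow> nat \<Rightarrow> (nat set \<times> nat set) set" where
  "biq U s = {(A, B). A \<subseteq> U \<and> B \<subseteq> U \<and> A \<inter> B = {} \<and> s \<le> card A \<and> card A \<le> card B}"

lemma finite_biq: "finite U \<Longrightarrow> finite (biq U s)"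
  unfolding biq_def by (rule finite_subset[of _ "Pow U \<times> Pow U"]) auto

text \<open>A vertex set minimal for the inequality below meets no star of its partition: deleting
  the centre of a star would remove one vertex and one biclique.\<close>

lemma starless_core:
  assumes E: "E \<subseteq> all_edges n" and r: "r + bp n E \<le> n"
  obtains U L where "U \<subseteq> {..<n}" "is_biclique_partition n {e \<in> E. e \<subseteq> U} L" "card U = r + length L"
    "set L \<subseteq> biq U 2"
proof -
  define Q where "Q m \<longleftrightarrow> (\<exists>U L. U \<subseteq> {..<n} \<and> is_biclique_partition n {e \<in> E. e \<subseteq> U} L \<and>
     r + length L \<le> card U \<and> card U = m)" for m
  obtain L0 where L0: "is_biclique_partition n E L0" "length L0 = bp n E" using bp_attained[OF E] .
  have "{e \<in> E. e \<subseteq> {..<n}} = E" using E by (auto simp: all_edges_eq)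
  hence "Q n" unfolding Q_def using L0 r by (intro exI[of _ "{..<n}"] exI[of _ L0]) auto
  define m where "m = (LEAST m. Q m)"
  have "Q m" unfolding m_def using \<open>Q n\<close> by (rule LeastI)
  have minimal: "\<not> Q m'" if "m' < m" for m' using that unfolding m_def by (rule not_less_Least)
  obtain U L where UL: "U \<subseteq> {..<n}" "is_biclique_partition n {e \<in> E. e \<subseteq> U} L"
     "r + length L \<le> card U" "card U = m" using \<open>Q m\<close> unfolding Q_def by blast
  have finU: "finite U" using UL finite_subset by auto
  have del: "\<not> r + length L' < card U" if "v \<in> U" "is_biclique_partition n {e \<in> {e \<in> E. e \<subseteq> U}. v \<notin> e} L'" for v L'
  proof
    assume less: "r + length L' < card U"
    have "{e \<in> {e \<in> E. e \<subseteq> U}. v \<notin> e} = {e \<in> E. e \<subseteq> U - {v}}" by auto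
    moreover have "card (U - {v}) = m - 1" "0 < m" using that finU UL by (auto simp: card_gt_0_iff)
    ultimately have "Q (m - 1)" unfolding Q_def using that less UL
      by (intro exI[of _ "U - {v}"] exI[of _ L']) auto
    thus False using minimal \<open>0 < m\<close> by auto
  qed
  \<comment> \<open>With a strict inequality any vertex could be deleted, since the number of
    bicliques does not grow; minimality of \<open>m\<close> thus forces equality.\<close>
  have cardU: "card U = r + length L"
  proof (rule ccontr)
    assume "card U \<noteq> r + length L"
    hence less: "r + length L < card U" using UL by simp
    then obtain v where "v \<in> U" by fastforce
    obtain L' where "is_biclique_partition n {e \<in> {e \<in> E. e \<subseteq> U}. v \<notin> e} L'" "length L' \<le> length L"
      using bpart_delete_vertex[OF UL(2), of v] by blast
    thus False using del \<open>v \<in> U\<close> less by fastforce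
  qed
  have inU: "fst x \<subseteq> U \<and> snd x \<subseteq> U" if "x \<in> set L" for x
  proof -
    have "is_biclique n {e \<in> E. e \<subseteq> U} x" using that UL bpart_memD by blast
    hence s: "biclique_edges x \<subseteq> {e. e \<subseteq> U}" and ne: "fst x \<noteq> {}" "snd x \<noteq> {}" by (auto simp: is_biclique_def)
    have "a \<in> U \<and> b \<in> U" if "a \<in> fst x" "b \<in> snd x" for a b
    proof -
      have "{a, b} \<in> biclique_edges x" using that unfolding biclique_edges_def by blast
      thus ?thesis using s by auto
    qed
    thus ?thesis using ne by blast
  qed
  have nostar: "2 \<le> card (fst x) \<and> 2 \<le> card (snd x)" if x: "x \<in> set L" for x
  proof -
    have no: "fst x \<noteq> {v} \<and> snd x \<noteq> {v}" for v
    proof (rule ccontr)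
      assume "\<not> (fst x \<noteq> {v} \<and> snd x \<noteq> {v})"
      hence *: "fst x = {v} \<or> snd x = {v}" by blast
      hence "v \<in> U" using inU[OF x] by auto
      obtain L' where "is_biclique_partition n {e \<in> {e \<in> E. e \<subseteq> U}. v \<notin> e} L'" "length L' < length L"
        using bpart_delete_vertex[OF UL(2), of v] x * by blast
      thus False using del \<open>v \<in> U\<close> cardU by fastforce
    qed
    have "is_biclique n {e \<in> E. e \<subseteq> U} x" using x UL bpart_memD by blast
    hence "fst x \<noteq> {}" "snd x \<noteq> {}" by (auto simp: is_biclique_def)
    moreover have "finite (fst x)" "finite (snd x)" using inU[OF x] finU finite_subset by auto
    ultimately have "card (fst x) \<noteq> 0" "card (snd x) \<noteq> 0" by auto
    moreover have "card (fst x) \<noteq> 1" "card (snd x) \<noteq> 1" using no by (auto simp: card_1_singleton_iff)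
    ultimately show ?thesis by linarith
  qed
  define L2 where "L2 = map (\<lambda>(A, B). if card A \<le> card B then (A, B) else (B, A)) L"
  have disj: "fst x \<inter> snd x = {}" if "x \<in> set L" for x
    using bpart_memD[OF UL(2) that] by (simp add: is_biclique_def)
  have "set L2 \<subseteq> biq U 2"
  proof
    fix z assume "z \<in> set L2"
    then obtain A B where x: "(A, B) \<in> set L" and z: "z = (if card A \<le> card B then (A, B) else (B, A))"
      unfolding L2_def by auto
    have *: "A \<subseteq> U" "B \<subseteq> U" "2 \<le> card A" "2 \<le> card B" "A \<inter> B = {}" "B \<inter> A = {}"
      using inU[OF x] nostar[OF x] disj[OF x] by auto
    show "z \<in> biq U 2"
    proof (cases "card A \<le> card B")
      case True
      thus ?thesis using * z by (simp add: biq_def)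
    next
      case False
      thus ?thesis using * z by (simp add: biq_def)
    qed
  qed
  thus ?thesis using that[of U L2] UL cardU bpart_swap[OF UL(2)] unfolding L2_def by simp
qed

section \<open>The first moment of starless cores\<close>

text \<open>Up to a common factor, the probability that a list of bicliques is a partition is at
  most a product of weights. So the union bound over lists of length \<open>k\<close> becomes the
  \<open>k\<close>-th power of the single sum \<open>biq_weight\<close>.\<close>

lemma sum_prod_list_lists:
  fixes g :: "'a \<Rightarrow> real"
  assumes "finite S"
  shows "(\<Sum>xs\<in>{xs. set xs \<subseteq> S \<and> length xs = k}. prod_list (map g xs)) = (\<Sum>x\<in>S. g x) ^ k"
proof (induction k)
  case 0
  have "{xs. set xs \<subseteq> S \<and> length xs = 0} = {[]}" by auto
  thus ?case by simp
next
  case (Suc k)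
  let ?T = "{xs. set xs \<subseteq> S \<and> length xs = k}"
  have "inj_on (\<lambda>(xs, n). n # xs) (?T \<times> S)" by (auto simp: inj_on_def)
  hence "(\<Sum>xs\<in>{xs. set xs \<subseteq> S \<and> length xs = Suc k}. prod_list (map g xs)) =
     (\<Sum>(xs, x)\<in>?T \<times> S. g x * prod_list (map g xs))"
    unfolding lists_length_Suc_eq by (subst sum.reindex) (auto intro!: sum.cong)
  also have "\<dots> = (\<Sum>xs\<in>?T. \<Sum>x\<in>S. g x * prod_list (map g xs))"
    by (rule sum.cartesian_product[symmetric])
  also have "\<dots> = (\<Sum>xs\<in>?T. prod_list (map g xs)) * (\<Sum>x\<in>S. g x)"
    by (simp add: sum_distrib_right[symmetric] sum_distrib_left[symmetric] mult.commute)
  finally show ?case using Suc by simp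
qed

lemma sum_Pow_card:
  fixes f :: "nat \<Rightarrow> real"
  assumes "finite U"
  shows "(\<Sum>B\<in>Pow U. f (card B)) = (\<Sum>b\<le>card U. real (card U choose b) * f b)"
proof -
  have "(\<Sum>B\<in>Pow U. f (card B)) = (\<Sum>b\<le>card U. \<Sum>B\<in>{B. B \<in> Pow U \<and> card B = b}. f (card B))"
    using assms by (intro sum.group[symmetric]) (auto intro: card_mono)
  also have "\<dots> = (\<Sum>b\<le>card U. real (card U choose b) * f b)"
  proof (intro sum.cong refl)
    fix b
    have "(\<Sum>B\<in>{B. B \<in> Pow U \<and> card B = b}. f (card B)) = (\<Sum>B\<in>{B. B \<subseteq> U \<and> card B = b}. f b)"
      by (intro sum.cong) auto
    thus "(\<Sum>B\<in>{B. B \<in> Pow U \<and> card B = b}. f (card B)) = real (card U choose b) * f b"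
      using n_subsets[OF assms, of b] by simp
  qed
  finally show ?thesis .
qed

lemma choose_le_mult:
  assumes "a \<le> b"
  shows "(u choose b) \<le> (u choose a) * (u choose (b - a))"
proof (cases "b \<le> u")
  case True
  have "1 \<le> b choose a" using assms by (simp add: Suc_le_eq)
  hence "(u choose b) \<le> (u choose b) * (b choose a)" by simp
  also have "\<dots> = (u choose a) * ((u - a) choose (b - a))" using assms True by (rule choose_mult)
  also have "\<dots> \<le> (u choose a) * (u choose (b - a))" by (intro mult_left_mono binomial_right_mono) auto
  finally show ?thesis .
qed (simp add: binomial_eq_0)

text \<open>Splits off \<open>a\<close> elements of \<open>B\<close> by
  \<open>choose_le_mult\<close>; the rest sums to \<open>(1 + z) ^ card U\<close>. With
  \<open>z = x ^ a\<close> the factor \<open>z ^ a\<close> is the decay \<open>x ^ (a * a)\<close>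
  that makes large sides negligible.\<close>

lemma sum_large_subsets_le:
  fixes z :: real
  assumes "finite U" "0 \<le> z"
  shows "(\<Sum>B\<in>{B \<in> Pow U. a \<le> card B}. z ^ card B) \<le> real (card U choose a) * z ^ a * (1 + z) ^ card U"
proof -
  let ?u = "card U"
  have "(\<Sum>B\<in>{B \<in> Pow U. a \<le> card B}. z ^ card B) = (\<Sum>B\<in>Pow U. of_bool (a \<le> card B) * z ^ card B)"
    using assms by (intro sum.mono_neutral_cong_left) auto
  also have "\<dots> = (\<Sum>b\<le>?u. real (?u choose b) * (of_bool (a \<le> b) * z ^ b))"
    by (rule sum_Pow_card[OF assms(1)])
  also have "\<dots> = (\<Sum>b\<in>{a..?u}. real (?u choose b) * z ^ b)"
    by (intro sum.mono_neutral_cong_right) auto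
  also have "\<dots> \<le> (\<Sum>b\<in>{a..?u}. real (?u choose a) * z ^ a * (real (?u choose (b - a)) * z ^ (b - a)))"
  proof (intro sum_mono)
    fix b assume b: "b \<in> {a..?u}"
    have "real (?u choose b) \<le> real (?u choose a) * real (?u choose (b - a))"
      using choose_le_mult[of a b ?u] b by (metis atLeastAtMost_iff of_nat_le_iff of_nat_mult)
    hence "real (?u choose b) * z ^ b \<le> real (?u choose a) * real (?u choose (b - a)) * z ^ b"
      using assms by (intro mult_right_mono) auto
    also have "real (?u choose a) * real (?u choose (b - a)) * z ^ b =
        real (?u choose a) * real (?u choose (b - a)) * (z ^ a * z ^ (b - a))" using b by (simp add: power_add[symmetric])
    finally show "real (?u choose b) * z ^ b \<le> real (?u choose a) * z ^ a * (real (?u choose (b - a)) * z ^ (b - a))"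
      by (simp add: mult_ac)
  qed
  also have "\<dots> = real (?u choose a) * z ^ a * (\<Sum>b\<in>{a..?u}. real (?u choose (b - a)) * z ^ (b - a))"
    by (simp add: sum_distrib_left)
  also have "(\<Sum>b\<in>{a..?u}. real (?u choose (b - a)) * z ^ (b - a)) =
     (\<Sum>c\<in>(\<lambda>b. b - a) ` {a..?u}. real (?u choose c) * z ^ c)"
    by (subst sum.reindex) (auto simp: inj_on_def)
  also have "\<dots> \<le> (\<Sum>c\<le>?u. real (?u choose c) * z ^ c)"
    using assms by (intro sum_mono2) auto
  also have "\<dots> = (1 + z) ^ ?u" by (subst add.commute) (simp add: binomial_ring)
  finally show ?thesis using assms by (simp add: mult_left_mono)
qed

text \<open>With \<open>x = p / (1 - p)\<close> each term is the factor by which turning the pairs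
  of one biclique into edges changes the probability of a graph without them.\<close>

definition biq_weight :: "nat set \<Rightarrow> nat \<Rightarrow> real \<Rightarrow> real" where
  "biq_weight U s x = (\<Sum>(A, B)\<in>biq U s. x ^ (card A * card B))"

lemma biq_weight_nonneg: "0 \<le> x \<Longrightarrow> 0 \<le> biq_weight U s x"
  unfolding biq_weight_def by (intro sum_nonneg) auto

text \<open>Fix the small side \<open>A\<close> of size \<open>a\<close> and sum over
  \<open>B\<close> with \<open>sum_large_subsets_le\<close>. One factor \<open>card U ^ a\<close>
  counts the choices of \<open>A\<close>, the other the \<open>a\<close> elements split off from
  \<open>B\<close>; \<open>1 + x ^ a\<close> is replaced by its value at
  \<open>a = s\<close>.\<close>

lemma biq_weight_le:
  fixes x :: real
  assumes "finite U" "0 \<le> x" "x \<le> 1"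
  shows "biq_weight U s x \<le> (1 + x ^ s) ^ card U * (\<Sum>a=s..card U. ((card U)\<^sup>2 * x ^ a) ^ a)"
proof -
  let ?u = "card U"
  have fin: "finite {A \<in> Pow U. s \<le> card A}" "finite {B \<in> Pow U. k \<le> card B}" for k using assms by auto
  have "biq_weight U s x \<le> (\<Sum>(A, B)\<in>Sigma {A \<in> Pow U. s \<le> card A} (\<lambda>A. {B \<in> Pow U. card A \<le> card B}).
      (x ^ card A) ^ card B)"
    unfolding biq_weight_def power_mult using assms fin
    by (intro sum_mono2) (auto simp: biq_def)
  also have "\<dots> = (\<Sum>A\<in>{A \<in> Pow U. s \<le> card A}. \<Sum>B\<in>{B \<in> Pow U. card A \<le> card B}. (x ^ card A) ^ card B)"
    using fin by (intro sum.Sigma[symmetric]) auto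
  also have "\<dots> \<le> (\<Sum>A\<in>{A \<in> Pow U. s \<le> card A}.
      real (?u choose card A) * (x ^ card A) ^ card A * (1 + x ^ card A) ^ ?u)"
    using assms by (intro sum_mono sum_large_subsets_le) auto
  also have "\<dots> \<le> (\<Sum>A\<in>{A \<in> Pow U. s \<le> card A}.
      real (?u choose card A) * (x ^ card A) ^ card A * (1 + x ^ s) ^ ?u)"
    using assms by (intro sum_mono mult_left_mono power_mono add_left_mono power_decreasing) auto
  also have "\<dots> = (\<Sum>A\<in>Pow U. of_bool (s \<le> card A) *
      (real (?u choose card A) * (x ^ card A) ^ card A * (1 + x ^ s) ^ ?u))"
    using assms by (intro sum.mono_neutral_cong_left) auto
  also have "\<dots> = (\<Sum>a\<le>?u. real (?u choose a) * (of_bool (s \<le> a) *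
      (real (?u choose a) * (x ^ a) ^ a * (1 + x ^ s) ^ ?u)))"
    by (rule sum_Pow_card[OF assms(1)])
  also have "\<dots> = (\<Sum>a=s..?u. (real (?u choose a))\<^sup>2 * (x ^ a) ^ a * (1 + x ^ s) ^ ?u)"
    by (intro sum.mono_neutral_cong_right) (auto simp: power2_eq_square)
  also have "\<dots> \<le> (\<Sum>a=s..?u. ((real ?u) ^ a)\<^sup>2 * (x ^ a) ^ a * (1 + x ^ s) ^ ?u)"
  proof (intro sum_mono mult_right_mono power_mono)
    fix a assume "a \<in> {s..?u}"
    hence "(?u choose a) \<le> ?u ^ a" by (intro binomial_le_pow) auto
    thus "real (?u choose a) \<le> real ?u ^ a" by (metis of_nat_le_iff of_nat_power)
  qed (use assms in auto)
  also have "\<dots> = (1 + x ^ s) ^ ?u * (\<Sum>a=s..?u. ((real ?u)\<^sup>2 * x ^ a) ^ a)"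
    by (simp add: sum_distrib_left power_mult_distrib power_mult[symmetric] mult_ac)
  finally show ?thesis by simp
qed

text \<open>Complete the square: with l = ln u and w = ln (1/x), the exponent
  \<open>a * (2 * l - a * w)\<close> is at most l^2 / w. The sum is thus only quasi-polynomial in
  \<open>u\<close>, harmless against any exponential in \<open>u\<close>.\<close>

lemma sum_power_gaussian_le:
  assumes "0 < x" "x < 1" "1 \<le> u" "1 \<le> s"
  shows "(\<Sum>a=s..u. ((real u)\<^sup>2 * x ^ a) ^ a) \<le> u * exp ((ln u)\<^sup>2 / ln (1 / x))"
proof -
  define w where "w = ln (1 / x)"
  define l where "l = ln (real u)"
  have w: "0 < w" using assms by (simp add: w_def)
  have "((real u)\<^sup>2 * x ^ a) ^ a \<le> exp (l\<^sup>2 / w)" for a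
  proof -
    have ex: "x = exp (- w)" "real u = exp l" using assms by (auto simp: w_def l_def ln_div)
    have "((real u)\<^sup>2 * x ^ a) ^ a = exp (real a * (2 * l - real a * w))"
      unfolding ex by (simp add: exp_of_nat_mult[symmetric] exp_add[symmetric] power2_eq_square algebra_simps exp_of_nat2_mult[symmetric])
    also have "real a * (2 * l - real a * w) = l\<^sup>2 / w - (l - real a * w)\<^sup>2 / w"
      using w by (simp add: field_simps power2_eq_square)
    also have "\<dots> \<le> l\<^sup>2 / w" using w by simp
    finally show ?thesis by simp
  qed
  hence "(\<Sum>a=s..u. ((real u)\<^sup>2 * x ^ a) ^ a) \<le> (\<Sum>a=s..u. exp (l\<^sup>2 / w))" by (intro sum_mono)
  also have "\<dots> = real (Suc u - s) * exp (l\<^sup>2 / w)" by simp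
  also have "\<dots> \<le> u * exp (l\<^sup>2 / w)" using assms by (intro mult_right_mono) auto
  finally show ?thesis by (simp add: l_def w_def)
qed

section \<open>Probability that an induced subgraph has a partition of given length\<close>

lemma card_pairs_in:
  assumes "U \<subseteq> {..<n}"
  shows "card {e \<in> all_edges n. e \<subseteq> U} = card U choose 2"
proof -
  have "{e \<in> all_edges n. e \<subseteq> U} = {e. e \<subseteq> U \<and> card e = 2}" using assms by (auto simp: all_edges_eq)
  thus ?thesis using n_subsets[of U 2] assms finite_subset by auto
qed

lemma bpart_card:
  assumes "is_biclique_partition n F L" "set L \<subseteq> biq U s" "finite U" "finite F"
  shows "card F = sum_list (map (\<lambda>(A, B). card A * card B) L)"
  using assms
proof (induction L arbitrary: F)
  case (Cons x L)
  obtain A B where x: "x = (A, B)" by (cases x)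
  have *: "is_biclique n F x" "is_biclique_partition n (F - biclique_edges x) L"
    using Cons.prems by (auto simp: bpart_Cons)
  have AB: "A \<subseteq> U" "B \<subseteq> U" "A \<inter> B = {}" using Cons.prems by (auto simp: x biq_def)
  have "card (biclique_edges x) = card A * card B"
    unfolding x using AB Cons.prems finite_subset by (intro card_biclique_edges) auto
  moreover have "card (F - biclique_edges x) = sum_list (map (\<lambda>(A, B). card A * card B) L)"
    using Cons * by auto
  moreover have "biclique_edges x \<subseteq> F" using * by (simp add: is_biclique_def)
  hence "card F = card (F - biclique_edges x) + card (biclique_edges x)"
    using Cons.prems by (metis card_Diff_subset card_mono finite_subset le_add_diff_inverse2)
  ultimately show ?case by (simp add: x)
qed (simp add: bpart_Nil)

lemma prod_list_power_map:
  "prod_list (map (\<lambda>x. (a::real) ^ f x) L) = a ^ sum_list (map f L)"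
  by (induction L) (simp_all add: power_add)

lemma pr_induced_eq:
  assumes "0 \<le> p" "p \<le> 1" "U \<subseteq> {..<n}" "F \<subseteq> {e \<in> all_edges n. e \<subseteq> U}"
  shows "pr n p (\<lambda>E. {e \<in> E. e \<subseteq> U} = F) = p ^ card F * (1 - p) ^ ((card U choose 2) - card F)"
proof -
  let ?P = "{e \<in> all_edges n. e \<subseteq> U}"
  have "pr n p (\<lambda>E. {e \<in> E. e \<subseteq> U} = F) = pr n p (\<lambda>E. F \<subseteq> E \<and> (?P - F) \<inter> E = {})"
    using assms by (intro bexp_cong refl arg_cong[where f = of_bool]) auto
  also have "\<dots> = p ^ card F * (1 - p) ^ card (?P - F)"
    using assms by (intro bexp_pattern) auto
  also have "card (?P - F) = (card U choose 2) - card F"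
    using assms card_pairs_in[OF assms(3)] by (subst card_Diff_subset) (auto intro: finite_subset)
  finally show ?thesis .
qed

text \<open>A list determines the induced edge set F, so its probability is (1-p)^(number of pairs)
  times (p/(1-p))^|F|, and |F| is the sum of the products of the side sizes.\<close>

lemma pr_bpart_induced_le:
  assumes p: "0 < p" "p < 1" and U: "U \<subseteq> {..<n}"
  shows "pr n p (\<lambda>E. \<exists>L. length L = k \<and> set L \<subseteq> biq U 2 \<and> is_biclique_partition n {e \<in> E. e \<subseteq> U} L)
    \<le> (1 - p) ^ (card U choose 2) * biq_weight U 2 (p / (1 - p)) ^ k"
proof -
  let ?q = "p / (1 - p)" and ?c = "\<lambda>(A, B). card A * card (B::nat set) :: nat"
  let ?T = "{L. set L \<subseteq> biq U 2 \<and> length L = k}"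
  have finU: "finite U" using U finite_subset by auto
  have finT: "finite ?T" using finite_biq[OF finU] by (intro finite_lists_length_eq)
  have one: "pr n p (\<lambda>E. is_biclique_partition n {e \<in> E. e \<subseteq> U} L) \<le>
      (1 - p) ^ (card U choose 2) * prod_list (map (\<lambda>(A, B). ?q ^ (card A * card B)) L)" if L: "L \<in> ?T" for L
  proof (cases "\<exists>E0\<subseteq>all_edges n. is_biclique_partition n {e \<in> E0. e \<subseteq> U} L")
    case True
    then obtain E0 where E0: "E0 \<subseteq> all_edges n" "is_biclique_partition n {e \<in> E0. e \<subseteq> U} L" by blast
    define F where "F = {e \<in> E0. e \<subseteq> U}"
    have F: "F \<subseteq> {e \<in> all_edges n. e \<subseteq> U}" using E0 by (auto simp: F_def)
    have finF: "finite F" using F by (rule finite_subset) auto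
    have cF: "card F = sum_list (map ?c L)"
      using bpart_card[of n F L U 2] E0 L finU finF unfolding F_def by auto
    have le: "card F \<le> card U choose 2"
      using card_mono[OF _ F] card_pairs_in[OF U] by auto
    have "pr n p (\<lambda>E. is_biclique_partition n {e \<in> E. e \<subseteq> U} L) \<le> pr n p (\<lambda>E. {e \<in> E. e \<subseteq> U} = F)"
    proof (intro pr_mono)
      fix E assume "is_biclique_partition n {e \<in> E. e \<subseteq> U} L"
      thus "{e \<in> E. e \<subseteq> U} = F" unfolding F_def using bpart_Union E0(2) by metis
    qed (use p in auto)
    also have "\<dots> = p ^ card F * (1 - p) ^ ((card U choose 2) - card F)"
      using p U F by (intro pr_induced_eq) auto
    also have "\<dots> = (1 - p) ^ (card U choose 2) * ?q ^ card F"
      using p le by (simp add: power_diff field_simps)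
    also have "?q ^ card F = prod_list (map (\<lambda>x. ?q ^ ?c x) L)" unfolding cF prod_list_power_map ..
    finally show ?thesis by (simp add: case_prod_beta')
  next
    case False
    hence "pr n p (\<lambda>E. is_biclique_partition n {e \<in> E. e \<subseteq> U} L) = bexp (all_edges n) p (\<lambda>_. 0)"
      by (intro bexp_cong) auto
    moreover have "0 \<le> prod_list (map (\<lambda>(A, B). ?q ^ (card A * card B)) L)"
      using p by (intro prod_list_nonneg) auto
    ultimately show ?thesis using p by simp
  qed
  have "pr n p (\<lambda>E. \<exists>L. length L = k \<and> set L \<subseteq> biq U 2 \<and> is_biclique_partition n {e \<in> E. e \<subseteq> U} L) \<le>
     pr n p (\<lambda>E. \<exists>L\<in>?T. is_biclique_partition n {e \<in> E. e \<subseteq> U} L)"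
    using p by (intro pr_mono) auto
  also have "\<dots> \<le> (\<Sum>L\<in>?T. pr n p (\<lambda>E. is_biclique_partition n {e \<in> E. e \<subseteq> U} L))"
    using p finT by (intro pr_UN_le) auto
  also have "\<dots> \<le> (\<Sum>L\<in>?T. (1 - p) ^ (card U choose 2) * prod_list (map (\<lambda>(A, B). ?q ^ (card A * card B)) L))"
    by (intro sum_mono one)
  also have "\<dots> = (1 - p) ^ (card U choose 2) * biq_weight U 2 ?q ^ k"
    unfolding biq_weight_def by (simp add: sum_distrib_left[symmetric] sum_prod_list_lists[OF finite_biq[OF finU]])
  finally show ?thesis .
qed

lemma pr_starless_core_le:
  assumes p: "0 < p" "p < 1/2"
  shows "pr n p (\<lambda>E. \<exists>U L. U \<subseteq> {..<n} \<and> card U = u \<and> length L = k \<and> set L \<subseteq> biq U 2 \<and>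
       is_biclique_partition n {e \<in> E. e \<subseteq> U} L)
    \<le> real (n choose u) * (1 - p) ^ (u choose 2) *
      ((1 + (p / (1 - p))\<^sup>2) ^ u * (\<Sum>a=2..u. ((real u)\<^sup>2 * (p / (1 - p)) ^ a) ^ a)) ^ k"
proof -
  let ?q = "p / (1 - p)"
  let ?I = "{U. U \<subseteq> {..<n} \<and> card U = u}"
  let ?M = "(1 + ?q\<^sup>2) ^ u * (\<Sum>a=2..u. ((real u)\<^sup>2 * ?q ^ a) ^ a)"
  have lam: "0 \<le> ?q" "?q \<le> 1" using p by auto
  have fin: "finite ?I" by (rule finite_subset[of _ "Pow {..<n}"]) auto
  have "pr n p (\<lambda>E. \<exists>U L. U \<subseteq> {..<n} \<and> card U = u \<and> length L = k \<and> set L \<subseteq> biq U 2 \<and>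
       is_biclique_partition n {e \<in> E. e \<subseteq> U} L) \<le>
     pr n p (\<lambda>E. \<exists>U\<in>?I. \<exists>L. length L = k \<and> set L \<subseteq> biq U 2 \<and> is_biclique_partition n {e \<in> E. e \<subseteq> U} L)"
    using p by (intro pr_mono) auto
  also have "\<dots> \<le> (\<Sum>U\<in>?I. pr n p (\<lambda>E. \<exists>L. length L = k \<and> set L \<subseteq> biq U 2 \<and> is_biclique_partition n {e \<in> E. e \<subseteq> U} L))"
    using p fin by (intro pr_UN_le) auto
  also have "\<dots> \<le> (\<Sum>U\<in>?I. (1 - p) ^ (u choose 2) * ?M ^ k)"
  proof (intro sum_mono)
    fix U assume U: "U \<in> ?I"
    hence "finite U" using finite_subset by auto
    hence "biq_weight U 2 ?q \<le> ?M" using biq_weight_le[of U ?q 2] lam U by auto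
    hence "biq_weight U 2 ?q ^ k \<le> ?M ^ k" using biq_weight_nonneg lam by (intro power_mono) auto
    hence "(1 - p) ^ (u choose 2) * biq_weight U 2 ?q ^ k \<le> (1 - p) ^ (u choose 2) * ?M ^ k"
      using p by (intro mult_left_mono) auto
    moreover have "pr n p (\<lambda>E. \<exists>L. length L = k \<and> set L \<subseteq> biq U 2 \<and> is_biclique_partition n {e \<in> E. e \<subseteq> U} L)
        \<le> (1 - p) ^ (u choose 2) * biq_weight U 2 ?q ^ k"
      using pr_bpart_induced_le[of p U n k] p U by auto
    ultimately show "pr n p (\<lambda>E. \<exists>L. length L = k \<and> set L \<subseteq> biq U 2 \<and> is_biclique_partition n {e \<in> E. e \<subseteq> U} L)
        \<le> (1 - p) ^ (u choose 2) * ?M ^ k"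
      by (rule order_trans[rotated])
  qed
  also have "\<dots> = real (n choose u) * (1 - p) ^ (u choose 2) * ?M ^ k"
    using n_subsets[of "{..<n}" u] by simp
  finally show ?thesis .
qed

section \<open>The independence number\<close>

definition expected_indep :: "nat \<Rightarrow> real \<Rightarrow> nat \<Rightarrow> real" where
  "expected_indep n p r = real (n choose r) * (1 - p) ^ (r choose 2)"

lemma pr_independent:
  assumes "S \<subseteq> {..<n}"
  shows "pr n p (\<lambda>E. independent E S) = (1 - p) ^ (card S choose 2)"
proof -
  have "pr n p (\<lambda>E. independent E S) = pr n p (\<lambda>E. {} \<subseteq> E \<and> {e \<in> all_edges n. e \<subseteq> S} \<inter> E = {})"
    by (intro bexp_cong refl arg_cong[where f = of_bool]) (auto simp: independent_iff)
  also have "\<dots> = p ^ card ({}::nat set set) * (1 - p) ^ card {e \<in> all_edges n. e \<subseteq> S}"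
    by (intro bexp_pattern) auto
  finally show ?thesis using card_pairs_in[OF assms] by simp
qed

lemma pr_independent2:
  assumes "S \<subseteq> {..<n}" "T \<subseteq> {..<n}" "p < 1" "card S = s" "card T = s"
  shows "pr n p (\<lambda>E. independent E S \<and> independent E T) =
     ((1 - p) ^ (s choose 2))\<^sup>2 / (1 - p) ^ (card (S \<inter> T) choose 2)"
proof -
  let ?F = "\<lambda>S. {e \<in> all_edges n. e \<subseteq> S}"
  have ST: "S \<inter> T \<subseteq> {..<n}" using assms by auto
  have "pr n p (\<lambda>E. independent E S \<and> independent E T) = pr n p (\<lambda>E. {} \<subseteq> E \<and> (?F S \<union> ?F T) \<inter> E = {})"
    by (intro bexp_cong refl arg_cong[where f = of_bool]) (auto simp: independent_iff)
  also have "\<dots> = p ^ card ({}::nat set set) * (1 - p) ^ card (?F S \<union> ?F T)"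
    by (intro bexp_pattern) auto
  finally have 1: "pr n p (\<lambda>E. independent E S \<and> independent E T) = (1 - p) ^ card (?F S \<union> ?F T)" by simp
  have "?F S \<inter> ?F T = ?F (S \<inter> T)" by auto
  hence "card (?F S \<union> ?F T) + (card (S \<inter> T) choose 2) = 2 * (s choose 2)"
    using card_Un_Int[of "?F S" "?F T"] card_pairs_in[OF assms(1)] card_pairs_in[OF assms(2)]
      card_pairs_in[OF ST] assms by simp
  hence "(1 - p) ^ card (?F S \<union> ?F T) * (1 - p) ^ (card (S \<inter> T) choose 2) = ((1 - p) ^ (s choose 2))\<^sup>2"
    by (simp only: power_add[symmetric] power_mult[symmetric]) (simp add: mult.commute)
  thus ?thesis using 1 assms by (simp add: field_simps)
qed

lemma pr_alpha_ge_le: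
  assumes "0 \<le> p" "p \<le> 1"
  shows "pr n p (\<lambda>E. r \<le> alpha n E) \<le> expected_indep n p r"
proof -
  let ?I = "{S. S \<subseteq> {..<n} \<and> card S = r}"
  have fin: "finite ?I" by (rule finite_subset[of _ "Pow {..<n}"]) auto
  have "pr n p (\<lambda>E. r \<le> alpha n E) \<le> pr n p (\<lambda>E. \<exists>S\<in>?I. independent E S)"
  proof (intro pr_mono assms)
    fix E assume "r \<le> alpha n E"
    obtain S where S: "S \<subseteq> {..<n}" "independent E S" "card S = alpha n E" using alpha_attained by blast
    obtain T where "T \<subseteq> S" "card T = r" using obtain_subset_with_card_n[of r S] \<open>r \<le> alpha n E\<close> S by auto
    thus "\<exists>S\<in>?I. independent E S" using S by (intro bexI[of _ T]) (auto simp: independent_def)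
  qed
  also have "\<dots> \<le> (\<Sum>S\<in>?I. pr n p (\<lambda>E. independent E S))" by (intro pr_UN_le assms fin)
  also have "\<dots> = (\<Sum>S\<in>?I. (1 - p) ^ (r choose 2))" by (intro sum.cong refl) (auto simp: pr_independent)
  also have "\<dots> = expected_indep n p r" using n_subsets[of "{..<n}" r] by (simp add: expected_indep_def)
  finally show ?thesis .
qed

section \<open>Second moment over independent sets, by overlap\<close>

lemma card_overlap:
  assumes "finite V" "S \<subseteq> V" "l \<le> s"
  shows "card {T. T \<subseteq> V \<and> card T = s \<and> card (S \<inter> T) = l} = (card S choose l) * ((card V - card S) choose (s - l))"
proof -
  let ?A = "{A. A \<subseteq> S \<and> card A = l}" and ?B = "{B. B \<subseteq> V - S \<and> card B = s - l}"
  have finS: "finite S" using assms finite_subset by auto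
  have "bij_betw (\<lambda>(A, B). A \<union> B) (?A \<times> ?B) {T. T \<subseteq> V \<and> card T = s \<and> card (S \<inter> T) = l}"
  proof (rule bij_betw_byWitness[where f' = "\<lambda>T. (S \<inter> T, T - S)"])
    show "\<forall>a\<in>?A \<times> ?B. (\<lambda>T. (S \<inter> T, T - S)) ((\<lambda>(A, B). A \<union> B) a) = a" by auto
    show "\<forall>a'\<in>{T. T \<subseteq> V \<and> card T = s \<and> card (S \<inter> T) = l}. (\<lambda>(A, B). A \<union> B) ((\<lambda>T. (S \<inter> T, T - S)) a') = a'"
      by auto
    show "(\<lambda>(A, B). A \<union> B) ` (?A \<times> ?B) \<subseteq> {T. T \<subseteq> V \<and> card T = s \<and> card (S \<inter> T) = l}"
    proof clarify
      fix A B assume AB: "A \<subseteq> S" "l = card A" "B \<subseteq> V - S" "card B = s - card A"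
      have "finite A" "finite B" using AB assms finite_subset[of A S] finite_subset[of B V] finS by auto
      moreover have "A \<inter> B = {}" "S \<inter> (A \<union> B) = A" using AB by auto
      ultimately show "A \<union> B \<subseteq> V \<and> card (A \<union> B) = s \<and> card (S \<inter> (A \<union> B)) = card A"
        using AB assms by (auto simp: card_Un_disjoint)
    qed
    show "(\<lambda>T. (S \<inter> T, T - S)) ` {T. T \<subseteq> V \<and> card T = s \<and> card (S \<inter> T) = l} \<subseteq> ?A \<times> ?B"
    proof (rule image_subsetI)
      fix T assume "T \<in> {T. T \<subseteq> V \<and> card T = s \<and> card (S \<inter> T) = l}"
      hence T: "T \<subseteq> V" "card T = s" "card (S \<inter> T) = l" by auto
      hence "finite T" using assms finite_subset by auto
      hence "card (T - S) = s - l" using T by (simp add: card_Diff_subset_Int Int_commute)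
      thus "(S \<inter> T, T - S) \<in> ?A \<times> ?B" using T by auto
    qed
  qed
  from bij_betw_same_card[OF this, symmetric]
  have "card {T. T \<subseteq> V \<and> card T = s \<and> card (S \<inter> T) = l} = card ?A * card ?B"
    by (simp add: card_cartesian_product)
  also have "card ?A = card S choose l" using n_subsets[OF finS] .
  also have "card ?B = (card V - card S) choose (s - l)"
    using n_subsets[of "V - S" "s - l"] assms by (simp add: card_Diff_subset finS)
  finally show ?thesis .
qed

text \<open>Two s-sets with overlap \<open>l\<close> share \<open>l choose 2\<close> pairs. The 1
  subtracted in Chebyshev's inequality is, by Vandermonde, the sum of the hypergeometric
  probabilities, so overlaps below 2, which share no pair, cancel.\<close>

lemma pr_alpha_less_le:
  assumes p: "0 < p" "p < 1" and s: "s \<le> n"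
  shows "pr n p (\<lambda>E. alpha n E < s) \<le>
    (\<Sum>l=2..s. real (s choose l) * real ((n - s) choose (s - l)) / real (n choose s) / (1 - p) ^ (l choose 2))"
proof -
  let ?I = "{S. S \<subseteq> {..<n} \<and> card S = s}"
  define w where "w = (1 - p) ^ (s choose 2)"
  define h where "h l = real (s choose l) * real ((n - s) choose (s - l))" for l
  define m where "m = real (n choose s)"
  have w: "0 < w" using p by (simp add: w_def)
  have m: "0 < m" using s by (simp add: m_def zero_less_binomial)
  have fin: "finite ?I" by (rule finite_subset[of _ "Pow {..<n}"]) auto
  have cI: "real (card ?I) = m" using n_subsets[of "{..<n}" s] by (simp add: m_def)
  have expected_indep: "m * w = (\<Sum>S\<in>?I. pr n p (\<lambda>E. independent E S))"
  proof -
    have "(\<Sum>S\<in>?I. pr n p (\<lambda>E. independent E S)) = (\<Sum>S\<in>?I. w)"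
      by (intro sum.cong refl) (auto simp: pr_independent w_def)
    thus ?thesis using cI by simp
  qed
  have inner: "(\<Sum>T\<in>?I. pr n p (\<lambda>E. independent E S \<and> independent E T)) = (\<Sum>l\<le>s. h l * (w\<^sup>2 / (1 - p) ^ (l choose 2)))"
    if S: "S \<in> ?I" for S
  proof -
    have "(\<Sum>T\<in>?I. pr n p (\<lambda>E. independent E S \<and> independent E T)) =
        (\<Sum>T\<in>?I. w\<^sup>2 / (1 - p) ^ (card (S \<inter> T) choose 2))"
      using S p unfolding w_def by (intro sum.cong refl pr_independent2) auto
    also have "\<dots> = (\<Sum>l\<le>s. \<Sum>T\<in>{T. T \<in> ?I \<and> card (S \<inter> T) = l}. w\<^sup>2 / (1 - p) ^ (card (S \<inter> T) choose 2))"
    proof (rule sum.group[symmetric, OF fin])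
      have "card (S \<inter> T) \<le> card S" for T using S finite_subset[of S "{..<n}"] by (intro card_mono) auto
      thus "(\<lambda>T. card (S \<inter> T)) ` ?I \<subseteq> {..s}" using S by auto
    qed simp
    also have "\<dots> = (\<Sum>l\<le>s. h l * (w\<^sup>2 / (1 - p) ^ (l choose 2)))"
    proof (intro sum.cong refl)
      fix l assume "l \<in> {..s}"
      hence "real (card {T. T \<in> ?I \<and> card (S \<inter> T) = l}) = h l"
        using card_overlap[of "{..<n}" S l s] S by (simp add: h_def conj_assoc)
      thus "(\<Sum>T\<in>{T. T \<in> ?I \<and> card (S \<inter> T) = l}. w\<^sup>2 / (1 - p) ^ (card (S \<inter> T) choose 2)) =
          h l * (w\<^sup>2 / (1 - p) ^ (l choose 2))" by simp
    qed
    finally show ?thesis .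
  qed
  have sumh: "(\<Sum>l\<le>s. h l) = m"
  proof -
    have "(\<Sum>l\<le>s. h l) = real (\<Sum>l\<le>s. (s choose l) * ((n - s) choose (s - l)))" by (simp add: h_def)
    also have "(\<Sum>l\<le>s. (s choose l) * ((n - s) choose (s - l))) = (s + (n - s)) choose s"
      by (rule vandermonde)
    finally show ?thesis using s by (simp add: m_def)
  qed
  have "pr n p (\<lambda>E. alpha n E < s) \<le> pr n p (\<lambda>E. \<forall>S\<in>?I. \<not> independent E S)"
  proof (rule pr_mono)
    fix E assume less: "alpha n E < s"
    show "\<forall>S\<in>?I. \<not> independent E S"
    proof
      fix S assume "S \<in> ?I"
      thus "\<not> independent E S" using alpha_ge[of S n E] less by auto
    qed
  qed (use p in auto)
  also have "\<dots> \<le> (\<Sum>S\<in>?I. \<Sum>T\<in>?I. pr n p (\<lambda>E. independent E S \<and> independent E T)) / (m * w)\<^sup>2 - 1"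
    using p fin m w by (intro second_moment_none expected_indep) auto
  also have "(\<Sum>S\<in>?I. \<Sum>T\<in>?I. pr n p (\<lambda>E. independent E S \<and> independent E T)) =
      m * (\<Sum>l\<le>s. h l * (w\<^sup>2 / (1 - p) ^ (l choose 2)))" using inner cI by simp
  also have "\<dots> / (m * w)\<^sup>2 - 1 = (\<Sum>l\<le>s. h l / m / (1 - p) ^ (l choose 2)) - (\<Sum>l\<le>s. h l) / m"
    using m w unfolding sumh by (simp add: power_mult_distrib power2_eq_square sum_divide_distrib sum_distrib_left field_simps)
  also have "\<dots> = (\<Sum>l\<le>s. h l / m * (1 / (1 - p) ^ (l choose 2) - 1))"
    by (simp add: sum_divide_distrib sum_subtractf[symmetric] algebra_simps)
  also have "\<dots> = (\<Sum>l\<in>{2..s}. h l / m * (1 / (1 - p) ^ (l choose 2) - 1))"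
  proof (intro sum.mono_neutral_right ballI)
    fix l assume "l \<in> {..s} - {2..s}"
    hence "l < 2" by auto
    hence "l choose 2 = 0" by (rule binomial_eq_0)
    thus "h l / m * (1 / (1 - p) ^ (l choose 2) - 1) = 0" by (simp only:) simp
  qed auto
  also have "\<dots> \<le> (\<Sum>l\<in>{2..s}. h l / m / (1 - p) ^ (l choose 2))"
    using m by (intro sum_mono) (auto simp: h_def field_simps)
  finally show ?thesis by (simp add: h_def m_def)
qed

text \<open>Replacing \<open>n - s\<close> by \<open>n - l\<close> gives the probability that a
  random s-set contains \<open>l\<close> given elements. This is a product of ratios (s-i)/(n-i),
  each at most s/n.\<close>

lemma choose_ratio_le:
  assumes "l \<le> s" "s \<le> n"
  shows "real ((n - s) choose (s - l)) / real (n choose s) \<le> (real s / real n) ^ l"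
proof -
  have key: "real (s choose l) * real n ^ l \<le> real (n choose l) * real s ^ l" if "s \<le> n" for l
  proof (induction l)
    case (Suc l)
    have r: "real (m choose Suc l) * real (Suc l) = real (m choose l) * (real m - real l)" for m
    proof (cases "l \<le> m")
      case True
      have "(m choose Suc l) * Suc l = (m choose l) * (m - l)"
        using binomial_absorb_comp[of m l] binomial_absorption[of l m] by (simp add: mult.commute)
      hence "real ((m choose Suc l) * Suc l) = real ((m choose l) * (m - l))" by (rule arg_cong)
      thus ?thesis using True by (simp only: of_nat_mult of_nat_diff)
    qed (simp add: binomial_eq_0)
    show ?case
    proof (cases "l \<le> s")
      case True
      have "real (s choose Suc l) * real (Suc l) * real n ^ Suc l =
          (real (s choose l) * real n ^ l) * ((real s - real l) * real n)" unfolding r by simp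
      also have "\<dots> \<le> (real (n choose l) * real s ^ l) * ((real n - real l) * real s)"
      proof (rule mult_mono[OF Suc.IH])
        have "real l * real s \<le> real l * real n" using that by (intro mult_left_mono) auto
        thus "(real s - real l) * real n \<le> (real n - real l) * real s" by (simp add: algebra_simps)
      qed (use True in auto)
      also have "\<dots> = real (n choose Suc l) * real (Suc l) * real s ^ Suc l" unfolding r by simp
      finally have "real (Suc l) * (real (s choose Suc l) * real n ^ Suc l) \<le> real (Suc l) * (real (n choose Suc l) * real s ^ Suc l)"
        by (simp only: mult_ac)
      thus ?thesis by (simp only: mult_le_cancel_left_pos of_nat_0_less_iff zero_less_Suc)
    qed (simp add: binomial_eq_0)
  qed simp
  show ?thesis
  proof (cases "n = 0")
    case False
    have pos: "0 < real (n choose s)" "0 < real (n choose l)" "0 < real (s choose l)" using assms by auto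
    have "(n choose s) * (s choose l) = (n choose l) * ((n - l) choose (s - l))"
      using assms by (intro choose_mult) auto
    hence e: "real (n choose s) * real (s choose l) = real (n choose l) * real ((n - l) choose (s - l))"
      by (metis of_nat_mult)
    have "real ((n - s) choose (s - l)) \<le> real ((n - l) choose (s - l))"
      using assms by (simp add: binomial_right_mono)
    hence "real ((n - s) choose (s - l)) / real (n choose s) \<le> real ((n - l) choose (s - l)) / real (n choose s)"
      using pos by (intro divide_right_mono) auto
    also have "\<dots> = real (s choose l) / real (n choose l)" using e pos by (simp add: field_simps)
    also have "\<dots> \<le> (real s / real n) ^ l" using key[OF assms(2), of l] pos False
      by (simp add: field_simps power_divide)
    finally show ?thesis .
  qed (use assms in simp)
qed

lemma two_times_choose_two: "2 * (l choose 2) = l * (l - 1)"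
proof -
  have "even (l * (l - 1))" by (cases l) auto
  thus ?thesis unfolding choose_two by simp
qed

lemma geometric_sum_le:
  fixes x :: real
  assumes "0 \<le> x" "x \<le> 1 / 2"
  shows "(\<Sum>l\<in>{1..m}. x ^ l) \<le> 2 * x"
proof -
  have "(\<Sum>l\<in>{1..m}. x ^ l) = x * (\<Sum>l<m. x ^ l)"
    by (simp add: sum.atLeast1_atMost_eq sum_distrib_left)
  also have "(\<Sum>l<m. x ^ l) = (1 - x ^ m) / (1 - x)" using assms by (subst sum_gp_strict) auto
  also have "\<dots> \<le> 1 / (1 / 2)" using assms by (intro frac_le) auto
  finally show ?thesis using assms by (simp add: mult_left_mono)
qed

text \<open>Three ranges of the overlap \<open>l\<close>, each compared with a geometric series. Up
  to s/3, \<open>s choose l\<close> is bounded by s^l; in the middle by 2^s, hence by 8^l; near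
  \<open>s\<close> everything is expressed through \<open>j = s - l\<close> and measured against
  full overlap, whose term is 1 / \<open>expected_indep n p s\<close>.\<close>

lemma pr_alpha_less_explicit:
  assumes p: "0 < p" "p < 1" and s: "1 \<le> s" "s \<le> n"
    and y: "y = 1 / sqrt (1 - p)"
    and x1: "\<And>l. 3 * l \<le> s \<Longrightarrow> 1 \<le> l \<Longrightarrow> (real s)\<^sup>2 / real n * y ^ (l - 1) \<le> x1" "0 \<le> x1" "x1 \<le> 1/2"
    and x2: "\<And>l. real l \<le> (1 - z) * real s \<Longrightarrow> 1 \<le> l \<Longrightarrow> 8 * real s / real n * y ^ (l - 1) \<le> x2" "0 \<le> x2" "x2 \<le> 1/2"
    and x3: "\<And>j. real j < z * real s \<Longrightarrow> j \<le> s \<Longrightarrow> real s * real n / y ^ (2 * s - j - 1) \<le> x3" "0 \<le> x3" "x3 \<le> 1/2"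
  shows "pr n p (\<lambda>E. alpha n E < s) \<le> 2 * x1 + 2 * x2 + 2 / expected_indep n p s"
proof -
  have y0: "0 < y" using p y by simp
  have y2: "y\<^sup>2 = 1 / (1 - p)" using p unfolding y by (simp add: power_divide)
  have ypow: "1 / (1 - p) ^ (l choose 2) = y ^ (l * (l - 1))" for l
  proof -
    have "l * (l - 1) = 2 * (l choose 2)" by (simp only: two_times_choose_two)
    hence "y ^ (l * (l - 1)) = (y\<^sup>2) ^ (l choose 2)" by (simp add: power_mult)
    thus ?thesis unfolding y2 by (simp add: power_divide)
  qed
  have mupos: "0 < expected_indep n p s" unfolding expected_indep_def using p s by (simp add: zero_less_binomial)
  let ?t = "\<lambda>l. real (s choose l) * real ((n - s) choose (s - l)) / real (n choose s) / (1 - p) ^ (l choose 2)"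
  have tb: "?t l \<le> x1 ^ l + x2 ^ l + x3 ^ (s - l) / expected_indep n p s" if l: "l \<in> {2..s}" for l
  proof -
    have nn: "0 \<le> x1 ^ l" "0 \<le> x2 ^ l" "0 \<le> x3 ^ (s - l) / expected_indep n p s" using x1 x2 x3 mupos by auto
    have A: "?t l \<le> real (s choose l) * (real s / real n * y ^ (l - 1)) ^ l"
    proof -
      have "?t l = real (s choose l) * (real ((n - s) choose (s - l)) / real (n choose s)) * y ^ (l * (l - 1))"
        unfolding ypow[symmetric] by simp
      also have "\<dots> \<le> real (s choose l) * (real s / real n) ^ l * y ^ (l * (l - 1))"
        using l s y0 by (intro mult_right_mono mult_left_mono choose_ratio_le) auto
      also have "\<dots> = real (s choose l) * (real s / real n * y ^ (l - 1)) ^ l"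
        unfolding power_mult_distrib power_mult[symmetric] by (simp add: mult.commute)
      finally show ?thesis .
    qed
    consider "3 * l \<le> s" | "s < 3 * l" "real l \<le> (1 - z) * real s" | "(1 - z) * real s < real l" by linarith
    thus ?thesis
    proof cases
      case 1
      have "(s choose l) \<le> s ^ l" using l by (intro binomial_le_pow) auto
      hence "real (s choose l) \<le> real s ^ l" by (metis of_nat_le_iff of_nat_power)
      hence "real (s choose l) * (real s / real n * y ^ (l - 1)) ^ l \<le> real s ^ l * (real s / real n * y ^ (l - 1)) ^ l"
        using y0 by (intro mult_right_mono) auto
      also have "\<dots> = ((real s)\<^sup>2 / real n * y ^ (l - 1)) ^ l"
        by (simp add: power_mult_distrib[symmetric] power2_eq_square mult.assoc)
      also have "\<dots> \<le> x1 ^ l" using x1(1)[OF 1] l y0 by (intro power_mono) auto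
      finally show ?thesis using A nn by linarith
    next
      case 2
      have "(s choose l) \<le> 2 ^ s" using binomial_le_pow2 by blast
      also have "(2::nat) ^ s \<le> 2 ^ (3 * l)" using 2 by (intro power_increasing) auto
      also have "(2::nat) ^ (3 * l) = 8 ^ l" by (simp add: power_mult)
      finally have "real (s choose l) \<le> 8 ^ l" by (metis of_nat_le_iff of_nat_power of_nat_numeral)
      hence "real (s choose l) * (real s / real n * y ^ (l - 1)) ^ l \<le> 8 ^ l * (real s / real n * y ^ (l - 1)) ^ l"
        using y0 by (intro mult_right_mono) auto
      also have "\<dots> = (8 * real s / real n * y ^ (l - 1)) ^ l"
        by (simp add: power_mult_distrib[symmetric] mult.assoc)
      also have "\<dots> \<le> x2 ^ l" using x2(1)[OF 2(2)] l y0 by (intro power_mono) auto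
      finally show ?thesis using A nn by linarith
    next
      case 3
      define j where "j = s - l"
      have j: "j \<le> s" "l = s - j" "real j < z * real s" "j < s" using l 3 by (auto simp: j_def algebra_simps)
      \<comment> \<open>Splits the ordered pairs of an s-set into those inside the overlap and those
        that meet the other \<open>j\<close> elements.\<close>
      have ex: "s * (s - 1) = l * (l - 1) + j * (2 * s - j - 1)"
      proof -
        obtain a where a: "s = j + a" "a = l" using j l by (metis j_def atLeastAtMost_iff le_add_diff_inverse2)
        have "int s * (int s - 1) = int l * (int l - 1) + int j * (2 * int s - int j - 1)"
          using a by (simp add: algebra_simps)
        moreover have "int (s - 1) = int s - 1" "int (l - 1) = int l - 1" "int (2 * s - j - 1) = 2 * int s - int j - 1"
          using j l s by auto
        ultimately have "int (s * (s - 1)) = int (l * (l - 1) + j * (2 * s - j - 1))" by simp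
        thus ?thesis by (simp only: of_nat_eq_iff)
      qed
      have "?t l = real (s choose j) * real ((n - s) choose j) * (y ^ (l * (l - 1)) / y ^ (s * (s - 1))) / expected_indep n p s"
      proof -
        have "real (s choose l) = real (s choose j)" using j binomial_symmetric[of j s] by auto
        moreover have "s - l = j" using j by auto
        moreover have "expected_indep n p s = real (n choose s) / y ^ (s * (s - 1))"
          unfolding expected_indep_def ypow[symmetric] by simp
        moreover have "?t l = real (s choose l) * real ((n - s) choose (s - l)) / real (n choose s) * (1 / (1 - p) ^ (l choose 2))"
          by simp
        ultimately show ?thesis unfolding ypow using y0 by (simp add: field_simps)
      qed
      also have "y ^ (l * (l - 1)) / y ^ (s * (s - 1)) = 1 / (y ^ (2 * s - j - 1)) ^ j"
        unfolding ex using y0 by (simp add: power_add power_mult[symmetric] mult.commute)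
      also have "real (s choose j) * real ((n - s) choose j) * (1 / (y ^ (2 * s - j - 1)) ^ j) / expected_indep n p s \<le>
         (real s ^ j * real n ^ j) * (1 / (y ^ (2 * s - j - 1)) ^ j) / expected_indep n p s"
      proof (intro divide_right_mono mult_right_mono mult_mono)
        have "(s choose j) \<le> s ^ j" using j by (intro binomial_le_pow) auto
        thus "real (s choose j) \<le> real s ^ j" by (metis of_nat_le_iff of_nat_power)
        have "((n - s) choose j) \<le> n choose j" by (intro binomial_right_mono) auto
        also have "\<dots> \<le> n ^ j" using j s by (intro binomial_le_pow) auto
        finally show "real ((n - s) choose j) \<le> real n ^ j" by (metis of_nat_le_iff of_nat_power)
      qed (use y0 mupos in auto)
      also have "\<dots> = (real s * real n / y ^ (2 * s - j - 1)) ^ j / expected_indep n p s"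
        by (simp add: power_mult_distrib power_divide)
      also have "\<dots> \<le> x3 ^ j / expected_indep n p s"
        using x3(1)[OF j(3,1)] y0 mupos by (intro divide_right_mono power_mono) auto
      finally have "?t l \<le> x3 ^ (s - l) / expected_indep n p s" unfolding j_def .
      thus ?thesis using nn by linarith
    qed
  qed
  have "pr n p (\<lambda>E. alpha n E < s) \<le> (\<Sum>l=2..s. ?t l)" by (rule pr_alpha_less_le[OF p s(2)])
  also have "\<dots> \<le> (\<Sum>l=2..s. x1 ^ l + x2 ^ l + x3 ^ (s - l) / expected_indep n p s)" by (intro sum_mono tb)
  also have "\<dots> = (\<Sum>l=2..s. x1 ^ l) + (\<Sum>l=2..s. x2 ^ l) + (\<Sum>l=2..s. x3 ^ (s - l)) / expected_indep n p s"
    by (simp add: sum.distrib sum_divide_distrib)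
  also have "\<dots> \<le> (\<Sum>l=1..s. x1 ^ l) + (\<Sum>l=1..s. x2 ^ l) + (\<Sum>j<s. x3 ^ j) / expected_indep n p s"
  proof (intro add_mono divide_right_mono)
    have "(\<Sum>l=2..s. x3 ^ (s - l)) = (\<Sum>j\<in>(\<lambda>l. s - l) ` {2..s}. x3 ^ j)"
      by (subst sum.reindex) (auto simp: inj_on_def)
    also have "\<dots> \<le> (\<Sum>j<s. x3 ^ j)" using x3 by (intro sum_mono2) auto
    finally show "(\<Sum>l=2..s. x3 ^ (s - l)) \<le> (\<Sum>j<s. x3 ^ j)" .
  qed (use x1 x2 mupos in \<open>auto intro!: sum_mono2\<close>)
  also have "\<dots> \<le> 2 * x1 + 2 * x2 + 2 / expected_indep n p s"
  proof (intro add_mono divide_right_mono geometric_sum_le)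
    have "(\<Sum>j<s. x3 ^ j) = (1 - x3 ^ s) / (1 - x3)" using x3 by (subst sum_gp_strict) auto
    also have "\<dots> \<le> 1 / (1 / 2)" using x3 by (intro frac_le) auto
    finally show "(\<Sum>j<s. x3 ^ j) \<le> 2" by simp
  qed (use x1 x2 mupos in auto)
  finally show ?thesis .
qed

section \<open>The window for the independence number\<close>

lemma power_third_le_fact: "(real s / 3) ^ s \<le> fact s"
proof (induction s)
  case (Suc s)
  show ?case
  proof (cases "s = 0")
    case False
    \<comment> \<open>The induction step loses a factor (1 + 1/s)^s, which is below e; hence 3 in
      this weak form of Stirling's bound.\<close>
    have "(1 + 1 / real s) ^ s \<le> exp (1 / real s) ^ s" by (intro power_mono) (auto simp: add_pos_nonneg)
    also have "\<dots> = exp 1" using False by (simp add: exp_of_nat_mult[symmetric])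
    also have "\<dots> \<le> 3" by (rule exp_le)
    finally have "(1 + 1 / real s) ^ s \<le> 3" .
    moreover have "real (Suc s) = real s * (1 + 1 / real s)" using False by (simp add: field_simps)
    ultimately have "real (Suc s) ^ s \<le> real s ^ s * 3"
      by (simp only: power_mult_distrib) (simp add: mult_left_mono)
    hence "real (Suc s) / 3 * (real (Suc s) ^ s / 3 ^ s) \<le> real (Suc s) / 3 * (real s ^ s * 3 / 3 ^ s)"
      by (intro mult_left_mono divide_right_mono) auto
    hence "(real (Suc s) / 3) ^ Suc s \<le> real (Suc s) * (real s / 3) ^ s"
      by (simp add: power_divide)
    also have "\<dots> \<le> real (Suc s) * fact s" using Suc by (intro mult_left_mono) auto
    finally show ?thesis by simp
  qed simp
qed simp

lemma choose_le_pow_three: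
  assumes "1 \<le> s"
  shows "real (n choose s) \<le> (3 * real n / real s) ^ s"
proof -
  have "(real s / 3) ^ s * real (n choose s) \<le> fact s * real (n choose s)"
    by (intro mult_right_mono power_third_le_fact) auto
  also have "\<dots> = real ((n choose s) * fact s)" by (simp add: mult.commute)
  also have "\<dots> \<le> real (n ^ s)" by (intro of_nat_mono binomial_fact_pow)
  finally show ?thesis using assms by (simp add: power_divide power_mult_distrib field_simps)
qed

text \<open>With y for this number, (1-p)^(r choose 2) is y^(-r(r-1)), free of halves. For constant
  p the independence number is ln n / ln y to leading order.\<close>

abbreviation inv_sqrt_compl :: "real \<Rightarrow> real" where "inv_sqrt_compl p \<equiv> 1 / sqrt (1 - p)"

lemma inv_sqrt_compl_bounds:
  assumes "0 < p" "p \<le> 1/2"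
  shows "1 < inv_sqrt_compl p" "inv_sqrt_compl p \<le> 2" "0 < inv_sqrt_compl p"
proof -
  have "1 / 2 \<le> sqrt (1 - p)" using assms by (intro real_le_rsqrt) (simp add: power2_eq_square)
  moreover have "sqrt (1 - p) < 1" using assms by simp
  moreover have "0 < sqrt (1 - p)" using assms by simp
  ultimately show "1 < inv_sqrt_compl p" "inv_sqrt_compl p \<le> 2" "0 < inv_sqrt_compl p" by (auto simp: field_simps)
qed

lemma one_minus_power_choose_two:
  assumes "p < 1"
  shows "(1 - p) ^ (l choose 2) = 1 / inv_sqrt_compl p ^ (l * (l - 1))"
proof -
  have "inv_sqrt_compl p ^ (l * (l - 1)) = ((inv_sqrt_compl p)\<^sup>2) ^ (l choose 2)"
    by (simp only: two_times_choose_two[symmetric] power_mult)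
  also have "(inv_sqrt_compl p)\<^sup>2 = 1 / (1 - p)" using assms by (simp add: power_divide)
  finally show ?thesis by (simp add: power_divide)
qed

text \<open>The size \<open>s + 1\<close> is the first at which the expected number of independent sets drops to
  \<open>n powr \<epsilon>\<close>; the last two conjuncts pin down \<open>(1 - p) powr (s / 2)\<close> up to constants.\<close>

definition alpha_window :: "nat \<Rightarrow> real \<Rightarrow> real \<Rightarrow> real \<Rightarrow> nat \<Rightarrow> bool" where
  "alpha_window n p \<eta> \<epsilon> s \<longleftrightarrow> 1 \<le> s \<and> Suc s \<le> n \<and> 0 < p \<and> p \<le> 1/2 \<and> real n powr \<epsilon> < expected_indep n p s \<and>
     expected_indep n p (Suc s) \<le> real n powr \<epsilon> \<and> real s \<le> real n powr (1/3 - \<eta>) \<and>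
     inv_sqrt_compl p ^ (s - 1) \<le> 3 * real n / real s \<and> real n / (2 * (real s + 1)) \<le> inv_sqrt_compl p ^ s"

text \<open>Feeds the window into \<open>pr_alpha_less_explicit\<close>. The first two error terms
  come from small and middle overlaps, the third from overlaps near \<open>s\<close>, where the
  expected number of independent sets exceeds n^\<epsilon>.\<close>

lemma alpha_lower:
  assumes "0 < \<eta>" "\<eta> < 1/3" "0 < \<epsilon>"
  shows "\<forall>\<^sub>F n in sequentially. \<forall>p s. alpha_window n p \<eta> \<epsilon> s \<longrightarrow>
    pr n p (\<lambda>E. alpha n E < s) \<le> 4 * real n powr (-1/9) + 48 * real n powr (-(2*\<eta>/3)) + 2 * real n powr (-\<epsilon>)"
proof -
  have e1: "\<forall>\<^sub>F n in sequentially. 2 * real n powr (-1/9) \<le> 1/2" by real_asymp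
  have e2: "\<forall>\<^sub>F n in sequentially. 24 * real n powr (-(2*\<eta>/3)) \<le> 1/2" using assms by real_asymp
  have e3: "\<forall>\<^sub>F n in sequentially. 32 * real n powr (-(2*\<eta>)) \<le> 1/2" using assms by real_asymp
  show ?thesis using e1 e2 e3
  proof eventually_elim
    case (elim n)
    show ?case
    proof (intro allI impI)
      fix p s assume "alpha_window n p \<eta> \<epsilon> s"
      hence r: "1 \<le> s" "Suc s \<le> n" "0 < p" "p \<le> 1/2" "real n powr \<epsilon> < expected_indep n p s"
        "real s \<le> real n powr (1/3 - \<eta>)" "inv_sqrt_compl p ^ (s - 1) \<le> 3 * real n / real s"
        "real n / (2 * (real s + 1)) \<le> inv_sqrt_compl p ^ s" by (auto simp: alpha_window_def)
      define y where "y = inv_sqrt_compl p"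
      define N where "N = real n"
      define S where "S = real s"
      have y: "1 < y" "y \<le> 2" "0 < y" using inv_sqrt_compl_bounds[OF r(3,4)] by (auto simp: y_def)
      have N: "1 < N" "0 < N" "1 \<le> S" "0 < S" "S < N" using r by (auto simp: N_def S_def)
      have S: "S \<le> N powr (1/3 - \<eta>)" "S \<le> N powr (1/3)"
      proof -
        show a: "S \<le> N powr (1/3 - \<eta>)" using r by (simp add: S_def N_def)
        have "N powr (1/3 - \<eta>) \<le> N powr (1/3)" using N assms by (intro powr_mono) auto
        thus "S \<le> N powr (1/3)" using a by linarith
      qed
      have h1: "y ^ (s - 1) \<le> 3 * N / S" using r by (simp add: y_def N_def S_def)
      have h2: "N / (4 * S) \<le> y ^ s"
      proof -
        have "N / (4 * S) \<le> N / (2 * (S + 1))" using N by (intro divide_left_mono) auto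
        thus ?thesis using r by (simp add: y_def N_def S_def)
      qed
      have pl: "pr n p (\<lambda>E. alpha n E < s) \<le> 2 * (2 * N powr (-1/9)) + 2 * (24 * N powr (-(2*\<eta>/3))) + 2 / expected_indep n p s"
      proof (rule pr_alpha_less_explicit[where y = y and z = \<eta> and ?x3.0 = "32 * N powr (-(2*\<eta>))"])
        fix l assume l: "3 * l \<le> s" "1 \<le> l"
        \<comment> \<open>Cubing turns the exponent into 3(l-1), which is at most s-1, and for s-1
          the window bounds the power of y.\<close>
        have "((real s)\<^sup>2 / real n * y ^ (l - 1)) ^ 3 = S ^ 6 / N ^ 3 * y ^ (3 * (l - 1))"
          unfolding N_def S_def by (simp add: power_mult_distrib power_divide power_mult[symmetric] mult.commute)
        also have "\<dots> \<le> S ^ 6 / N ^ 3 * y ^ (s - 1)"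
          using l y N by (intro mult_left_mono power_increasing) auto
        also have "\<dots> \<le> S ^ 6 / N ^ 3 * (3 * N / S)" using h1 N by (intro mult_left_mono) auto
        also have "\<dots> = 3 * S ^ 5 / N\<^sup>2" using N by (simp add: field_simps power2_eq_square eval_nat_numeral)
        also have "\<dots> \<le> 3 * (N powr (1/3)) ^ 5 / N\<^sup>2"
          using S N by (intro divide_right_mono mult_left_mono power_mono) auto
        also have "\<dots> = 3 * N powr (-1/3)"
        proof -
          have "(N powr (1/3)) ^ 5 = N powr (5/3)" using N by (simp add: powr_power)
          moreover have "N\<^sup>2 = N powr 2" using N by (simp add: powr_numeral)
          moreover have "N powr (5/3) / N powr 2 = N powr (5/3 - 2)" by (simp only: powr_diff)
          ultimately show ?thesis by (simp only: times_divide_eq_right[symmetric]) simp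
        qed
        also have "\<dots> \<le> 8 * N powr (-1/3)" by simp
        also have "\<dots> = (2 * N powr (-1/9)) ^ 3" using N by (simp add: powr_power power_mult_distrib)
        finally have "((real s)\<^sup>2 / real n * y ^ (l - 1)) ^ Suc 2 \<le> (2 * N powr (-1/9)) ^ Suc 2" by (simp add: eval_nat_numeral)
        thus "(real s)\<^sup>2 / real n * y ^ (l - 1) \<le> 2 * N powr (-1/9)"
          by (rule power_le_imp_le_base) simp
      next
        fix l assume l: "real l \<le> (1 - \<eta>) * real s" "1 \<le> l"
        have "y ^ (l - 1) = y powr (real l - 1)" using y l by (simp add: powr_realpow[symmetric] of_nat_diff)
        also have "\<dots> \<le> y powr (real (s - 1) * (1 - \<eta>))"
        proof (intro powr_mono)
          show "real l - 1 \<le> real (s - 1) * (1 - \<eta>)"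
            using l r assms by (simp add: of_nat_diff algebra_simps)
        qed (use y in auto)
        also have "\<dots> = (y ^ (s - 1)) powr (1 - \<eta>)" using y by (simp add: powr_powr[symmetric] powr_realpow)
        also have "\<dots> \<le> (3 * (N / S)) powr (1 - \<eta>)" using h1 y assms by (intro powr_mono2) auto
        also have "\<dots> = 3 powr (1 - \<eta>) * (N / S) powr (1 - \<eta>)" using N by (subst powr_mult) auto
        also have "\<dots> \<le> 3 powr 1 * (N / S) powr (1 - \<eta>)"
          using assms by (intro mult_right_mono powr_mono) auto
        finally have "8 * real s / real n * y ^ (l - 1) \<le> 8 * S / N * (3 * (N / S) powr (1 - \<eta>))"
          unfolding N_def S_def by (intro mult_left_mono) auto
        also have "(N / S) powr (1 - \<eta>) = N / S * (N / S) powr (- \<eta>)"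
          using N by (simp add: powr_diff powr_minus field_simps)
        also have "8 * S / N * (3 * (N / S * (N / S) powr (- \<eta>))) = 24 * (N / S) powr (- \<eta>)" using N by simp
        also have "\<dots> \<le> 24 * (N powr (2/3)) powr (- \<eta>)"
        proof (intro mult_left_mono powr_mono2')
          have "N powr (2/3) * S \<le> N powr (2/3) * N powr (1/3)" using S by (intro mult_left_mono) auto
          also have "\<dots> = N" using N by (simp add: powr_add[symmetric])
          finally show "N powr (2/3) \<le> N / S" using N by (simp add: field_simps)
        qed (use assms N in auto)
        also have "\<dots> = 24 * N powr (-(2*\<eta>/3))" by (simp add: powr_powr)
        finally show "8 * real s / real n * y ^ (l - 1) \<le> 24 * N powr (-(2*\<eta>/3))" .
      next
        fix j assume j: "real j < \<eta> * real s" "j \<le> s"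
        have "N / (4 * S) \<ge> 0" using N by auto
        have "(N / (4 * S)) powr (2 - \<eta>) \<le> (y ^ s) powr (2 - \<eta>)"
          using h2 N assms by (intro powr_mono2) auto
        also have "\<dots> = y powr (S * (2 - \<eta>))" using y by (simp add: powr_powr[symmetric] powr_realpow S_def)
        also have "\<dots> \<le> y powr (1 + (2 * S - real j - 1))"
          using y j by (intro powr_mono) (auto simp: S_def algebra_simps)
        also have "\<dots> = y * y powr (2 * S - real j - 1)" using y by (subst powr_add) auto
        also have "2 * S - real j - 1 = real (2 * s - j - 1)" using j r by (simp add: S_def of_nat_diff)
        also have "y * y powr real (2 * s - j - 1) = y * y ^ (2 * s - j - 1)" using y by (simp add: powr_realpow)
        also have "\<dots> \<le> 2 * y ^ (2 * s - j - 1)" using y by (intro mult_right_mono) auto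
        finally have low: "(N / (4 * S)) powr (2 - \<eta>) \<le> 2 * y ^ (2 * s - j - 1)" .
        have pos: "0 < (N / (4 * S)) powr (2 - \<eta>)" using N by simp
        have "real s * real n / y ^ (2 * s - j - 1) = 2 * (S * N) / (2 * y ^ (2 * s - j - 1))" by (simp add: S_def N_def)
        also have "\<dots> \<le> 2 * (S * N) / (N / (4 * S)) powr (2 - \<eta>)"
          using low pos N y by (intro divide_left_mono) auto
        also have "\<dots> = 2 * (S * N) / (N / (4 * S))\<^sup>2 * (N / (4 * S)) powr \<eta>"
          using N by (simp add: powr_diff powr_numeral)
        also have "\<dots> = 32 * S ^ 3 / N * (N / (4 * S)) powr \<eta>"
          using N by (simp add: field_simps power2_eq_square eval_nat_numeral)
        \<comment> \<open>Essentially s^3 / n. This is where \<open>s\<close> has to stay below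
          n^(1/3), and so \<open>p\<close> above n^(-1/3), by a power of n.\<close>
        also have "\<dots> \<le> 32 * (N powr (1/3 - \<eta>)) ^ 3 / N * N powr \<eta>"
        proof (intro mult_mono divide_right_mono power_mono powr_mono2)
          show "N / (4 * S) \<le> N" using N by (simp add: field_simps)
        qed (use N S assms in auto)
        also have "(N powr (1/3 - \<eta>)) ^ 3 = N powr (1 - 3 * \<eta>)" using N by (simp add: powr_power algebra_simps)
        also have "32 * N powr (1 - 3 * \<eta>) / N * N powr \<eta> = 32 * N powr (-(2*\<eta>))"
        proof -
          have "N powr (1 - 3 * \<eta>) / N * N powr \<eta> = N powr (1 - 3 * \<eta>) / N powr 1 * N powr \<eta>" using N by simp
          also have "\<dots> = N powr (1 - 3 * \<eta> - 1 + \<eta>)" by (simp only: powr_diff[symmetric] powr_add[symmetric])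
          finally show ?thesis by simp
        qed
        finally show "real s * real n / y ^ (2 * s - j - 1) \<le> 32 * N powr (-(2*\<eta>))" .
      qed (use r elim in \<open>auto simp: y_def N_def\<close>)
      have "0 < N powr \<epsilon>" using N by simp
      moreover have "N powr \<epsilon> < expected_indep n p s" using r by (simp add: N_def)
      ultimately have "2 / expected_indep n p s \<le> 2 / N powr \<epsilon>" by (intro divide_left_mono mult_pos_pos) linarith+
      thus "pr n p (\<lambda>E. alpha n E < s) \<le> 4 * real n powr (-1/9) + 48 * real n powr (-(2*\<eta>/3)) + 2 * real n powr (-\<epsilon>)"
        using pl unfolding N_def by (simp add: powr_minus_divide)
    qed
  qed
qed

text \<open>An expected number of at least 1 at \<open>s\<close> bounds y^(s-1) from above; at most
  n^\<epsilon> at \<open>s + 1\<close> bounds y^s from below; and y^(s-1) <= 3n together with ln y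
  >= p/2 bounds \<open>s\<close> itself.\<close>

lemma alpha_window_exists:
  assumes eta: "0 < \<eta>" "\<eta> < 1/6" and eps: "0 < \<epsilon>" "\<epsilon> \<le> 1/8"
    and p: "\<forall>\<^sub>F n in sequentially. real n powr (-1/3 + 2 * \<eta>) \<le> p n \<and> p n \<le> 1/2"
  shows "\<forall>\<^sub>F n in sequentially. \<exists>s. alpha_window n (p n) \<eta> \<epsilon> s"
proof -
  have e1: "\<forall>\<^sub>F n in sequentially. 1 + 2 * ln (3 * real n) \<le> real n powr \<eta>" using eta by real_asymp
  have e2: "\<forall>\<^sub>F n in sequentially. 1/4 * ln (real n) \<le> real n powr (1/4)" by real_asymp
  have e3: "\<forall>\<^sub>F n in sequentially. 2 \<le> n" by (rule eventually_ge_at_top)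
  show ?thesis using e1 e2 e3 p
  proof eventually_elim
    case (elim n)
    define N where "N = real n"
    define y where "y = inv_sqrt_compl (p n)"
    have N: "2 \<le> N" "0 < N" "1 < N" using elim by (auto simp: N_def)
    have pp: "0 < p n" "p n \<le> 1/2"
    proof -
      have "0 < real n powr (-1/3 + 2 * \<eta>)" using elim by simp
      thus "0 < p n" "p n \<le> 1/2" using elim by linarith+
    qed
    have y: "1 < y" "y \<le> 2" "0 < y" using inv_sqrt_compl_bounds[OF pp] by (auto simp: y_def)
    have muy: "expected_indep n (p n) r = real (n choose r) / y ^ (r * (r - 1))" for r
      unfolding expected_indep_def y_def using one_minus_power_choose_two[of "p n" r] pp by simp
    define Q where "Q r \<longleftrightarrow> 1 \<le> r \<and> expected_indep n (p n) r \<le> N powr \<epsilon>" for r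
    have Neps: "1 \<le> N powr \<epsilon>" using N eps by (simp add: ge_one_powr_ge_zero)
    have "expected_indep n (p n) n \<le> 1" unfolding expected_indep_def using pp by (simp add: power_le_one)
    hence Qn: "Q n" unfolding Q_def using elim Neps by linarith
    define R where "R = (LEAST r. Q r)"
    have QR: "Q R" unfolding R_def using Qn by (rule LeastI)
    have Rn: "R \<le> n" unfolding R_def using Qn by (rule Least_le)
    have below: "N powr \<epsilon> < expected_indep n (p n) r" if "1 \<le> r" "r < R" for r
      using that not_less_Least[of r Q] unfolding R_def Q_def by auto
    \<comment> \<open>This forces \<open>R\<close> above \<open>2 * \<epsilon> * ln N\<close>, so
      that in \<open>h2\<close> the factor n^\<epsilon> is at most exp(R/2) and disappears in
      2^R.\<close>
    have small: "N powr \<epsilon> < expected_indep n (p n) r" if r: "1 \<le> r" "real r \<le> 2 * \<epsilon> * ln N" "r \<le> n" for r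
    proof -
      have lnN: "0 < ln N" using N by simp
      have "2 * \<epsilon> * ln N \<le> 2 * (1/8) * ln N" using eps lnN by (intro mult_right_mono) auto
      hence r4: "real r \<le> 1/4 * ln N" using r by linarith
      hence r5: "real r \<le> N powr (1/4)" using elim by (simp add: N_def)
      have "(1/2::real) ^ r \<ge> N powr (-1/4)"
      proof -
        have "(1/2::real) ^ r = exp (- (ln 2 * real r))"
          by (simp add: powr_realpow[symmetric] powr_def ln_div)
        moreover have "ln 2 * real r \<le> 1 * real r" using ln_2_less_1 by (intro mult_right_mono) auto
        ultimately show ?thesis using r4 N by (simp add: powr_def)
      qed
      moreover have "N powr (3/4) \<le> N / real r"
      proof -
        have "N powr (3/4) * real r \<le> N powr (3/4) * N powr (1/4)" using r5 by (intro mult_left_mono) auto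
        also have "\<dots> = N" using N by (simp add: powr_add[symmetric])
        finally show ?thesis using r by (simp add: field_simps)
      qed
      ultimately have "N powr (3/4) * N powr (-1/4) \<le> N / real r * (1/2) ^ r" using N by (intro mult_mono) auto
      moreover have "N powr (3/4) * N powr (-1/4) = N powr (1/2)" by (simp add: powr_add[symmetric])
      ultimately have b: "N powr (1/2) \<le> N / real r * (1/2) ^ r" by simp
      have "N powr \<epsilon> < N powr (1/2)" using N eps by (intro powr_less_mono) auto
      also have "\<dots> \<le> (N powr (1/2)) ^ r" using r N by (intro self_le_power) (auto simp: ge_one_powr_ge_zero)
      also have "\<dots> \<le> (N / real r * (1/2) ^ r) ^ r" using b by (intro power_mono) auto
      also have "\<dots> = (N / real r) ^ r * (1/2) ^ (r * r)" by (simp only: power_mult_distrib power_mult)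
      also have "\<dots> \<le> real (n choose r) * (1 - p n) ^ (r choose 2)"
      proof (intro mult_mono)
        show "(N / real r) ^ r \<le> real (n choose r)"
          unfolding N_def using r by (intro binomial_ge_n_over_k_pow_k) auto
        have "r choose 2 \<le> r * r" using two_times_choose_two[of r] by (cases r) auto
        hence "(1/2::real) ^ (r * r) \<le> (1/2) ^ (r choose 2)" by (intro power_decreasing) auto
        also have "\<dots> \<le> (1 - p n) ^ (r choose 2)" using pp by (intro power_mono) auto
        finally show "(1/2::real) ^ (r * r) \<le> (1 - p n) ^ (r choose 2)" .
      qed auto
      finally show ?thesis by (simp add: expected_indep_def)
    qed
    have "R \<noteq> 1"
    proof
      assume "R = 1"
      hence "expected_indep n (p n) 1 \<le> N powr \<epsilon>" using QR by (simp add: Q_def)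
      moreover have "expected_indep n (p n) 1 = N" by (simp add: expected_indep_def N_def numeral_2_eq_2)
      moreover have "N powr \<epsilon> < N powr 1" using N eps by (intro powr_less_mono) auto
      ultimately show False using N by simp
    qed
    hence R2: "2 \<le> R" using QR by (simp add: Q_def)
    define s where "s = R - 1"
    have s: "1 \<le> s" "R = Suc s" "s \<le> n" using R2 Rn by (auto simp: s_def)
    have Rbig: "2 * \<epsilon> * ln N < real R"
      using small[of R] QR Rn by (fastforce simp: Q_def not_le)
    have musbig: "N powr \<epsilon> < expected_indep n (p n) s" using below[of s] s by auto
    have h1: "y ^ (s - 1) \<le> 3 * N / real s"
    proof -
      have "1 \<le> expected_indep n (p n) s" using musbig Neps by linarith
      hence "y ^ (s * (s - 1)) \<le> real (n choose s)" using y by (simp add: muy field_simps)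
      also have "\<dots> \<le> (3 * N / real s) ^ s" unfolding N_def using s by (intro choose_le_pow_three)
      finally have "(y ^ (s - 1)) ^ s \<le> (3 * N / real s) ^ s" by (simp add: power_mult[symmetric] mult.commute)
      moreover obtain s' where "s = Suc s'" using s by (cases s) auto
      ultimately show ?thesis using N power_le_imp_le_base[of "y ^ (s - 1)" s' "3 * N / real s"] by auto
    qed
    have h2: "N / (2 * (real s + 1)) \<le> y ^ s"
    proof -
      have "(N / real R) ^ R / y ^ (R * (R - 1)) \<le> expected_indep n (p n) R"
        unfolding muy N_def using Rn y by (intro divide_right_mono binomial_ge_n_over_k_pow_k) auto
      also have "\<dots> \<le> N powr \<epsilon>" using QR by (simp add: Q_def)
      also have "\<dots> = exp (\<epsilon> * ln N)" using N by (simp add: powr_def)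
      also have "\<dots> \<le> exp (real R * (1/2))" using Rbig by simp
      also have "\<dots> = exp (1/2) ^ R" by (simp only: exp_of_nat_mult)
      also have "\<dots> \<le> 2 ^ R"
      proof (intro power_mono)
        show "exp (1/2 :: real) \<le> 2" 
        proof (rule power2_le_imp_le)
          have "(exp (1/2 :: real))\<^sup>2 = exp 1" by (simp add: power2_eq_square exp_add[symmetric])
          thus "(exp (1/2 :: real))\<^sup>2 \<le> 2\<^sup>2" using exp_le by simp
        qed simp
      qed auto
      finally have le: "(N / real R) ^ R / y ^ (R * (R - 1)) \<le> 2 ^ R" .
      have "R * (R - 1) = s * R" using s by simp
      hence "y ^ (R * (R - 1)) = (y ^ s) ^ R" by (simp only: power_mult)
      with le have "(N / real R / y ^ s) ^ R \<le> 2 ^ R" by (simp only: power_divide)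
      hence "(N / real R / y ^ s) ^ Suc s \<le> 2 ^ Suc s" using s by simp
      hence "N / real R / y ^ s \<le> 2" by (rule power_le_imp_le_base) simp
      hence "N / real R \<le> 2 * y ^ s" using y by (subst (asm) pos_divide_le_eq) auto
      moreover have "N / (2 * (real s + 1)) = N / real R / 2" using s by (simp add: add.commute)
      moreover from calculation(1) have "N / real R / 2 \<le> y ^ s" by (subst pos_divide_le_eq) (auto simp: mult.commute)
      ultimately show ?thesis by (simp only:)
    qed
    have h3: "real s \<le> N powr (1/3 - \<eta>)"
    proof -
      have "y ^ (s - 1) \<le> 3 * N" using h1 s N by (elim order_trans) (simp add: field_simps)
      hence "ln (y ^ (s - 1)) \<le> ln (3 * N)" using y N by (intro ln_mono) auto
      hence "real (s - 1) * ln y \<le> ln (3 * N)" using y by (simp add: ln_realpow)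
      \<comment> \<open>Hence \<open>s\<close> is at most about 2 ln(3n) / p. Of the
        \<open>2 * \<eta>\<close> in the hypothesis on \<open>p\<close>, one \<eta> absorbs the
        logarithm and the other remains.\<close>
      moreover have "p n / 2 \<le> ln y"
      proof -
        have "ln y = - (ln (1 - p n) / 2)" unfolding y_def using pp by (simp add: ln_div ln_sqrt)
        moreover have "ln (1 - p n) \<le> - p n" using ln_le_minus_one[of "1 - p n"] pp by simp
        ultimately show ?thesis by linarith
      qed
      hence "real (s - 1) * (p n / 2) \<le> real (s - 1) * ln y" by (intro mult_left_mono) auto
      ultimately have "real (s - 1) * (p n / 2) \<le> ln (3 * N)" by linarith
      hence "real (s - 1) \<le> 2 * ln (3 * N) / p n" using pp by (simp add: field_simps)
      also have "\<dots> \<le> 2 * ln (3 * N) / N powr (-1/3 + 2 * \<eta>)"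
        using elim N pp by (intro divide_left_mono) (auto simp: N_def)
      also have "\<dots> = 2 * ln (3 * N) * N powr (-(-1/3 + 2 * \<eta>))"
        by (simp only: powr_minus_divide times_divide_eq_right mult_1_right)
      also have "-(-1/3 + 2 * \<eta>) = 1/3 - 2 * \<eta>" by simp
      finally have "real s \<le> 1 + 2 * ln (3 * N) * N powr (1/3 - 2 * \<eta>)" using s by (simp add: of_nat_diff)
      also have "\<dots> \<le> N powr (1/3 - 2 * \<eta>) + 2 * ln (3 * N) * N powr (1/3 - 2 * \<eta>)"
        using N eta by (simp add: ge_one_powr_ge_zero)
      also have "\<dots> = (1 + 2 * ln (3 * N)) * N powr (1/3 - 2 * \<eta>)" by (simp add: algebra_simps)
      also have "\<dots> \<le> N powr \<eta> * N powr (1/3 - 2 * \<eta>)" using elim by (intro mult_right_mono) (auto simp: N_def)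
      also have "\<dots> = N powr (1/3 - \<eta>)" by (simp add: powr_add[symmetric])
      finally show ?thesis .
    qed
    show ?case unfolding alpha_window_def
      using s Rn pp musbig QR h1 h2 h3 by (intro exI[of _ s]) (auto simp: Q_def N_def y_def)
  qed
qed

section \<open>Exactness below the threshold\<close>

text \<open>The bound of \<open>biq_weight_le\<close> for \<open>s = 2\<close> and
  \<open>x = p / (1 - p)\<close>, as a function of the size of the core alone.\<close>

definition core_weight :: "real \<Rightarrow> nat \<Rightarrow> real" where
  "core_weight p u = (1 + (p / (1 - p))\<^sup>2) ^ u * (\<Sum>a=2..u. ((real u)\<^sup>2 * (p / (1 - p)) ^ a) ^ a)"

lemma choose_le_power: "real (n choose k) \<le> real n ^ k"
proof (cases "k \<le> n")
  case True
  hence "(n choose k) \<le> n ^ k" by (rule binomial_le_pow)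
  thus ?thesis by (metis of_nat_le_iff of_nat_power)
qed (simp add: binomial_eq_0)

lemma expected_indep_eq: "p < 1 \<Longrightarrow> expected_indep n p r = real (n choose r) / inv_sqrt_compl p ^ (r * (r - 1))"
  unfolding expected_indep_def using one_minus_power_choose_two[of p r] by simp

text \<open>Growing an r-set by \<open>k\<close> vertices multiplies the number of sets by at most
  n^k and adds k(2r+k-1)/2 pairs. A core of surplus \<open>r\<close> with \<open>k\<close> bicliques
  has r+k vertices, so the loss is a \<open>k\<close>-th power and can be shared equally among the
  bicliques.\<close>

lemma expected_indep_add_le:
  assumes "0 < p" "p < 1"
  shows "expected_indep n p (r + k) \<le> expected_indep n p r * (real n / inv_sqrt_compl p ^ (2 * r + k - 1)) ^ k"
proof (cases "k = 0")
  case False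
  define y where "y = inv_sqrt_compl p"
  have y: "0 < y" using assms by (simp add: y_def)
  have "int (r + k) * (int (r + k) - 1) = int r * (int r - 1) + int k * (2 * int r + int k - 1)"
    by (simp add: algebra_simps)
  moreover have "int (r + k - 1) = int (r + k) - 1" "int (2 * r + k - 1) = 2 * int r + int k - 1"
    using False by auto
  moreover have "int r * (int r - 1) = int (r * (r - 1))" by (cases r) (auto simp: algebra_simps)
  ultimately have "int ((r + k) * (r + k - 1)) = int (r * (r - 1) + k * (2 * r + k - 1))"
    by (simp only: of_nat_mult of_nat_add)
  hence ex: "(r + k) * (r + k - 1) = r * (r - 1) + k * (2 * r + k - 1)" by (simp only: of_nat_eq_iff)
  have "real (n choose (r + k)) \<le> real (n choose r) * real (n choose k)"
    using choose_le_mult[of r "r + k" n] by (metis add_diff_cancel_left' le_add1 of_nat_le_iff of_nat_mult)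
  also have "\<dots> \<le> real (n choose r) * real n ^ k" by (intro mult_left_mono choose_le_power) auto
  finally have "expected_indep n p (r + k) \<le> real (n choose r) * real n ^ k / y ^ (r * (r - 1) + k * (2 * r + k - 1))"
    unfolding expected_indep_eq[OF assms(2)] ex y_def[symmetric] using y by (intro divide_right_mono) auto
  also have "\<dots> = expected_indep n p r * (real n / y ^ (2 * r + k - 1)) ^ k"
    unfolding expected_indep_eq[OF assms(2)] y_def[symmetric] power_add power_divide power_mult[symmetric]
    by (simp add: mult.commute)
  finally show ?thesis by (simp add: y_def)
qed simp

lemma expected_indep_nonneg: "p \<le> 1 \<Longrightarrow> 0 \<le> expected_indep n p r"
  by (simp add: expected_indep_def)

text \<open>A failure of the identity with independence number at least s yields a starless core with
  more than \<open>s\<close> surplus vertices and at least one biclique; the expected number of such cores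
  decays geometrically in both parameters.\<close>

lemma pr_bp_neq_le:
  assumes r: "alpha_window n p \<eta> \<epsilon> s" and \<beta>: "0 \<le> \<beta>" "\<beta> \<le> 1/2"
    and R4: "4 * (real s + 1)\<^sup>2 / real n \<le> 1/2" and plt: "p < 1/2"
    and \<beta>u: "\<And>u. Suc s < u \<Longrightarrow> u \<le> n \<Longrightarrow> 2 * (real s + 1) * core_weight p u / inv_sqrt_compl p ^ (u - 1) \<le> \<beta>"
  shows "pr n p (\<lambda>E. bp n E \<noteq> n - alpha n E) \<le> pr n p (\<lambda>E. alpha n E < s) + 4 * real n powr \<epsilon> * \<beta>"
proof -
  define y where "y = inv_sqrt_compl p"
  define R where "R = Suc s"
  have rr: "1 \<le> s" "R \<le> n" "0 < p" "p \<le> 1/2" "expected_indep n p R \<le> real n powr \<epsilon>"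
     "real n / (2 * (real s + 1)) \<le> y ^ s" using r by (auto simp: alpha_window_def R_def y_def)
  have y: "1 < y" "0 < y" using inv_sqrt_compl_bounds[OF rr(3,4)] by (auto simp: y_def)
  have n0: "0 < n" using rr by (auto simp: R_def)
  have nys: "real n / y ^ s \<le> 2 * (real s + 1)" using rr(6) y n0 by (simp add: field_simps)
  \<comment> \<open>From size \<open>R\<close> on, each further vertex at least halves the expected
    number: n / y^(2m) is at most (n / y^s)^2 / n, hence at most 4 (s+1)^2 / n.\<close>
  have mur: "expected_indep n p r \<le> expected_indep n p R * (1/2) ^ (r - R)" if "R \<le> r" for r
    using that
  proof (induction r rule: dec_induct)
    case (step m)
    have "real n / y ^ (2 * m) \<le> real n / y ^ (2 * s)"
      using y step.hyps by (intro divide_left_mono power_increasing) (auto simp: R_def)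
    also have "\<dots> = (real n / y ^ s)\<^sup>2 / real n" using n0 by (simp add: power2_eq_square power_add mult_2)
    also have "\<dots> \<le> (2 * (real s + 1))\<^sup>2 / real n" using nys y by (intro divide_right_mono power_mono) auto
    also have "(2 * (real s + 1))\<^sup>2 = 4 * (real s + 1)\<^sup>2" unfolding power_mult_distrib by simp
    also have "\<dots> / real n \<le> 1/2" by (rule R4)
    finally have h: "real n / y ^ (2 * m) \<le> 1/2" .
    have "expected_indep n p (m + 1) \<le> expected_indep n p m * (real n / inv_sqrt_compl p ^ (2 * m + 1 - 1)) ^ 1"
      using rr by (intro expected_indep_add_le) auto
    also have "\<dots> \<le> expected_indep n p m * (1/2)"
      using h rr by (intro mult_left_mono expected_indep_nonneg) (auto simp: y_def)
    also have "\<dots> \<le> expected_indep n p R * (1/2) ^ (m - R) * (1/2)" using step.IH by (intro mult_right_mono) auto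
    finally show ?case using step.hyps by (simp add: Suc_diff_le)
  qed simp
  define bad where "bad r k E \<longleftrightarrow> (\<exists>U L. U \<subseteq> {..<n} \<and> card U = r + k \<and> length L = k \<and> set L \<subseteq> biq U 2 \<and>
       is_biclique_partition n {e \<in> E. e \<subseteq> U} L)" for r k :: nat and E
  have muR: "0 \<le> expected_indep n p R" using rr by (intro expected_indep_nonneg) auto
  have Mnn: "0 \<le> core_weight p u" for u unfolding core_weight_def using rr by (intro mult_nonneg_nonneg sum_nonneg) auto
  have badle: "pr n p (bad r k) \<le> expected_indep n p R * (1/2) ^ (r - R) * \<beta> ^ k"
    if rk: "R \<le> r" "1 \<le> k" "r + k \<le> n" for r k
  proof -
    have "pr n p (bad r k) \<le> real (n choose (r + k)) * (1 - p) ^ ((r + k) choose 2) * core_weight p (r + k) ^ k"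
      unfolding bad_def core_weight_def using rr plt by (intro pr_starless_core_le) auto
    also have "\<dots> = expected_indep n p (r + k) * core_weight p (r + k) ^ k" by (simp add: expected_indep_def)
    also have "\<dots> \<le> expected_indep n p r * (real n / y ^ (2 * r + k - 1)) ^ k * core_weight p (r + k) ^ k"
      unfolding y_def using rr Mnn by (intro mult_right_mono expected_indep_add_le) auto
    also have "\<dots> = expected_indep n p r * (real n / y ^ (2 * r + k - 1) * core_weight p (r + k)) ^ k"
      by (simp only: power_mult_distrib mult.assoc)
    also have "\<dots> \<le> expected_indep n p r * \<beta> ^ k"
    proof (intro mult_left_mono power_mono)
      \<comment> \<open>The exponent is split: \<open>y ^ s\<close> cancels n up to the factor
        2(s+1), and \<open>y ^ (r + k - 1)\<close> is left against
        \<open>core_weight\<close>.\<close>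
      have "real n / y ^ (2 * r + k - 1) \<le> real n / (y ^ s * y ^ (r + k - 1))"
      proof (intro divide_left_mono)
        have "y ^ (s + (r + k - 1)) \<le> y ^ (2 * r + k - 1)"
          using y rk by (intro power_increasing) (auto simp: R_def)
        thus "y ^ s * y ^ (r + k - 1) \<le> y ^ (2 * r + k - 1)" by (simp add: power_add)
      qed (use y in auto)
      also have "\<dots> = real n / y ^ s / y ^ (r + k - 1)" by simp
      also have "\<dots> \<le> 2 * (real s + 1) / y ^ (r + k - 1)" using nys y by (intro divide_right_mono) auto
      finally have "real n / y ^ (2 * r + k - 1) * core_weight p (r + k) \<le> 2 * (real s + 1) / y ^ (r + k - 1) * core_weight p (r + k)"
        using Mnn by (intro mult_right_mono)
      also have "\<dots> = 2 * (real s + 1) * core_weight p (r + k) / y ^ (r + k - 1)" by simp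
      also have "\<dots> \<le> \<beta>" unfolding y_def using rk by (intro \<beta>u) (auto simp: R_def)
      finally show "real n / y ^ (2 * r + k - 1) * core_weight p (r + k) \<le> \<beta>" .
    qed (use rr y Mnn[of "r + k"] in \<open>auto intro: expected_indep_nonneg mult_nonneg_nonneg\<close>)
    also have "\<dots> \<le> expected_indep n p R * (1/2) ^ (r - R) * \<beta> ^ k"
      using mur[OF rk(1)] \<beta> by (intro mult_right_mono) auto
    finally show ?thesis .
  qed
  have "pr n p (\<lambda>E. bp n E \<noteq> n - alpha n E) \<le>
    pr n p (\<lambda>E. alpha n E < s \<or> (\<exists>(r, k)\<in>Sigma {R..n} (\<lambda>r. {1..n - r}). bad r k E))"
  proof (rule pr_mono)
    fix E assume E: "E \<subseteq> all_edges n" and neq: "bp n E \<noteq> n - alpha n E"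
    have al: "alpha n E \<le> n" by (rule alpha_le)
    have less: "bp n E < n - alpha n E" using neq bp_le_alpha[OF E] by simp
    show "alpha n E < s \<or> (\<exists>(r, k)\<in>Sigma {R..n} (\<lambda>r. {1..n - r}). bad r k E)"
    proof (cases "alpha n E < s")
      case False
      \<comment> \<open>A surplus of one more than the independence number: the core cannot be
        independent, so its partition contains a biclique.\<close>
      define r where "r = Suc (alpha n E)"
      have "r + bp n E \<le> n" using less by (simp add: r_def)
      then obtain U L where UL: "U \<subseteq> {..<n}" "is_biclique_partition n {e \<in> E. e \<subseteq> U} L" "card U = r + length L"
        "set L \<subseteq> biq U 2" using starless_core[OF E] by blast
      have "card U \<le> n" using card_mono[OF _ UL(1)] by simp
      have "L \<noteq> []"
      proof
        assume "L = []"
        hence "{e \<in> E. e \<subseteq> U} = {}" using UL(2) by (simp add: bpart_Nil)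
        hence "independent E U" using independent_iff[OF E] by blast
        hence "card U \<le> alpha n E" using alpha_ge UL(1) by blast
        thus False using UL(3) by (simp add: r_def)
      qed
      hence "1 \<le> length L" by (cases L) auto
      moreover have "bad r (length L) E" unfolding bad_def using UL by blast
      moreover have "R \<le> r" "r + length L \<le> n" using False UL(3) \<open>card U \<le> n\<close> by (auto simp: R_def r_def)
      ultimately have "(r, length L) \<in> Sigma {R..n} (\<lambda>r. {1..n - r})" "bad r (length L) E" by auto
      thus ?thesis by blast
    qed simp
  qed (use rr in auto)
  also have "\<dots> \<le> pr n p (\<lambda>E. alpha n E < s) + pr n p (\<lambda>E. \<exists>(r, k)\<in>Sigma {R..n} (\<lambda>r. {1..n - r}). bad r k E)"
    using rr by (intro pr_disj) auto
  also have "pr n p (\<lambda>E. \<exists>(r, k)\<in>Sigma {R..n} (\<lambda>r. {1..n - r}). bad r k E) \<le>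
      (\<Sum>x\<in>Sigma {R..n} (\<lambda>r. {1..n - r}). pr n p (\<lambda>E. case x of (r, k) \<Rightarrow> bad r k E))"
    using rr by (intro pr_UN_le) auto
  also have "\<dots> \<le> (\<Sum>(r, k)\<in>Sigma {R..n} (\<lambda>r. {1..n - r}). expected_indep n p R * (1/2) ^ (r - R) * \<beta> ^ k)"
    using badle by (intro sum_mono) auto
  also have "\<dots> = (\<Sum>r\<in>{R..n}. \<Sum>k\<in>{1..n - r}. expected_indep n p R * (1/2) ^ (r - R) * \<beta> ^ k)"
    by (rule sum.Sigma[symmetric]) auto
  also have "\<dots> = (\<Sum>r\<in>{R..n}. expected_indep n p R * (1/2) ^ (r - R) * (\<Sum>k\<in>{1..n - r}. \<beta> ^ k))"
    by (simp add: sum_distrib_left)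
  also have "\<dots> \<le> (\<Sum>r\<in>{R..n}. expected_indep n p R * (1/2) ^ (r - R) * (2 * \<beta>))"
    using \<beta> muR by (intro sum_mono mult_left_mono geometric_sum_le) auto
  also have "\<dots> = expected_indep n p R * (2 * \<beta>) * (\<Sum>r\<in>{R..n}. (1/2) ^ (r - R))" by (simp add: sum_distrib_left mult_ac)
  also have "(\<Sum>r\<in>{R..n}. (1/2::real) ^ (r - R)) = (\<Sum>j\<in>{..<Suc (n - R)}. (1/2) ^ j)"
    by (intro sum.reindex_bij_witness[of _ "\<lambda>j. j + R" "\<lambda>r. r - R"]) (use rr in auto)
  also have "\<dots> = 2 * (1 - (1/2) ^ Suc (n - R))" by (subst sum_gp_strict) auto
  also have "expected_indep n p R * (2 * \<beta>) * (2 * (1 - (1/2) ^ Suc (n - R))) \<le> real n powr \<epsilon> * (2 * \<beta>) * 2"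
    using rr \<beta> muR power_le_one[of "1/2::real" "Suc (n - R)"] by (intro mult_mono) auto
  finally show ?thesis by simp
qed

section \<open>The polynomial that defines \<open>p0\<close>\<close>

lemma p0_cubic:
  fixes a b :: real
  defines "g \<equiv> \<lambda>x::real. 4 * x ^ 3 - 7 * x\<^sup>2 + 5 * x - 1"
  shows p0_root: "g p0 = 0" and p0_cubic_mono: "a < b \<Longrightarrow> g a < g b" and p0_bounds: "0 < p0" "p0 < 1/2"
proof -
  have mono: "g a < g b" if "a < b" for a b
  proof -
    \<comment> \<open>Completing squares shows that the difference quotient is positive, so the
      cubic is strictly increasing; its values -1 at 0 and 1/4 at 1/2 then locate the root.\<close>
    have "g b - g a = (b - a) * (4 * (a\<^sup>2 + a * b + b\<^sup>2) - 7 * (a + b) + 5)"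
      unfolding g_def by (simp add: algebra_simps power2_eq_square power3_eq_cube)
    moreover have "4 * (a\<^sup>2 + a * b + b\<^sup>2) - 7 * (a + b) + 5 = (a - b)\<^sup>2 + 3 * (a + b - 7/6)\<^sup>2 + 11/12"
      by (simp add: algebra_simps power2_eq_square)
    moreover have "0 < (a - b)\<^sup>2 + 3 * (a + b - 7/6)\<^sup>2 + 11/12"
      by (intro add_nonneg_pos add_nonneg_nonneg) auto
    ultimately have "0 < g b - g a" using that by simp
    thus ?thesis by simp
  qed
  have "\<exists>x\<ge>0. x \<le> 1/2 \<and> g x = 0"
    unfolding g_def by (rule IVT') (auto intro!: continuous_intros simp: power2_eq_square power3_eq_cube)
  then obtain x where x: "0 \<le> x" "x \<le> 1/2" "g x = 0" by blast
  have "p0 = x" unfolding p0_def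
  proof (rule the_equality)
    show "4 * x ^ 3 - 7 * x\<^sup>2 + 5 * x - 1 = 0" using x by (simp add: g_def)
    fix z :: real assume "4 * z ^ 3 - 7 * z\<^sup>2 + 5 * z - 1 = 0"
    hence "g z = 0" by (simp add: g_def)
    thus "z = x" using mono[of x z] mono[of z x] x by linarith
  qed
  moreover have "g 0 \<noteq> 0" "g (1/2) \<noteq> 0" by (simp_all add: g_def power2_eq_square power3_eq_cube)
  hence "x \<noteq> 0" "x \<noteq> 1/2" using x(3) by metis+
  ultimately show "g p0 = 0" "0 < p0" "p0 < 1/2" using x by auto
  show "g a < g b" if "a < b" using mono that .
qed

text \<open>For positive p the sign of the cubic thus decides which of the two powers is larger.
  Used below \<open>p0\<close> for (i) and above it for (iii).\<close>

lemma p0_quartic: "(1 - 2 * p + 2 * p\<^sup>2)\<^sup>2 - (1 - p) ^ 3 = p * (4 * p ^ 3 - 7 * p\<^sup>2 + 5 * p - 1)" for p :: real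
  by (simp add: algebra_simps power2_eq_square power3_eq_cube)

text \<open>Common part of the constant and the sparse case, which differ only in how they verify
  the bound \<open>M\<close>. Its right side n^(-2 \<epsilon>) outweighs the factor n^\<epsilon>
  that the window allows for the expected number of independent sets.\<close>

lemma whp_bp_eq:
  assumes eta: "0 < \<eta>" "\<eta> < 1/6" and eps: "0 < \<epsilon>" "\<epsilon> \<le> 1/8"
    and p: "\<forall>\<^sub>F n in sequentially. real n powr (-1/3 + 2 * \<eta>) \<le> p n \<and> p n < 1/2"
    and M: "\<forall>\<^sub>F n in sequentially. \<forall>s u. alpha_window n (p n) \<eta> \<epsilon> s \<longrightarrow> Suc s < u \<longrightarrow> u \<le> n \<longrightarrow>
       2 * (real s + 1) * core_weight (p n) u / inv_sqrt_compl (p n) ^ (u - 1) \<le> real n powr (-2 * \<epsilon>)"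
  shows "whp p (\<lambda>n E. bp n E = n - alpha n E)"
proof (rule whpI)
  let ?f = "\<lambda>n. 4 * real n powr (-1/9) + 48 * real n powr (-(2*\<eta>/3)) + 2 * real n powr (-\<epsilon>) + 4 * real n powr (-\<epsilon>)"
  have "(\<lambda>n. real n powr (-1/9)) \<longlonglongrightarrow> 0" by real_asymp
  moreover have "(\<lambda>n. real n powr (-(2*\<eta>/3))) \<longlonglongrightarrow> 0" using eta by real_asymp
  moreover have "(\<lambda>n. real n powr (-\<epsilon>)) \<longlonglongrightarrow> 0" using eps by real_asymp
  ultimately have "?f \<longlonglongrightarrow> 4 * 0 + 48 * 0 + 2 * 0 + 4 * 0" by (intro tendsto_intros)
  thus "?f \<longlonglongrightarrow> 0" by simp
  show "\<forall>\<^sub>F n in sequentially. 0 \<le> p n \<and> p n \<le> 1"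
    using p by eventually_elim (auto intro: order_trans[OF powr_ge_zero])
  have p': "\<forall>\<^sub>F n in sequentially. real n powr (-1/3 + 2 * \<eta>) \<le> p n \<and> p n \<le> 1/2"
    using p by eventually_elim auto
  have e1: "\<forall>\<^sub>F n in sequentially. 4 * (real n powr (1/3) + 1)\<^sup>2 / real n \<le> 1/2" by real_asymp
  have e2: "\<forall>\<^sub>F n in sequentially. real n powr (-2 * \<epsilon>) \<le> 1/2" using eps by real_asymp
  have eta': "\<eta> < 1/3" using eta by simp
  show "\<forall>\<^sub>F n in sequentially. pr n (p n) (\<lambda>E. \<not> bp n E = n - alpha n E) \<le> ?f n"
    using p M alpha_window_exists[OF eta eps p'] alpha_lower[OF eta(1) eta' eps(1)] e1 e2 eventually_ge_at_top[of 1]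
  proof eventually_elim
    case (elim n)
    then obtain s where s: "alpha_window n (p n) \<eta> \<epsilon> s" by blast
    have n1: "1 \<le> real n" using elim by simp
    have "real s \<le> real n powr (1/3 - \<eta>)" using s by (simp add: alpha_window_def)
    also have "\<dots> \<le> real n powr (1/3)" using n1 eta by (intro powr_mono) auto
    finally have "4 * (real s + 1)\<^sup>2 / real n \<le> 4 * (real n powr (1/3) + 1)\<^sup>2 / real n"
      by (intro divide_right_mono mult_left_mono power_mono) auto
    hence R4: "4 * (real s + 1)\<^sup>2 / real n \<le> 1/2" using elim by linarith
    have "pr n (p n) (\<lambda>E. bp n E \<noteq> n - alpha n E) \<le>
        pr n (p n) (\<lambda>E. alpha n E < s) + 4 * real n powr \<epsilon> * real n powr (-2 * \<epsilon>)"
      using elim s R4 by (intro pr_bp_neq_le) auto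
    moreover have "real n powr \<epsilon> * real n powr (-2 * \<epsilon>) = real n powr (-\<epsilon>)"
      unfolding powr_add[symmetric] by simp
    moreover have "pr n (p n) (\<lambda>E. alpha n E < s) \<le> 4 * real n powr (-1/9) + 48 * real n powr (-(2*\<eta>/3)) + 2 * real n powr (-\<epsilon>)"
      using elim s by blast
    ultimately show ?case by simp
  qed
qed

text \<open>About half of the true order; it needs only that y^s is at least n / (2(s+1)), hence at
  least the square root of n.\<close>

lemma alpha_window_log_lower:
  assumes p: "0 < p" "p < 1/2"
  shows "\<forall>\<^sub>F n in sequentially. \<forall>s. alpha_window n p (1/12) \<epsilon> s \<longrightarrow> ln (real n) / (2 * ln (inv_sqrt_compl p)) \<le> real s"
proof -
  define y where "y = inv_sqrt_compl p"
  have y: "1 < y" "0 < y" using inv_sqrt_compl_bounds[of p] p by (auto simp: y_def)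
  have "\<forall>\<^sub>F n in sequentially. 2 * (real n powr (1/3) + 1) * real n powr (1/2) \<le> real n" by real_asymp
  thus ?thesis using eventually_ge_at_top[of 2]
  proof eventually_elim
    case (elim n)
    show ?case
    proof (intro allI impI)
      fix s assume s: "alpha_window n p (1/12) \<epsilon> s"
      have n: "2 \<le> real n" using elim by simp
      have sl: "real s \<le> real n powr (1/3)"
      proof -
        have "real s \<le> real n powr (1/3 - 1/12)" using s by (simp add: alpha_window_def)
        also have "\<dots> \<le> real n powr (1/3)" using n by (intro powr_mono) auto
        finally show ?thesis .
      qed
      have "real n powr (1/2) \<le> real n / (2 * (real s + 1))"
      proof -
        have "real n powr (1/2) * (2 * (real s + 1)) \<le> 2 * (real n powr (1/3) + 1) * real n powr (1/2)"
          using mult_right_mono[of "2 * (real s + 1)" "2 * (real n powr (1/3) + 1)" "real n powr (1/2)"] sl by (simp add: mult.commute)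
        also have "\<dots> \<le> real n" using elim by simp
        finally show ?thesis by (simp add: field_simps)
      qed
      also have "\<dots> \<le> y ^ s" using s by (simp add: alpha_window_def y_def)
      finally have "ln (real n powr (1/2)) \<le> ln (y ^ s)" using n by (intro ln_mono) auto
      hence "1/2 * ln (real n) \<le> real s * ln y" using n y by (simp add: ln_powr ln_realpow)
      moreover have "0 < ln y" using y by simp
      ultimately show "ln (real n) / (2 * ln (inv_sqrt_compl p)) \<le> real s" unfolding y_def[symmetric] by (simp add: field_simps)
    qed
  qed
qed

lemma whp_bp_eq_const:
  assumes p: "0 < p" "p < p0"
  shows "whp (\<lambda>_. p) (\<lambda>n E. bp n E = n - alpha n E)"
proof -
  have p2: "p < 1/2" using p p0_bounds by linarith
  define lam where "lam = p / (1 - p)"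
  define y where "y = inv_sqrt_compl p"
  have y: "1 < y" "y \<le> 2" "0 < y" using inv_sqrt_compl_bounds[of p] p p2 by (auto simp: y_def)
  have lam: "0 < lam" "lam < 1" using p p2 by (auto simp: lam_def)
  \<comment> \<open>Up to quasi-polynomial factors \<open>core_weight p u / y ^ u\<close> is q^u,
    and q^2 = (1-2p+2p^2)^2 / (1-p)^3.\<close>
  define q where "q = (1 + lam\<^sup>2) / y"
  have q0: "0 < q" using y by (simp add: q_def add_pos_nonneg)
  have "q < 1"
  proof -
    have "4 * p ^ 3 - 7 * p\<^sup>2 + 5 * p - 1 < 0" using p0_cubic_mono[OF p(2)] p0_root by simp
    hence "p * (4 * p ^ 3 - 7 * p\<^sup>2 + 5 * p - 1) < 0" using p by (simp add: mult_pos_neg)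
    hence less: "(1 - 2 * p + 2 * p\<^sup>2)\<^sup>2 < (1 - p) ^ 3" unfolding p0_quartic[symmetric] by simp
    have "1 + lam\<^sup>2 = (1 - 2 * p + 2 * p\<^sup>2) / (1 - p)\<^sup>2"
      using p2 unfolding lam_def by (simp add: power_divide field_simps) (simp add: power2_eq_square algebra_simps)
    hence "q\<^sup>2 = (1 - 2 * p + 2 * p\<^sup>2)\<^sup>2 / (1 - p) ^ 4 * (1 - p)"
      using p2 unfolding q_def y_def by (simp add: power_divide power_mult_distrib power_mult[symmetric])
    also have "\<dots> = (1 - 2 * p + 2 * p\<^sup>2)\<^sup>2 / (1 - p) ^ 3"
    proof -
      have "(1 - p) ^ 4 = (1 - p) ^ 3 * (1 - p)" by (simp add: eval_nat_numeral)
      thus ?thesis using p2 by simp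
    qed
    also have "\<dots> < 1" using less p2 by simp
    finally have "q\<^sup>2 < 1\<^sup>2" by simp
    thus "q < 1" by (rule power2_less_imp_less) simp
  qed
  \<comment> \<open>So q = exp(-2c): one factor exp(-cu) absorbs the quasi-polynomial terms, the
    other yields n^(-2 \<epsilon>).\<close>
  define c where "c = - ln q / 2"
  have c: "0 < c" using q0 \<open>q < 1\<close> by (simp add: c_def)
  have qc: "q = exp (-2 * c)" using q0 by (simp add: c_def)
  define w where "w = ln (1 / lam)"
  have w: "0 < w" using lam by (simp add: w_def)
  define ly where "ly = ln y"
  have ly: "0 < ly" using y by (simp add: ly_def)
  \<comment> \<open>Since \<open>u\<close> exceeds ln n / (2 ly), the bound
    \<open>2 * \<epsilon> \<le> c / (2 * ly)\<close> turns exp(-cu) into n^(-2 \<epsilon>).\<close>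
  define \<epsilon> where "\<epsilon> = min (1/8) (c / (4 * ly))"
  have eps: "0 < \<epsilon>" "\<epsilon> \<le> 1/8" "2 * \<epsilon> \<le> c / (2 * ly)" using c ly by (auto simp: \<epsilon>_def min_def field_simps)
  have "\<forall>\<^sub>F u in sequentially. 4 * (real u)\<^sup>2 * exp ((ln (real u))\<^sup>2 / w) * exp (- (c * real u)) \<le> 1"
    using c w by real_asymp
  then obtain u0 where u0: "4 * (real u)\<^sup>2 * exp ((ln (real u))\<^sup>2 / w) * exp (- (c * real u)) \<le> 1" if "u0 \<le> u" for u
    unfolding eventually_sequentially by blast
  note e1 = alpha_window_log_lower[OF p(1) p2, of \<epsilon>]
  have e2: "\<forall>\<^sub>F n in sequentially. real u0 \<le> ln (real n) / (2 * ly)" using ly by real_asymp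
  show ?thesis
  proof (rule whp_bp_eq[where \<eta> = "1/12" and \<epsilon> = \<epsilon>])
    show "\<forall>\<^sub>F n in sequentially. real n powr (-1/3 + 2 * (1/12)) \<le> p \<and> p < 1/2"
    proof -
      have "\<forall>\<^sub>F n in sequentially. real n powr (-1/3 + 2 * (1/12)) \<le> p" using p by real_asymp
      thus ?thesis by (rule eventually_mono) (use p2 in auto)
    qed
    show "\<forall>\<^sub>F n in sequentially. \<forall>s u. alpha_window n p (1/12) \<epsilon> s \<longrightarrow> Suc s < u \<longrightarrow> u \<le> n \<longrightarrow>
       2 * (real s + 1) * core_weight p u / inv_sqrt_compl p ^ (u - 1) \<le> real n powr (-2 * \<epsilon>)"
      using e1 e2 eventually_ge_at_top[of 2]
    proof eventually_elim
      case (elim n)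
      show ?case
      proof (intro allI impI)
        fix s u assume s: "alpha_window n p (1/12) \<epsilon> s" and u: "Suc s < u" "u \<le> n"
        have n: "2 \<le> real n" using elim by simp
        have sbig: "ln (real n) / (2 * ly) \<le> real s" using elim s by (simp add: ly_def y_def)
        have uu: "u0 \<le> u" using sbig elim u by linarith
        have u1: "1 \<le> u" using u by simp
        have "core_weight p u \<le> (1 + lam\<^sup>2) ^ u * (real u * exp ((ln (real u))\<^sup>2 / w))"
          unfolding core_weight_def lam_def[symmetric] w_def using lam u1
          by (intro mult_left_mono sum_power_gaussian_le) auto
        hence "2 * (real s + 1) * core_weight p u / y ^ (u - 1) \<le>
           2 * real u * ((1 + lam\<^sup>2) ^ u * (real u * exp ((ln (real u))\<^sup>2 / w))) / y ^ (u - 1)"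
          using u y lam by (intro divide_right_mono mult_mono) (auto simp: core_weight_def lam_def[symmetric] intro!: mult_nonneg_nonneg sum_nonneg) 
        also have yu: "y ^ (u - 1) = y ^ u / y" using y u1 by (simp add: power_diff)
        also have "2 * real u * ((1 + lam\<^sup>2) ^ u * (real u * exp ((ln (real u))\<^sup>2 / w))) / (y ^ u / y) =
            2 * y * (real u)\<^sup>2 * exp ((ln (real u))\<^sup>2 / w) * q ^ u"
          unfolding q_def by (simp add: power_divide power2_eq_square)
        also have "q ^ u = exp (- (c * real u)) * exp (- (c * real u))"
          unfolding qc by (simp add: exp_of_nat_mult[symmetric] exp_add[symmetric] algebra_simps)
        also have "2 * y * (real u)\<^sup>2 * exp ((ln (real u))\<^sup>2 / w) * (exp (- (c * real u)) * exp (- (c * real u))) \<le>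
            2 * 2 * (real u)\<^sup>2 * exp ((ln (real u))\<^sup>2 / w) * (exp (- (c * real u)) * exp (- (c * real u)))"
          using y by (intro mult_right_mono) auto
        also have "\<dots> = (4 * (real u)\<^sup>2 * exp ((ln (real u))\<^sup>2 / w) * exp (- (c * real u))) * exp (- (c * real u))" by simp
        also have "\<dots> \<le> 1 * exp (- (c * real u))" using u0[OF uu] by (intro mult_right_mono) auto
        also have "\<dots> \<le> exp (- (c * (ln (real n) / (2 * ly))))"
        proof -
          have "ln (real n) / (2 * ly) \<le> real u" using sbig u by linarith
          hence "c * (ln (real n) / (2 * ly)) \<le> c * real u" using c by (intro mult_left_mono) auto
          thus ?thesis by simp
        qed
        also have "\<dots> = exp (- (c / (2 * ly) * ln (real n)))" by simp
        also have "\<dots> \<le> exp (- (2 * \<epsilon> * ln (real n)))"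
        proof -
          have "2 * \<epsilon> * ln (real n) \<le> c / (2 * ly) * ln (real n)" using eps n by (intro mult_right_mono) auto
          thus ?thesis by simp
        qed
        also have "\<dots> = real n powr (-2 * \<epsilon>)" using n by (simp add: powr_def)
        finally show "2 * (real s + 1) * core_weight p u / inv_sqrt_compl p ^ (u - 1) \<le> real n powr (-2 * \<epsilon>)"
          unfolding y_def[symmetric] yu .
      qed
    qed
  qed (use eps in auto)
qed

text \<open>Here p/(1-p) tends to 0. As long as u^2 (p/(1-p))^3 is at most 1/2, small sides of size
  2 dominate \<open>core_weight\<close>, and only polylogarithmic factors stand against s^2 / n. For
  larger u the product p u exceeds a power of n, and exp(-pu/4) beats the polynomial factors that
  remain.\<close>

lemma whp_bp_eq_sparse:
  assumes g: "-1/3 < \<gamma>" "\<gamma> < 0"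
  shows "whp (\<lambda>n. real n powr \<gamma>) (\<lambda>n E. bp n E = n - alpha n E)"
proof -
  define g where "g = - \<gamma>"
  have g0: "0 < g" "\<gamma> = - g" using g by (auto simp: g_def)
  \<comment> \<open>Places \<open>-1/3 + 2 * \<eta>\<close> midway between -1/3 and
    \<open>\<gamma>\<close>.\<close>
  define \<eta> where "\<eta> = (\<gamma> + 1/3) / 4"
  have eta: "0 < \<eta>" "\<eta> < 1/6" "-1/3 + 2 * \<eta> \<le> \<gamma>" 
    using g unfolding \<eta>_def by (simp_all add: field_simps)
  have e1: "\<forall>\<^sub>F n in sequentially. real n powr (-g) < 1/16" using g0 by real_asymp
  have e2: "\<forall>\<^sub>F n in sequentially. 4 * (real n)\<^sup>2 * real n powr (2 / g) * exp (- (real n powr (g/2) / 16)) \<le> real n powr (-1/10)"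
    using g0 by real_asymp
  \<comment> \<open>The constants 48 = 12 * 4 and 69632 = 17 * 4096 arise in the first case below; 1
    + 2 ln(3n) bounds p (s+1).\<close>
  have e3: "\<forall>\<^sub>F n in sequentially. 48 * real n powr (-1/3) * (69632 * (1 + 2 * ln (3 * real n)) ^ 4) \<le> real n powr (-1/10)"
    by real_asymp
  have e4: "\<forall>\<^sub>F n in sequentially. ln 2 \<le> g / 2 * ln (real n)" using g0 by real_asymp
  show ?thesis
  proof (rule whp_bp_eq[where \<eta> = \<eta> and \<epsilon> = "1/20"])
    show "\<forall>\<^sub>F n in sequentially. real n powr (-1/3 + 2 * \<eta>) \<le> real n powr \<gamma> \<and> real n powr \<gamma> < 1/2"
      using e1 eventually_ge_at_top[of 1]
    proof eventually_elim
      case (elim n)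
      have "real n powr (-1/3 + 2 * \<eta>) \<le> real n powr \<gamma>" using elim eta by (intro powr_mono) auto
      thus ?case using elim by (simp add: g_def)
    qed
    show "\<forall>\<^sub>F n in sequentially. \<forall>s u. alpha_window n (real n powr \<gamma>) \<eta> (1/20) s \<longrightarrow> Suc s < u \<longrightarrow> u \<le> n \<longrightarrow>
       2 * (real s + 1) * core_weight (real n powr \<gamma>) u / inv_sqrt_compl (real n powr \<gamma>) ^ (u - 1) \<le> real n powr (-2 * (1/20))"
      using e1 e2 e3 e4 eventually_ge_at_top[of 2]
    proof eventually_elim
      case (elim n)
      show ?case
      proof (intro allI impI)
        fix s u assume s: "alpha_window n (real n powr \<gamma>) \<eta> (1/20) s" and u: "Suc s < u" "u \<le> n"
        define N where "N = real n"
        define p where "p = N powr \<gamma>"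
        define lam where "lam = p / (1 - p)"
        define y where "y = inv_sqrt_compl p"
        have N: "2 \<le> N" using elim by (simp add: N_def)
        have p: "0 < p" "p < 1/16" using elim N by (auto simp: p_def N_def g0)
        have y: "1 < y" "y \<le> 2" "0 < y" using inv_sqrt_compl_bounds[of p] p by (auto simp: y_def)
        have lam: "0 < lam" "lam < 1" "lam \<le> 2 * p" using p by (auto simp: lam_def field_simps)
        have ss: "1 \<le> s" "real s \<le> N powr (1/3 - \<eta>)" "y ^ (s - 1) \<le> 3 * N / real s" "N / (2 * (real s + 1)) \<le> y ^ s"
          using s by (auto simp: alpha_window_def N_def p_def y_def)
        have lny: "p / 2 \<le> ln y"
        proof -
          have "ln y = - (ln (1 - p) / 2)" unfolding y_def using p by (simp add: ln_div ln_sqrt)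
          moreover have "ln (1 - p) \<le> - p" using ln_le_minus_one[of "1 - p"] p by simp
          ultimately show ?thesis by linarith
        qed
        have yexp: "exp (p / 2) \<le> y" using lny y by (metis exp_le_cancel_iff exp_ln)
        define V where "V = 1 + lam\<^sup>2"
        define h where "h = (\<Sum>a=2..u. ((real u)\<^sup>2 * lam ^ a) ^ a)"
        have core_weight: "core_weight p u = V ^ u * h" by (simp add: core_weight_def V_def h_def lam_def)
        have V: "1 \<le> V" by (simp add: V_def)
        have h0: "0 \<le> h" unfolding h_def using lam by (intro sum_nonneg) auto
        have u1: "1 \<le> u" "2 \<le> u" using u by auto
        have "2 * (real s + 1) * core_weight p u / y ^ (u - 1) \<le> N powr (-1/10)"
        proof (cases "(real u)\<^sup>2 * lam ^ 3 \<le> 1/2")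
          case True
          have hb: "h \<le> (real u * lam) ^ 4 + 1"
          proof -
            have "h = ((real u)\<^sup>2 * lam ^ 2) ^ 2 + (\<Sum>a=3..u. ((real u)\<^sup>2 * lam ^ a) ^ a)"
              unfolding h_def using u1 by (subst sum.atLeast_Suc_atMost) (auto simp: eval_nat_numeral)
            also have "(\<Sum>a=3..u. ((real u)\<^sup>2 * lam ^ a) ^ a) \<le> (\<Sum>a=3..u. (1/2) ^ a)"
            proof (intro sum_mono power_mono)
              fix a assume "a \<in> {3..u}"
              hence "(real u)\<^sup>2 * lam ^ a \<le> (real u)\<^sup>2 * lam ^ 3"
                using lam by (intro mult_left_mono power_decreasing) auto
              thus "(real u)\<^sup>2 * lam ^ a \<le> 1/2" using True by linarith
            qed (use lam in auto)
            also have "\<dots> \<le> (\<Sum>a=1..u. (1/2::real) ^ a)" by (intro sum_mono2) auto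
            also have "\<dots> \<le> 2 * (1/2)" by (rule geometric_sum_le) auto
            finally show ?thesis by (simp add: power_mult_distrib power_mult[symmetric])
          qed
          have Vb: "V ^ u \<le> 3"
          proof -
            have "(lam\<^sup>2 * real u)\<^sup>2 = (real u)\<^sup>2 * lam ^ 3 * lam" by (simp add: power_mult_distrib eval_nat_numeral)
            also have "\<dots> \<le> 1/2 * 1" using True lam by (intro mult_mono) auto
            also have "\<dots> \<le> 1\<^sup>2" by simp
            finally have "lam\<^sup>2 * real u \<le> 1" by (rule power2_le_imp_le) simp
            have "V ^ u \<le> exp (lam\<^sup>2) ^ u" unfolding V_def by (intro power_mono) auto
            also have "\<dots> = exp (lam\<^sup>2 * real u)" by (simp add: exp_of_nat2_mult)
            also have "\<dots> \<le> exp 1" using \<open>lam\<^sup>2 * real u \<le> 1\<close> by simp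
            also have "\<dots> \<le> 3" by (rule exp_le)
            finally show ?thesis .
          qed
          \<comment> \<open>Excess of the core over \<open>s\<close> in units of 1/p. From y >=
            exp(p/2) there is a gain exp(x/2) beyond y^s, which absorbs the growth (1+x)^4 of
            \<open>h\<close>.\<close>
          define x where "x = p * (real u - 1 - real s)"
          have x: "0 \<le> x" using p u by (auto simp: x_def intro!: mult_nonneg_nonneg)
          have yb: "N / (2 * (real s + 1)) * exp (x / 2) \<le> y ^ (u - 1)"
          proof -
            have "x / 2 = real (u - 1 - s) * (p / 2)" using u by (simp add: x_def of_nat_diff)
            hence "exp (x / 2) = exp (p / 2) ^ (u - 1 - s)" by (simp only: exp_of_nat_mult)
            also have "\<dots> \<le> y ^ (u - 1 - s)" using yexp by (intro power_mono) auto
            finally have "N / (2 * (real s + 1)) * exp (x / 2) \<le> y ^ s * y ^ (u - 1 - s)"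
              using ss y N by (intro mult_mono) auto
            also have "\<dots> = y ^ (u - 1)" using u by (simp add: power_add[symmetric])
            finally show ?thesis .
          qed
          define T where "T = 1 + 2 * ln (3 * N)"
          have lnN: "0 \<le> ln (3 * N)" using N by simp
          have T: "1 \<le> T" using lnN by (simp add: T_def)
          have psT: "p * (real s + 1) \<le> T"
          proof -
            have "y ^ (s - 1) \<le> 3 * N" using ss N by (elim order_trans) (simp add: field_simps)
            hence "ln (y ^ (s - 1)) \<le> ln (3 * N)" using y N by (intro ln_mono) auto
            hence "real (s - 1) * ln y \<le> ln (3 * N)" using y by (simp add: ln_realpow)
            moreover have "real (s - 1) * (p / 2) \<le> real (s - 1) * ln y" using lny by (intro mult_left_mono) auto
            ultimately have "real (s - 1) * (p / 2) \<le> ln (3 * N)" by linarith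
            hence "p * (real s - 1) \<le> 2 * ln (3 * N)" using ss by (simp add: of_nat_diff mult.commute)
            thus ?thesis using p by (simp add: T_def algebra_simps)
          qed
          have lu: "real u * lam \<le> 2 * T * (1 + x)"
          proof -
            have "real u * lam \<le> real u * (2 * p)" using lam by (intro mult_left_mono) auto
            also have "\<dots> = 2 * (x + p * (real s + 1))" by (simp add: x_def algebra_simps)
            also have "\<dots> \<le> 2 * (T * x + T)" using psT T x mult_right_mono[of 1 T x] by simp
            finally show ?thesis by (simp add: algebra_simps)
          qed
          have expx: "(1 + x) ^ 4 \<le> 4096 * exp (x / 2)"
          proof -
            have "1 + x \<le> 8 * exp (x / 8)" using exp_ge_add_one_self[of "x / 8"] by linarith
            hence "(1 + x) ^ 4 \<le> (8 * exp (x / 8)) ^ 4" using x by (intro power_mono) auto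
            also have "\<dots> = 4096 * exp (x / 2)" by (simp add: power_mult_distrib exp_of_nat_mult[symmetric])
            finally show ?thesis .
          qed
          have "(real u * lam) ^ 4 \<le> (2 * T * (1 + x)) ^ 4" using lu lam by (intro power_mono) auto
          also have "\<dots> = 16 * (T ^ 4 * (1 + x) ^ 4)" by (simp add: power_mult_distrib)
          finally have "h \<le> 16 * (T ^ 4 * (1 + x) ^ 4) + 1" using hb by linarith
          also have "\<dots> \<le> 17 * (T ^ 4 * (1 + x) ^ 4)"
            using mult_mono[of 1 "T ^ 4" 1 "(1 + x) ^ 4"] T x by (simp add: one_le_power)
          also have "\<dots> \<le> 17 * (T ^ 4 * (4096 * exp (x / 2)))"
            using expx T by (intro mult_left_mono) auto
          finally have hb2: "h \<le> 69632 * T ^ 4 * exp (x / 2)" by simp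
          have "2 * (real s + 1) * core_weight p u / y ^ (u - 1) \<le>
              2 * (real s + 1) * (3 * (69632 * T ^ 4 * exp (x / 2))) / (N / (2 * (real s + 1)) * exp (x / 2))"
          proof (rule frac_le)
            show "2 * (real s + 1) * core_weight p u \<le> 2 * (real s + 1) * (3 * (69632 * T ^ 4 * exp (x / 2)))"
              unfolding core_weight using Vb hb2 h0 V by (intro mult_left_mono mult_mono) auto
            show "0 < N / (2 * (real s + 1)) * exp (x / 2)" using N by (intro mult_pos_pos divide_pos_pos) auto
          qed (use yb T in auto)
          also have "\<dots> = 12 * (real s + 1)\<^sup>2 / N * (69632 * T ^ 4)"
            using N by (simp add: field_simps power2_eq_square)
          also have "\<dots> \<le> 12 * (2 * N powr (1/3))\<^sup>2 / N * (69632 * T ^ 4)"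
          proof (intro mult_right_mono divide_right_mono mult_left_mono power_mono)
            have "real s \<le> N powr (1/3)" using ss(2) powr_mono[of "1/3 - \<eta>" "1/3" N] N eta by linarith
            moreover have "1 \<le> N powr (1/3)" using N by (simp add: ge_one_powr_ge_zero)
            ultimately show "real s + 1 \<le> 2 * N powr (1/3)" by simp
          qed (use N T in auto)
          also have "12 * (2 * N powr (1/3))\<^sup>2 / N = 48 * N powr (-1/3)"
          proof -
            have "(N powr (1/3))\<^sup>2 / N = N powr (2/3) / N powr 1" using N by (simp add: powr_power)
            also have "\<dots> = N powr (2/3 - 1)" by (simp only: powr_diff)
            finally have "(N powr (1/3))\<^sup>2 / N = N powr (-1/3)" by simp
            thus ?thesis unfolding power_mult_distrib by (simp only: times_divide_eq_right[symmetric] mult.assoc) simp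
          qed
          also have "48 * N powr (-1/3) * (69632 * T ^ 4) \<le> N powr (-1/10)" using elim by (simp add: N_def T_def)
          finally show ?thesis .
        next
          case False
          have "h \<le> real u * exp ((ln (real u))\<^sup>2 / ln (1 / lam))"
            unfolding h_def using lam u1 by (intro sum_power_gaussian_le) auto
          also have "\<dots> \<le> N * exp (2 / g * ln N)"
          proof (intro mult_mono)
            have lnu: "0 \<le> ln (real u)" "ln (real u) \<le> ln N" using u1 u N by (auto simp: N_def)
            have lnN: "0 < ln N" using N by simp
            have "g / 2 * ln N \<le> ln (1 / lam)"
            proof -
              have "ln lam \<le> ln (2 * p)" using lam p by (intro ln_mono) auto
              also have "\<dots> = ln 2 - g * ln N" using p N unfolding p_def by (simp add: ln_mult ln_powr g0)
              also have "\<dots> \<le> g / 2 * ln N - g * ln N" using elim by (simp add: N_def)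
              also have "\<dots> = - (g / 2 * ln N)" by simp
              finally show ?thesis using lam by (simp add: ln_div)
            qed
            hence "(ln (real u))\<^sup>2 / ln (1 / lam) \<le> (ln N)\<^sup>2 / (g / 2 * ln N)"
              using lnu lnN g0 by (intro frac_le power_mono mult_pos_pos) auto
            also have "\<dots> = 2 / g * ln N" using lnN g0 by (simp add: power2_eq_square field_simps)
            finally show "exp ((ln (real u))\<^sup>2 / ln (1 / lam)) \<le> exp (2 / g * ln N)" by simp
            show "real u \<le> N" using u by (simp add: N_def)
          qed (use N in auto)
          also have "\<dots> = N * N powr (2 / g)" using N by (simp add: powr_def)
          finally have hb: "h \<le> N * N powr (2 / g)" .
          \<comment> \<open>In this case u^2 (2p)^3 exceeds 1/2, so (p u)^2 is at least 1/(16 p), a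
            positive power of n up to the constant.\<close>
          have ub: "N powr (g/2) / 4 \<le> p * real u"
          proof (rule power2_le_imp_le)
            have "lam ^ 3 \<le> (2 * p) ^ 3" using lam by (intro power_mono) auto
            hence "(real u)\<^sup>2 * lam ^ 3 \<le> (real u)\<^sup>2 * (2 * p) ^ 3" by (intro mult_left_mono) auto
            hence "1/2 \<le> (real u)\<^sup>2 * (2 * p) ^ 3" using False by linarith
            also have "\<dots> = 8 * p * (p * real u)\<^sup>2" by (simp add: power_mult_distrib eval_nat_numeral)
            finally have "1 / p / 16 \<le> (p * real u)\<^sup>2" using p by (simp add: field_simps)
            moreover have "1 / p = N powr g" by (simp add: p_def g0 powr_minus_divide)
            moreover have "(N powr (g/2) / 4)\<^sup>2 = N powr g / 16" using N by (simp add: power_divide powr_power)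
            ultimately show "(N powr (g/2) / 4)\<^sup>2 \<le> (p * real u)\<^sup>2" by simp
          qed (use p in auto)
          have Vy: "V / y \<le> exp (- (p / 4))"
          proof -
            have "V \<le> exp (lam\<^sup>2)" unfolding V_def by simp
            also have "\<dots> \<le> exp (p / 4)"
            proof -
              have "lam\<^sup>2 \<le> (2 * p)\<^sup>2" using lam by (intro power_mono) auto
              also have "\<dots> = 4 * p * p" by (simp add: power2_eq_square)
              also have "\<dots> \<le> 4 * p * (1/16)" using p by (intro mult_left_mono) auto
              finally show ?thesis by simp
            qed
            finally have "V / y \<le> exp (p / 4) / exp (p / 2)" using yexp by (intro frac_le) auto
            also have "\<dots> = exp (- (p / 4))" by (simp add: exp_diff[symmetric])
            finally show ?thesis .
          qed
          have "2 * (real s + 1) * core_weight p u / y ^ (u - 1) = 2 * (real s + 1) * (y * (V / y) ^ u * h)"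
          proof -
            have "y ^ (u - 1) = y ^ u / y" using y u1 by (simp add: power_diff)
            thus ?thesis unfolding core_weight using y by (simp add: power_divide)
          qed
          also have "\<dots> \<le> 2 * N * (2 * exp (- (N powr (g/2) / 16)) * (N * N powr (2 / g)))"
          proof (intro mult_mono)
            show "real s + 1 \<le> N" using u by (simp add: N_def)
            have "(V / y) ^ u \<le> exp (- (p / 4)) ^ u" using Vy V y by (intro power_mono) auto
            also have "\<dots> = exp (- (p * real u / 4))" by (simp add: exp_of_nat_mult[symmetric] mult.commute)
            also have "\<dots> \<le> exp (- (N powr (g/2) / 16))" using ub by simp
            finally show "(V / y) ^ u \<le> exp (- (N powr (g/2) / 16))" .
          qed (use y V h0 hb N in auto)
          also have "\<dots> = 4 * N\<^sup>2 * N powr (2 / g) * exp (- (N powr (g/2) / 16))"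
            by (simp add: power2_eq_square)
          also have "\<dots> \<le> N powr (-1/10)" using elim by (simp add: N_def)
          finally show ?thesis .
        qed
        thus "2 * (real s + 1) * core_weight (real n powr \<gamma>) u / inv_sqrt_compl (real n powr \<gamma>) ^ (u - 1) \<le> real n powr (-2 * (1/20))"
          by (simp add: N_def p_def y_def)
      qed
    qed
  qed (use eta in auto)
qed

section \<open>The lower bound up to a constant factor\<close>

lemma hoeffding_two_point:
  fixes h p :: real
  assumes "0 \<le> p" "p \<le> 1"
  shows "1 - p + p * exp h \<le> exp (h * p + h\<^sup>2 / 8)"
proof -
  have key: "1 - p + p * exp h \<le> exp (h * p + h\<^sup>2 / 8)" if "0 \<le> h" "0 \<le> p" "p \<le> 1" for h p :: real
  proof -
    have pos: "0 < 1 + p * (exp h - 1)" using that by (intro add_pos_nonneg mult_nonneg_nonneg) auto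
    have "- h * p + ln (1 + p * (exp h - 1)) \<le> h\<^sup>2 / 8" using that by (intro Hoeffdings_lemma_aux) auto
    hence "ln (1 + p * (exp h - 1)) \<le> h * p + h\<^sup>2 / 8" by simp
    hence "1 + p * (exp h - 1) \<le> exp (h * p + h\<^sup>2 / 8)" using pos by (metis exp_le_cancel_iff exp_ln)
    thus ?thesis by (simp add: algebra_simps)
  qed
  show ?thesis
  proof (cases "0 \<le> h")
    case False
    \<comment> \<open>Exchanging the two outcomes reduces negative \<open>h\<close> to
      \<open>- h\<close>, with \<open>1 - p\<close> in place of \<open>p\<close>.\<close>
    have "1 - p + p * exp h = exp h * (1 - (1 - p) + (1 - p) * exp (- h))"
      by (simp add: algebra_simps exp_minus)
    also have "\<dots> \<le> exp h * exp (- h * (1 - p) + (- h)\<^sup>2 / 8)"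
      using False assms by (intro mult_left_mono key) auto
    also have "\<dots> = exp (h * p + h\<^sup>2 / 8)" by (simp add: exp_add[symmetric] algebra_simps)
    finally show ?thesis .
  qed (use key assms in auto)
qed

text \<open>Exposes one coordinate at a time: \<open>g\<close> averages \<open>f\<close> over
  \<open>x\<close> and inherits the difference bounds of the other coordinates, while averaging over
  \<open>x\<close> costs one factor by \<open>hoeffding_two_point\<close>.\<close>

lemma bexp_exp_le:
  fixes f :: "'a set \<Rightarrow> real"
  assumes "finite A" "0 \<le> p" "p \<le> 1"
    and "\<And>x E. x \<in> A \<Longrightarrow> E \<subseteq> A \<Longrightarrow> x \<notin> E \<Longrightarrow> \<bar>f (insert x E) - f E\<bar> \<le> c x"
  shows "bexp A p (\<lambda>E. exp (t * f E)) \<le> exp (t * bexp A p f + t\<^sup>2 * (\<Sum>x\<in>A. (c x)\<^sup>2) / 8)"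
  using assms(1,4)
proof (induction A arbitrary: f rule: finite_induct)
  case (insert x A)
  define g where "g E = p * f (insert x E) + (1 - p) * f E" for E
  have gb: "\<bar>g (insert z E) - g E\<bar> \<le> c z" if z: "z \<in> A" "E \<subseteq> A" "z \<notin> E" for z E
  proof -
    have "\<bar>f (insert z (insert x E)) - f (insert x E)\<bar> \<le> c z" "\<bar>f (insert z E) - f E\<bar> \<le> c z"
      using z insert.hyps by (auto intro!: insert.prems)
    moreover have "g (insert z E) - g E = p * (f (insert z (insert x E)) - f (insert x E)) + (1 - p) * (f (insert z E) - f E)"
      unfolding g_def insert_commute[of x z] by (simp add: algebra_simps)
    hence "\<bar>g (insert z E) - g E\<bar> \<le> p * \<bar>f (insert z (insert x E)) - f (insert x E)\<bar> + (1 - p) * \<bar>f (insert z E) - f E\<bar>"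
      using assms(2,3) by (metis abs_triangle_ineq abs_mult abs_of_nonneg diff_ge_0_iff_ge)
    moreover have "\<dots> \<le> p * c z + (1 - p) * c z"
      using assms(2,3) calculation by (intro add_mono mult_left_mono) auto
    ultimately show ?thesis by (simp add: algebra_simps)
  qed
  have "bexp (insert x A) p (\<lambda>E. exp (t * f E)) = bexp A p (\<lambda>E. p * exp (t * f (insert x E)) + (1 - p) * exp (t * f E))"
    using insert.hyps by (simp add: bexp_insert bexp_add bexp_cmult)
  also have "\<dots> \<le> bexp A p (\<lambda>E. exp (t\<^sup>2 * (c x)\<^sup>2 / 8) * exp (t * g E))"
  proof (intro bexp_mono assms)
    fix E assume E: "E \<subseteq> A"
    define d where "d = f (insert x E) - f E"
    have d: "\<bar>d\<bar> \<le> c x" unfolding d_def using E insert.hyps by (intro insert.prems) auto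
    hence d2: "d\<^sup>2 \<le> (c x)\<^sup>2" by (metis abs_ge_zero order_trans power2_abs power_mono)
    have "p * exp (t * f (insert x E)) + (1 - p) * exp (t * f E) = exp (t * f E) * (1 - p + p * exp (t * d))"
      by (simp add: d_def algebra_simps exp_add[symmetric])
    also have "\<dots> \<le> exp (t * f E) * exp (t * d * p + (t * d)\<^sup>2 / 8)"
      using assms by (intro mult_left_mono hoeffding_two_point) auto
    also have "\<dots> = exp (t * g E + t\<^sup>2 * d\<^sup>2 / 8)"
    proof -
      have "g E = f E + d * p" by (simp add: g_def d_def algebra_simps)
      thus ?thesis by (simp add: exp_add[symmetric] power_mult_distrib algebra_simps)
    qed
    also have "\<dots> \<le> exp (t * g E + t\<^sup>2 * (c x)\<^sup>2 / 8)" using d2 by (simp add: mult_left_mono)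
    finally show "p * exp (t * f (insert x E)) + (1 - p) * exp (t * f E) \<le> exp (t\<^sup>2 * (c x)\<^sup>2 / 8) * exp (t * g E)"
      by (simp add: exp_add[symmetric] add.commute)
  qed
  also have "\<dots> \<le> exp (t\<^sup>2 * (c x)\<^sup>2 / 8) * exp (t * bexp A p g + t\<^sup>2 * (\<Sum>x\<in>A. (c x)\<^sup>2) / 8)"
    unfolding bexp_cmult using insert.IH[of g, OF gb] by (intro mult_left_mono) auto
  also have "bexp A p g = bexp (insert x A) p f"
    using insert.hyps unfolding g_def by (simp add: bexp_insert bexp_add bexp_cmult)
  finally show ?case using insert.hyps by (simp add: exp_add[symmetric] algebra_simps add_divide_distrib)
qed simp

lemma bexp_lower_tail:
  fixes f :: "'a set \<Rightarrow> real"
  assumes A: "finite A" "0 \<le> p" "p \<le> 1"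
    and c: "\<And>x E. x \<in> A \<Longrightarrow> E \<subseteq> A \<Longrightarrow> x \<notin> E \<Longrightarrow> \<bar>f (insert x E) - f E\<bar> \<le> c x"
    and C: "(\<Sum>x\<in>A. (c x)\<^sup>2) \<le> C" "0 < C" and d: "0 \<le> d"
    and m: "m + d \<le> bexp A p f"
  shows "bexp A p (\<lambda>E. of_bool (f E \<le> m)) \<le> exp (- 2 * d\<^sup>2 / C)"
proof -
  \<comment> \<open>The minimiser of \<open>- t * d + t\<^sup>2 * C / 8\<close>.\<close>
  define t where "t = 4 * d / C"
  have t: "0 \<le> t" using d C by (simp add: t_def)
  have "bexp A p (\<lambda>E. of_bool (f E \<le> m)) \<le> bexp A p (\<lambda>E. exp (t * m) * exp (- t * f E))"
  proof (intro bexp_mono A)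
    fix E
    show "of_bool (f E \<le> m) \<le> exp (t * m) * exp (- t * f E)"
    proof (cases "f E \<le> m")
      case True
      hence "t * f E \<le> t * m" using t by (intro mult_left_mono)
      thus ?thesis by (simp add: exp_add[symmetric])
    qed simp
  qed
  also have "\<dots> \<le> exp (t * m) * exp (- t * bexp A p f + (- t)\<^sup>2 * (\<Sum>x\<in>A. (c x)\<^sup>2) / 8)"
    unfolding bexp_cmult using A c by (intro mult_left_mono bexp_exp_le) auto
  also have "\<dots> \<le> exp (t * m) * exp (- t * (m + d) + t\<^sup>2 * C / 8)"
  proof (intro mult_left_mono, unfold exp_le_cancel_iff, intro add_mono divide_right_mono)
    show "- t * bexp A p f \<le> - t * (m + d)" using m t by (simp add: mult_left_mono)
    show "(- t)\<^sup>2 * (\<Sum>x\<in>A. (c x)\<^sup>2) \<le> t\<^sup>2 * C" using C by (simp add: mult_left_mono)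
  qed auto
  also have "\<dots> = exp (- t * d + t\<^sup>2 * C / 8)" by (simp add: exp_add[symmetric] algebra_simps)
  also have "- t * d + t\<^sup>2 * C / 8 = - 2 * d\<^sup>2 / C" using C by (simp add: t_def power2_eq_square field_simps)
  finally show ?thesis .
qed

text \<open>A biclique with one side \<open>A\<close> containing \<open>v\<close> covers the edge \<open>vw\<close> only if \<open>A\<close> lies in the
  neighbourhood of \<open>w\<close>. The edges below cannot be covered by any biclique with a side in \<open>\<A>\<close>.\<close>

definition uncovered :: "nat set set \<Rightarrow> nat set set \<Rightarrow> nat \<Rightarrow> nat \<Rightarrow> bool" where
  "uncovered \<A> E v w \<longleftrightarrow> v \<noteq> w \<and> {v, w} \<in> E \<and> (\<forall>A\<in>\<A>. v \<in> A \<longrightarrow> \<not> (\<forall>y\<in>A. {w, y} \<in> E)) \<and>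
     (\<forall>A\<in>\<A>. w \<in> A \<longrightarrow> \<not> (\<forall>z\<in>A. {v, z} \<in> E))"

text \<open>Ordered pairs, so every edge counts twice; this is the factor 2 in
  \<open>big_or_small\<close>.\<close>

definition uncovered_count :: "nat set \<Rightarrow> nat set set \<Rightarrow> nat set set \<Rightarrow> nat" where
  "uncovered_count U \<A> E = card {(v, w) \<in> U \<times> U. uncovered \<A> E v w}"

lemma edge_in_all_edges: "v \<noteq> w \<Longrightarrow> v < n \<Longrightarrow> w < n \<Longrightarrow> {v, w} \<in> all_edges n"
  by (simp add: all_edges_eq)

lemma loop_notin_all_edges: "{v, v} \<notin> all_edges n"
  by (simp add: all_edges_eq)

text \<open>Small members of the family are blocked by forbidding one edge each; the large ones are
  unlikely even in total.\<close>

lemma pr_uncovered_ge: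
  assumes p: "0 < p" "p < 1" and vw: "v \<noteq> w" "v < n" "w < n"
    and fin: "finite \<A>" and sub: "\<And>A. A \<in> \<A> \<Longrightarrow> A \<subseteq> {..<n} \<and> 2 \<le> card A"
    and small: "\<And>x. x \<in> {v, w} \<Longrightarrow> card {A\<in>\<A>. x \<in> A \<and> card A \<le> a} \<le> h"
    and large: "\<And>x. x \<in> {v, w} \<Longrightarrow> (\<Sum>A\<in>{A\<in>\<A>. x \<in> A \<and> a < card A}. p ^ (card A - 1)) \<le> 1/4"
  shows "p * (1 - p) ^ (2 * h) / 2 \<le> pr n p (\<lambda>E. uncovered \<A> E v w)"
proof -
  define rep where "rep A x = (SOME y. y \<in> A \<and> y \<noteq> x)" for A and x :: nat
  have rep: "rep A x \<in> A \<and> rep A x \<noteq> x" if "A \<in> \<A>" for A x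
  proof -
    have "\<exists>y. y \<in> A \<and> y \<noteq> x"
    proof (rule ccontr)
      assume "\<nexists>y. y \<in> A \<and> y \<noteq> x"
      hence "A \<subseteq> {x}" by auto
      hence "card A \<le> card {x}" by (intro card_mono) auto
      thus False using sub[OF that] by simp
    qed
    thus ?thesis unfolding rep_def by (rule someI_ex)
  qed
  \<comment> \<open>A member that also contains \<open>z\<close> needs no blocking, since no vertex
    is adjacent to itself.\<close>
  define S where "S x z = {A\<in>\<A>. x \<in> A \<and> card A \<le> a \<and> z \<notin> A}" for x z
  define T where "T x z = {A\<in>\<A>. x \<in> A \<and> a < card A \<and> z \<notin> A}" for x z
  \<comment> \<open>For each small member through one endpoint, the edge from the other endpoint to
    a second vertex of that member is forbidden; at most \<open>2 * h\<close> edges in all.\<close>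
  define R where "R = (\<lambda>A. {w, rep A v}) ` S v w \<union> (\<lambda>A. {v, rep A w}) ` S w v"
  have finS: "finite (S x z)" "finite (T x z)" for x z using fin by (auto simp: S_def T_def)
  have Ssub: "card (S x z) \<le> h" if "x \<in> {v, w}" for x z
  proof -
    have "card (S x z) \<le> card {A\<in>\<A>. x \<in> A \<and> card A \<le> a}" using fin by (intro card_mono) (auto simp: S_def)
    thus ?thesis using small[OF that] by linarith
  qed
  have "card R \<le> card (S v w) + card (S w v)"
    unfolding R_def by (rule order_trans[OF card_Un_le]) (intro add_mono card_image_le finS)
  hence cR: "card R \<le> 2 * h" using Ssub[of v w] Ssub[of w v] by simp
  have Rsub: "R \<subseteq> all_edges n"
  proof
    fix e assume "e \<in> R"
    then consider A where "A \<in> S v w" "e = {w, rep A v}" | A where "A \<in> S w v" "e = {v, rep A w}"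
      unfolding R_def by auto
    thus "e \<in> all_edges n"
    proof cases
      case (1 A)
      hence "A \<in> \<A>" "w \<notin> A" by (auto simp: S_def)
      hence "rep A v \<in> A" "A \<subseteq> {..<n}" using rep sub by blast+
      thus ?thesis using 1 \<open>w \<notin> A\<close> vw by (auto intro!: edge_in_all_edges)
    next
      case (2 A)
      hence "A \<in> \<A>" "v \<notin> A" by (auto simp: S_def)
      hence "rep A w \<in> A" "A \<subseteq> {..<n}" using rep sub by blast+
      thus ?thesis using 2 \<open>v \<notin> A\<close> vw by (auto intro!: edge_in_all_edges)
    qed
  qed
  have eR: "{v, w} \<notin> R"
  proof
    assume "{v, w} \<in> R"
    then consider A where "A \<in> \<A>" "{v, w} = {w, rep A v}" | A where "A \<in> \<A>" "{v, w} = {v, rep A w}"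
      unfolding R_def S_def by auto
    thus False
    proof cases
      case (1 A)
      thus False using rep[OF 1(1), of v] vw by (auto simp: doubleton_eq_iff)
    next
      case (2 A)
      thus False using rep[OF 2(1), of w] vw by (auto simp: doubleton_eq_iff)
    qed
  qed
  let ?G = "\<lambda>E. {{v, w}} \<subseteq> E \<and> R \<inter> E = {}"
  define G0 where "G0 = p * (1 - p) ^ card R"
  have G0: "0 \<le> G0" using p by (simp add: G0_def)
  have prG: "pr n p ?G = G0"
    unfolding G0_def using Rsub eR vw by (subst bexp_pattern) (auto intro: edge_in_all_edges)
  define F where "F z A = (\<lambda>y. {z, y}) ` A" for z and A :: "nat set"
  \<comment> \<open>The edge \<open>vw\<close> lies in \<open>F z A\<close> and is already paid for
    in \<open>G0\<close>; hence the exponent \<open>card A - 1\<close>.\<close>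
  have prF: "pr n p (\<lambda>E. ?G E \<and> F z A \<subseteq> E) \<le> G0 * p ^ (card A - 1)"
    if xz: "{x, z} = {v, w}" and A: "A \<in> T x z" for x z A
  proof (cases "F z A \<inter> R = {}")
    case True
    have AA: "A \<in> \<A>" "x \<in> A" "z \<notin> A" using A by (auto simp: T_def)
    have An: "A \<subseteq> {..<n}" "2 \<le> card A" using sub AA by auto
    have zn: "z < n" using xz vw by (auto simp: doubleton_eq_iff)
    have cF: "card (F z A) = card A" unfolding F_def
      using AA by (intro card_image) (auto simp: inj_on_def doubleton_eq_iff)
    have Fs: "F z A \<subseteq> all_edges n" unfolding F_def using An zn AA by (auto intro!: edge_in_all_edges)
    have vwF: "{v, w} \<in> F z A" unfolding xz[symmetric] F_def using AA by (auto simp: insert_commute)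
    have "pr n p (\<lambda>E. ?G E \<and> F z A \<subseteq> E) = pr n p (\<lambda>E. F z A \<subseteq> E \<and> R \<inter> E = {})"
      using vwF by (intro bexp_cong refl arg_cong[where f = of_bool]) auto
    also have "\<dots> = p ^ card A * (1 - p) ^ card R"
      using True Fs Rsub cF by (subst bexp_pattern) auto
    also have "\<dots> = G0 * p ^ (card A - 1)" using An by (cases "card A") (auto simp: G0_def)
    finally show ?thesis by simp
  next
    case False
    hence "pr n p (\<lambda>E. ?G E \<and> F z A \<subseteq> E) = bexp (all_edges n) p (\<lambda>_. 0)"
      by (intro bexp_cong) auto
    thus ?thesis using G0 p by simp
  qed
  have Tsum: "(\<Sum>A\<in>T x z. p ^ (card A - 1)) \<le> 1/4" if "x \<in> {v, w}" for x z
  proof -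
    have "(\<Sum>A\<in>T x z. p ^ (card A - 1)) \<le> (\<Sum>A\<in>{A\<in>\<A>. x \<in> A \<and> a < card A}. p ^ (card A - 1))"
      using fin p by (intro sum_mono2) (auto simp: T_def)
    thus ?thesis using large[OF that] by linarith
  qed
  have bound: "(\<Sum>A\<in>T x z. pr n p (\<lambda>E. ?G E \<and> F z A \<subseteq> E)) \<le> G0 * (1/4)"
    if "{x, z} = {v, w}" for x z
  proof -
    have "(\<Sum>A\<in>T x z. pr n p (\<lambda>E. ?G E \<and> F z A \<subseteq> E)) \<le> (\<Sum>A\<in>T x z. G0 * p ^ (card A - 1))"
      using prF[OF that] by (intro sum_mono) auto
    also have "\<dots> = G0 * (\<Sum>A\<in>T x z. p ^ (card A - 1))" by (simp add: sum_distrib_left)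
    also have "\<dots> \<le> G0 * (1/4)" using Tsum[of x z] that G0 by (intro mult_left_mono) auto
    finally show ?thesis .
  qed
  \<comment> \<open>A union bound within the event \<open>?G\<close>: after taking expectations,
    each of the two sums removes at most a quarter of \<open>G0\<close>.\<close>
  have pw: "of_bool (?G E) - (\<Sum>A\<in>T v w. of_bool (?G E \<and> F w A \<subseteq> E)) - (\<Sum>A\<in>T w v. of_bool (?G E \<and> F v A \<subseteq> E))
      \<le> (of_bool (uncovered \<A> E v w) :: real)" if E: "E \<subseteq> all_edges n" for E
  proof (cases "?G E \<and> (\<forall>A\<in>T v w. \<not> F w A \<subseteq> E) \<and> (\<forall>A\<in>T w v. \<not> F v A \<subseteq> E)")
    case True
    have block: "\<not> (\<forall>y\<in>A. {z, y} \<in> E)" if A: "A \<in> \<A>" "x \<in> A" and xz: "(x, z) \<in> {(v, w), (w, v)}" for A x z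
    proof
      assume all: "\<forall>y\<in>A. {z, y} \<in> E"
      have "z \<notin> A" using all E loop_notin_all_edges[of z n] by auto
      show False
      proof (cases "card A \<le> a")
        case c: True
        hence "A \<in> S x z" using A \<open>z \<notin> A\<close> by (simp add: S_def)
        hence "{z, rep A x} \<in> R" unfolding R_def using xz by auto
        moreover have "{z, rep A x} \<in> E" using all rep[OF A(1)] by blast
        ultimately show False using True by blast
      next
        case False
        hence "A \<in> T x z" using A \<open>z \<notin> A\<close> by (simp add: T_def)
        moreover have "F z A \<subseteq> E" using all by (auto simp: F_def)
        ultimately show False using True xz by auto
      qed
    qed
    have "uncovered \<A> E v w" unfolding uncovered_def using True vw block by auto
    hence "of_bool (uncovered \<A> E v w) = (1::real)" by simp
    moreover have "of_bool (?G E) \<le> (1::real)" by simp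
    moreover have "0 \<le> (\<Sum>A\<in>T w v. of_bool (?G E \<and> F v A \<subseteq> E) :: real)" "0 \<le> (\<Sum>A\<in>T v w. of_bool (?G E \<and> F w A \<subseteq> E) :: real)"
      by (intro sum_nonneg; simp)+
    ultimately show ?thesis by linarith
  next
    case False
    show ?thesis
    proof (cases "?G E")
      case g: True
      then consider A where "A \<in> T v w" "F w A \<subseteq> E" | A where "A \<in> T w v" "F v A \<subseteq> E" using False by blast
      thus ?thesis
      proof cases
        case (1 A)
        have "1 \<le> (\<Sum>A\<in>T v w. of_bool (?G E \<and> F w A \<subseteq> E) :: real)"
          using member_le_sum[of A "T v w" "\<lambda>A. of_bool (?G E \<and> F w A \<subseteq> E) :: real"] 1 g finS by auto
        moreover have "0 \<le> (\<Sum>A\<in>T w v. of_bool (?G E \<and> F v A \<subseteq> E) :: real)" by (intro sum_nonneg) auto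
        ultimately show ?thesis by (smt (verit) of_bool_less_eq_one zero_less_eq_of_bool)
      next
        case (2 A)
        have "1 \<le> (\<Sum>A\<in>T w v. of_bool (?G E \<and> F v A \<subseteq> E) :: real)"
          using member_le_sum[of A "T w v" "\<lambda>A. of_bool (?G E \<and> F v A \<subseteq> E) :: real"] 2 g finS by auto
        moreover have "0 \<le> (\<Sum>A\<in>T v w. of_bool (?G E \<and> F w A \<subseteq> E) :: real)" by (intro sum_nonneg) auto
        ultimately show ?thesis by (smt (verit) of_bool_less_eq_one zero_less_eq_of_bool)
      qed
    next
      case ng: False
      have "0 \<le> (\<Sum>A\<in>T w v. of_bool (?G E \<and> F v A \<subseteq> E) :: real)" "0 \<le> (\<Sum>A\<in>T v w. of_bool (?G E \<and> F w A \<subseteq> E) :: real)"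
        by (intro sum_nonneg; simp)+
      thus ?thesis using ng by (smt (verit) of_bool_eq(1) zero_less_eq_of_bool)
    qed
  qed
  have "p * (1 - p) ^ (2 * h) / 2 \<le> G0 / 2"
    unfolding G0_def using cR p by (intro divide_right_mono mult_left_mono power_decreasing) auto
  also have "\<dots> = G0 - G0 * (1/4) - G0 * (1/4)" by simp
  also have "\<dots> \<le> pr n p ?G - (\<Sum>A\<in>T v w. pr n p (\<lambda>E. ?G E \<and> F w A \<subseteq> E)) - (\<Sum>A\<in>T w v. pr n p (\<lambda>E. ?G E \<and> F v A \<subseteq> E))"
    using bound[of v w] bound[of w v] unfolding prG by (simp add: insert_commute)
  also have "\<dots> = bexp (all_edges n) p (\<lambda>E. of_bool (?G E) - (\<Sum>A\<in>T v w. of_bool (?G E \<and> F w A \<subseteq> E)) - (\<Sum>A\<in>T w v. of_bool (?G E \<and> F v A \<subseteq> E)))"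
    by (simp only: bexp_diff bexp_sum)
  also have "\<dots> \<le> pr n p (\<lambda>E. uncovered \<A> E v w)" using p by (intro bexp_mono pw) auto
  finally show ?thesis .
qed

section \<open>Expectation and concentration of the number of uncovered pairs\<close>

lemma sum_incidence:
  fixes g :: "'a set \<Rightarrow> real"
  assumes "finite U" "finite \<A>" "\<A> \<subseteq> Pow U"
  shows "(\<Sum>v\<in>U. \<Sum>A\<in>{A\<in>\<A>. v \<in> A \<and> P A}. g A) = (\<Sum>A\<in>{A\<in>\<A>. P A}. real (card A) * g A)"
proof -
  have "(\<Sum>v\<in>U. \<Sum>A\<in>{A\<in>\<A>. v \<in> A \<and> P A}. g A) = (\<Sum>v\<in>U. \<Sum>A\<in>{A\<in>\<A>. P A}. of_bool (v \<in> A) * g A)"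
    using assms by (intro sum.cong refl sum.mono_neutral_cong_left) auto
  also have "\<dots> = (\<Sum>A\<in>{A\<in>\<A>. P A}. \<Sum>v\<in>U. of_bool (v \<in> A) * g A)" by (rule sum.swap)
  also have "\<dots> = (\<Sum>A\<in>{A\<in>\<A>. P A}. real (card A) * g A)"
  proof (intro sum.cong refl)
    fix A assume "A \<in> {A\<in>\<A>. P A}"
    hence "A \<subseteq> U" using assms by auto
    have "(\<Sum>v\<in>U. of_bool (v \<in> A) * g A) = (\<Sum>v\<in>A. g A)"
      using assms \<open>A \<subseteq> U\<close> by (intro sum.mono_neutral_cong_right) auto
    thus "(\<Sum>v\<in>U. of_bool (v \<in> A) * g A) = real (card A) * g A" by simp
  qed
  finally show ?thesis .
qed

lemma card_exceed_le:
  fixes f :: "'a \<Rightarrow> real"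
  assumes "finite U" "\<And>v. v \<in> U \<Longrightarrow> 0 \<le> f v"
  shows "t * real (card {v\<in>U. t < f v}) \<le> (\<Sum>v\<in>U. f v)"
proof -
  have "t * real (card {v\<in>U. t < f v}) = (\<Sum>v\<in>{v\<in>U. t < f v}. t)" by simp
  also have "\<dots> \<le> (\<Sum>v\<in>{v\<in>U. t < f v}. f v)" by (intro sum_mono) auto
  also have "\<dots> \<le> (\<Sum>v\<in>U. f v)" using assms by (intro sum_mono2) auto
  finally show ?thesis .
qed

text \<open>Markov's inequality twice. Small members have at most \<open>a * card U\<close>
  incidences, so at most an eighth of the vertices lies in more than \<open>8 * a\<close> of them;
  the weights of the large members sum to at most \<open>card U / 32\<close>, so they exceed 1/4 at
  no more than an eighth of the vertices.\<close>

lemma many_good_vertices: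
  assumes U: "finite U" and \<A>: "finite \<A>" "\<A> \<subseteq> Pow U" "card \<A> \<le> card U"
    and p: "0 \<le> p" and a: "1 \<le> a" "\<And>b. a < b \<Longrightarrow> real b * p ^ (b - 1) \<le> 1/32"
  shows "3/4 * real (card U) \<le> real (card {v\<in>U. card {A\<in>\<A>. v \<in> A \<and> card A \<le> a} \<le> 8 * a \<and>
     (\<Sum>A\<in>{A\<in>\<A>. v \<in> A \<and> a < card A}. p ^ (card A - 1)) \<le> 1/4})"
proof -
  define c1 where "c1 v = real (card {A\<in>\<A>. v \<in> A \<and> card A \<le> a})" for v
  define c2 where "c2 v = (\<Sum>A\<in>{A\<in>\<A>. v \<in> A \<and> a < card A}. p ^ (card A - 1))" for v
  define B1 where "B1 = {v\<in>U. 8 * real a < c1 v}"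
  define B2 where "B2 = {v\<in>U. 1/4 < c2 v}"
  define V0 where "V0 = {v\<in>U. card {A\<in>\<A>. v \<in> A \<and> card A \<le> a} \<le> 8 * a \<and> c2 v \<le> 1/4}"
  have u: "real (card \<A>) \<le> real (card U)" using \<A> by simp
  have "8 * real a * real (card B1) \<le> (\<Sum>v\<in>U. c1 v)"
    unfolding B1_def using U by (intro card_exceed_le) (auto simp: c1_def)
  also have "\<dots> = (\<Sum>v\<in>U. \<Sum>A\<in>{A\<in>\<A>. v \<in> A \<and> card A \<le> a}. 1)" by (simp add: c1_def)
  also have "\<dots> = (\<Sum>A\<in>{A\<in>\<A>. card A \<le> a}. real (card A) * 1)" by (rule sum_incidence[OF U \<A>(1,2)])
  also have "\<dots> \<le> (\<Sum>A\<in>{A\<in>\<A>. card A \<le> a}. real a)" by (intro sum_mono) auto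
  also have "\<dots> \<le> (\<Sum>A\<in>\<A>. real a)" using \<A> by (intro sum_mono2) auto
  also have "\<dots> \<le> real a * real (card U)" using u by (simp add: mult.commute mult_left_mono)
  finally have "real a * (8 * real (card B1)) \<le> real a * real (card U)" by simp
  hence b1: "8 * real (card B1) \<le> real (card U)" using a by simp
  have "1/4 * real (card B2) \<le> (\<Sum>v\<in>U. c2 v)"
    unfolding B2_def using U p by (intro card_exceed_le) (auto simp: c2_def intro!: sum_nonneg)
  also have "\<dots> = (\<Sum>A\<in>{A\<in>\<A>. a < card A}. real (card A) * p ^ (card A - 1))"
    unfolding c2_def by (rule sum_incidence[OF U \<A>(1,2)])
  also have "\<dots> \<le> (\<Sum>A\<in>{A\<in>\<A>. a < card A}. 1/32)" using a by (intro sum_mono) auto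
  also have "\<dots> \<le> (\<Sum>A\<in>\<A>. 1/32)" using \<A> by (intro sum_mono2) auto
  also have "\<dots> \<le> 1/32 * real (card U)" using u by simp
  finally have b2: "8 * real (card B2) \<le> real (card U)" by simp
  have "U \<subseteq> V0 \<union> (B1 \<union> B2)" unfolding V0_def B1_def B2_def c1_def by (auto simp flip: of_nat_mult)
  hence "card U \<le> card (V0 \<union> (B1 \<union> B2))" using U by (intro card_mono) (auto simp: V0_def B1_def B2_def)
  also have "\<dots> \<le> card V0 + (card B1 + card B2)"
    by (rule order_trans[OF card_Un_le add_left_mono[OF card_Un_le]])
  finally have "real (card U) \<le> real (card V0) + real (card B1) + real (card B2)" by linarith
  thus ?thesis using b1 b2 unfolding V0_def c2_def by linarith
qed

lemma uncovered_count_eq_sum: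
  assumes "finite U"
  shows "real (uncovered_count U \<A> E) = (\<Sum>(v, w)\<in>U \<times> U. of_bool (uncovered \<A> E v w))"
proof -
  have "(\<Sum>(v, w)\<in>U \<times> U. of_bool (uncovered \<A> E v w) :: real) = (\<Sum>z\<in>{(v, w) \<in> U \<times> U. uncovered \<A> E v w}. 1)"
    using assms by (intro sum.mono_neutral_cong_right) auto
  thus ?thesis by (simp add: uncovered_count_def)
qed

text \<open>Three quarters of the vertices satisfy the hypotheses of \<open>pr_uncovered_ge\<close>
  with \<open>h = 8 * a\<close>, and their ordered pairs make up at least u^2 / 4.\<close>

lemma expected_uncovered_count_ge:
  assumes p: "0 < p" "p < 1" and U: "U \<subseteq> {..<n}" "4 \<le> card U"
    and \<A>: "\<A> \<subseteq> Pow U" "card \<A> \<le> card U" "\<And>A. A \<in> \<A> \<Longrightarrow> 2 \<le> card A"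
    and a: "1 \<le> a" "\<And>b. a < b \<Longrightarrow> real b * p ^ (b - 1) \<le> 1/32"
  shows "p * (1 - p) ^ (16 * a) / 2 * (real (card U))\<^sup>2 / 4 \<le> bexp (all_edges n) p (\<lambda>E. real (uncovered_count U \<A> E))"
proof -
  define \<delta> where "\<delta> = p * (1 - p) ^ (16 * a) / 2"
  define u where "u = real (card U)"
  have d0: "0 \<le> \<delta>" using p by (simp add: \<delta>_def)
  have finU: "finite U" using U finite_subset by auto
  have fin: "finite \<A>" using \<A> finU by (meson finite_Pow_iff finite_subset)
  define V0 where "V0 = {v\<in>U. card {A\<in>\<A>. v \<in> A \<and> card A \<le> a} \<le> 8 * a \<and>
     (\<Sum>A\<in>{A\<in>\<A>. v \<in> A \<and> a < card A}. p ^ (card A - 1)) \<le> 1/4}"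
  have V0: "V0 \<subseteq> U" "finite V0" using finU by (auto simp: V0_def)
  have cV: "3/4 * u \<le> real (card V0)"
    unfolding V0_def u_def using p by (intro many_good_vertices finU fin \<A> a) auto
  define x where "x = real (card V0)"
  have u4: "4 \<le> u" using U by (simp add: u_def)
  have "u\<^sup>2 / 4 \<le> (3/4 * u) * (3/4 * u - 1)"
  proof -
    have "(3/4 * u) * (3/4 * u - 1) - u\<^sup>2 / 4 = u * (5/16 * u - 3/4)" by (simp add: algebra_simps power2_eq_square)
    moreover have "0 \<le> u * (5/16 * u - 3/4)" using u4 by (intro mult_nonneg_nonneg) auto
    ultimately show ?thesis by linarith
  qed
  also have "\<dots> \<le> x * (x - 1)" using cV u4 by (intro mult_mono) (auto simp: x_def)
  finally have pairs: "u\<^sup>2 / 4 \<le> x * (x - 1)" .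
  have cP: "real (card {(v, w) \<in> V0 \<times> V0. v \<noteq> w}) = x * (x - 1)"
  proof -
    have "{(v, w) \<in> V0 \<times> V0. v \<noteq> w} = V0 \<times> V0 - (\<lambda>v. (v, v)) ` V0" by auto
    moreover have "card ((\<lambda>v. (v, v)) ` V0) = card V0" by (intro card_image) (auto simp: inj_on_def)
    moreover have "card (V0 \<times> V0 - (\<lambda>v. (v, v)) ` V0) = card (V0 \<times> V0) - card ((\<lambda>v. (v, v)) ` V0)"
      using V0 by (intro card_Diff_subset) auto
    ultimately have "card {(v, w) \<in> V0 \<times> V0. v \<noteq> w} = card V0 * card V0 - card V0"
      by (simp add: card_cartesian_product)
    moreover have "card V0 \<le> card V0 * card V0" by (cases "card V0") auto
    ultimately show ?thesis by (simp add: x_def of_nat_diff algebra_simps)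
  qed
  have one: "\<delta> \<le> pr n p (\<lambda>E. uncovered \<A> E v w)" if "(v, w) \<in> {(v, w) \<in> V0 \<times> V0. v \<noteq> w}" for v w
  proof -
    have vw: "v \<in> V0" "w \<in> V0" "v \<noteq> w" using that by auto
    have "p * (1 - p) ^ (2 * (8 * a)) / 2 \<le> pr n p (\<lambda>E. uncovered \<A> E v w)"
    proof (rule pr_uncovered_ge[where a = a])
      show "card {A\<in>\<A>. x \<in> A \<and> card A \<le> a} \<le> 8 * a" if "x \<in> {v, w}" for x
        using that vw by (auto simp: V0_def)
      show "(\<Sum>A\<in>{A\<in>\<A>. x \<in> A \<and> a < card A}. p ^ (card A - 1)) \<le> 1/4" if "x \<in> {v, w}" for x
        using that vw by (auto simp: V0_def)
      show "A \<subseteq> {..<n} \<and> 2 \<le> card A" if "A \<in> \<A>" for A using that \<A> U by auto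
    qed (use vw V0 U p fin in auto)
    thus ?thesis by (simp add: \<delta>_def)
  qed
  have "\<delta> * (u\<^sup>2 / 4) \<le> \<delta> * (x * (x - 1))" using pairs d0 by (intro mult_left_mono)
  also have "\<dots> = (\<Sum>(v, w)\<in>{(v, w) \<in> V0 \<times> V0. v \<noteq> w}. \<delta>)" by (simp add: cP[symmetric] case_prod_beta')
  also have "\<dots> \<le> (\<Sum>(v, w)\<in>{(v, w) \<in> V0 \<times> V0. v \<noteq> w}. pr n p (\<lambda>E. uncovered \<A> E v w))"
    using one by (intro sum_mono) auto
  also have "\<dots> \<le> (\<Sum>(v, w)\<in>U \<times> U. pr n p (\<lambda>E. uncovered \<A> E v w))"
    using finU V0 p by (intro sum_mono2) (auto intro!: pr_nonneg)
  also have "\<dots> = bexp (all_edges n) p (\<lambda>E. \<Sum>(v, w)\<in>U \<times> U. of_bool (uncovered \<A> E v w))"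
    unfolding case_prod_beta' bexp_sum ..
  also have "\<dots> = bexp (all_edges n) p (\<lambda>E. real (uncovered_count U \<A> E))" by (simp add: uncovered_count_eq_sum[OF finU])
  finally show ?thesis by (simp add: \<delta>_def u_def)
qed

lemma card_diff_outside:
  assumes "finite S" "finite T" "finite R" "S - R = T - R"
  shows "\<bar>real (card S) - real (card T)\<bar> \<le> real (card R)"
proof -
  have le: "card X \<le> card (X - R) + card R" if "finite X" for X
  proof -
    have "card X \<le> card ((X - R) \<union> R)" using that assms(3) by (intro card_mono) auto
    thus ?thesis using card_Un_le[of "X - R" R] by linarith
  qed
  have "card S \<le> card (S - R) + card R" "card T \<le> card (T - R) + card R"
    using assms(1,2) le by blast+
  moreover have "card (S - R) \<le> card S" "card (T - R) \<le> card T" using assms by (auto intro: card_mono)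
  ultimately show ?thesis using assms(4) by (simp add: abs_le_iff)
qed

text \<open>An edge ij matters for (v, w) only if it is vw itself or joins one of \<open>v\<close>,
  \<open>w\<close> to a member through the other. Then one of them is i or j, and the other shares a
  member with the opposite end: at most \<open>D * K\<close> vertices for each of four
  placements.\<close>

lemma uncovered_count_insert_diff:
  assumes U: "U \<subseteq> {..<n}" and \<A>: "\<A> \<subseteq> Pow U" "\<And>A. A \<in> \<A> \<Longrightarrow> card A \<le> K"
    and deg: "\<And>y. y \<in> U \<Longrightarrow> card {A\<in>\<A>. y \<in> A} \<le> D" and x: "x \<in> all_edges n"
  shows "\<bar>real (uncovered_count U \<A> (insert x E)) - real (uncovered_count U \<A> E)\<bar> \<le> (if x \<subseteq> U then 2 + 4 * real (D * K) else 0)"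
proof -
  have finU: "finite U" using U finite_subset by auto
  have fin: "finite \<A>" using \<A> finU by (meson finite_Pow_iff finite_subset)
  have finA: "finite A" if "A \<in> \<A>" for A using that \<A>(1) finU finite_subset by blast
  define R where "R = {(v, w) \<in> U \<times> U. {v, w} = x \<or> (\<exists>A\<in>\<A>. \<exists>y\<in>A. v \<in> A \<and> {w, y} = x) \<or> (\<exists>A\<in>\<A>. \<exists>z\<in>A. w \<in> A \<and> {v, z} = x)}"
  let ?S = "\<lambda>E. {(v, w) \<in> U \<times> U. uncovered \<A> E v w}"
  have finR: "finite R" unfolding R_def using finU by (rule_tac finite_subset[of _ "U \<times> U"]) auto
  have finS: "finite (?S E)" for E using finU by (rule_tac finite_subset[of _ "U \<times> U"]) auto
  have "?S (insert x E) - R = ?S E - R"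
  proof -
    have "uncovered \<A> (insert x E) v w = uncovered \<A> E v w" if "(v, w) \<in> U \<times> U" "(v, w) \<notin> R" for v w
    proof -
      have 1: "{v, w} \<noteq> x" and 2: "\<And>A y. A \<in> \<A> \<Longrightarrow> y \<in> A \<Longrightarrow> v \<in> A \<Longrightarrow> {w, y} \<noteq> x"
        and 3: "\<And>A z. A \<in> \<A> \<Longrightarrow> z \<in> A \<Longrightarrow> w \<in> A \<Longrightarrow> {v, z} \<noteq> x"
        using that unfolding R_def by auto
      have a: "{v, w} \<in> insert x E \<longleftrightarrow> {v, w} \<in> E" using 1 by auto
      have b: "(\<forall>y\<in>A. {w, y} \<in> insert x E) \<longleftrightarrow> (\<forall>y\<in>A. {w, y} \<in> E)" if "A \<in> \<A>" "v \<in> A" for A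
        using 2[OF that(1) _ that(2)] by blast
      have c: "(\<forall>z\<in>A. {v, z} \<in> insert x E) \<longleftrightarrow> (\<forall>z\<in>A. {v, z} \<in> E)" if "A \<in> \<A>" "w \<in> A" for A
        using 3[OF that(1) _ that(2)] by blast
      have "(\<forall>A\<in>\<A>. v \<in> A \<longrightarrow> \<not> (\<forall>y\<in>A. {w, y} \<in> insert x E)) \<longleftrightarrow> (\<forall>A\<in>\<A>. v \<in> A \<longrightarrow> \<not> (\<forall>y\<in>A. {w, y} \<in> E))"
        by (rule ball_cong[OF refl], simp only: b cong: imp_cong)
      moreover have "(\<forall>A\<in>\<A>. w \<in> A \<longrightarrow> \<not> (\<forall>z\<in>A. {v, z} \<in> insert x E)) \<longleftrightarrow> (\<forall>A\<in>\<A>. w \<in> A \<longrightarrow> \<not> (\<forall>z\<in>A. {v, z} \<in> E))"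
        by (rule ball_cong[OF refl], simp only: c cong: imp_cong)
      ultimately show ?thesis unfolding uncovered_def a by (simp only:)
    qed
    thus ?thesis by auto
  qed
  hence le: "\<bar>real (uncovered_count U \<A> (insert x E)) - real (uncovered_count U \<A> E)\<bar> \<le> real (card R)"
    unfolding uncovered_count_def by (intro card_diff_outside finS finR)
  show ?thesis
  proof (cases "x \<subseteq> U")
    case True
    obtain i j where ij: "x = {i, j}" "i \<noteq> j" using x by (auto simp: all_edges_def)
    define N where "N y = \<Union>{A\<in>\<A>. y \<in> A}" for y
    have cN: "card (N y) \<le> D * K" if "y \<in> U" for y
    proof -
      have "card (N y) \<le> (\<Sum>A\<in>{A\<in>\<A>. y \<in> A}. card A)" unfolding N_def
        by (rule card_Union_le_sum_card_weak) (use finA in auto)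
      also have "\<dots> \<le> (\<Sum>A\<in>{A\<in>\<A>. y \<in> A}. K)" using \<A> by (intro sum_mono) auto
      also have "\<dots> \<le> D * K" using deg[OF that] by simp
      finally show ?thesis .
    qed
    have finN: "finite (N y)" for y unfolding N_def using fin finA by auto
    have iU: "i \<in> U" "j \<in> U" using True ij by auto
    have "R \<subseteq> {(i, j), (j, i)} \<union> (N j \<times> {i} \<union> (N i \<times> {j} \<union> ({i} \<times> N j \<union> {j} \<times> N i)))"
      unfolding R_def N_def ij(1) by (auto simp: doubleton_eq_iff)
    hence "card R \<le> card ({(i, j), (j, i)} \<union> (N j \<times> {i} \<union> (N i \<times> {j} \<union> ({i} \<times> N j \<union> {j} \<times> N i))))"
      using finN by (intro card_mono) auto
    also have "\<dots> \<le> card {(i, j), (j, i)} + (card (N j \<times> {i}) + (card (N i \<times> {j}) + (card ({i} \<times> N j) + card ({j} \<times> N i))))"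
      by (intro order_trans[OF card_Un_le] add_left_mono order_refl)
    also have "\<dots> \<le> 2 + (D * K + (D * K + (D * K + D * K)))"
    proof (intro add_mono)
      show "card {(i, j), (j, i)} \<le> 2" using ij(2) by simp
    qed (use cN iU in \<open>simp_all add: card_cartesian_product\<close>)
    finally have "real (card R) \<le> real (2 + (D * K + (D * K + (D * K + D * K))))" by (rule of_nat_mono)
    thus ?thesis using le True by simp
  next
    case False
    have "R = {}"
    proof (rule ccontr)
      assume "R \<noteq> {}"
      then obtain v w where "(v, w) \<in> R" by auto
      hence "x \<subseteq> U" using \<A> unfolding R_def by auto
      thus False using False by simp
    qed
    thus ?thesis using le False by simp
  qed
qed

lemma pr_uncovered_count_small:
  assumes p: "0 < p" "p < 1" and U: "U \<subseteq> {..<n}" "card U = u" "4 \<le> u"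
    and \<A>: "\<A> \<subseteq> Pow U" "card \<A> \<le> u" "\<And>A. A \<in> \<A> \<Longrightarrow> 2 \<le> card A \<and> card A \<le> K"
    and deg: "\<And>y. y \<in> U \<Longrightarrow> card {A\<in>\<A>. y \<in> A} \<le> D"
    and a: "1 \<le> a" "\<And>b. a < b \<Longrightarrow> real b * p ^ (b - 1) \<le> 1/32"
    and \<delta>: "\<delta> = p * (1 - p) ^ (16 * a) / 2"
  shows "pr n p (\<lambda>E. real (uncovered_count U \<A> E) \<le> \<delta> * (real u)\<^sup>2 / 8) \<le> exp (- (\<delta>\<^sup>2 / (32 * (2 + 4 * real (D * K))\<^sup>2)) * (real u)\<^sup>2)"
proof -
  define c0 where "c0 = 2 + 4 * real (D * K)"
  have c0: "0 < c0" by (simp add: c0_def add_pos_nonneg)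
  define C where "C = (real u)\<^sup>2 * c0\<^sup>2"
  have C: "0 < C" using c0 U by (simp add: C_def)
  have d0: "0 \<le> \<delta>" unfolding \<delta> using p by simp
  have "pr n p (\<lambda>E. real (uncovered_count U \<A> E) \<le> \<delta> * (real u)\<^sup>2 / 8) \<le> exp (- 2 * (\<delta> * (real u)\<^sup>2 / 8)\<^sup>2 / C)"
  proof (rule bexp_lower_tail[where c = "\<lambda>x. if x \<subseteq> U then c0 else 0"])
    show "\<bar>real (uncovered_count U \<A> (insert x E)) - real (uncovered_count U \<A> E)\<bar> \<le> (if x \<subseteq> U then c0 else 0)" if "x \<in> all_edges n" for x E
      unfolding c0_def using that U \<A> deg by (intro uncovered_count_insert_diff[of U n \<A>]) auto
    have "(\<Sum>x\<in>all_edges n. (if x \<subseteq> U then c0 else 0)\<^sup>2) = (\<Sum>x\<in>{e\<in>all_edges n. e \<subseteq> U}. c0\<^sup>2)"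
      by (intro sum.mono_neutral_cong_right) auto
    also have "\<dots> = real (u choose 2) * c0\<^sup>2" using card_pairs_in[OF U(1)] U by simp
    also have "\<dots> \<le> (real u)\<^sup>2 * c0\<^sup>2" by (intro mult_right_mono choose_le_power) auto
    finally show "(\<Sum>x\<in>all_edges n. (if x \<subseteq> U then c0 else 0)\<^sup>2) \<le> C" by (simp add: C_def)
    have "\<delta> * (real u)\<^sup>2 / 4 \<le> bexp (all_edges n) p (\<lambda>E. real (uncovered_count U \<A> E))"
      unfolding \<delta> using expected_uncovered_count_ge[of p U n \<A> a] p U \<A> a by auto
    thus "\<delta> * (real u)\<^sup>2 / 8 + \<delta> * (real u)\<^sup>2 / 8 \<le> bexp (all_edges n) p (\<lambda>E. real (uncovered_count U \<A> E))" by simp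
  qed (use p C d0 in auto)
  also have "- 2 * (\<delta> * (real u)\<^sup>2 / 8)\<^sup>2 / C = - (\<delta>\<^sup>2 / (32 * c0\<^sup>2)) * (real u)\<^sup>2"
    using U c0 by (simp add: C_def field_simps power2_eq_square)
  finally show ?thesis by (simp add: c0_def)
qed

section \<open>Union bounds over small sides and over large bicliques\<close>

lemma card_bounded_families:
  assumes "finite X" "real (card X) \<le> m" "1 \<le> m"
  shows "real (card {\<A>. \<A> \<subseteq> X \<and> card \<A> \<le> u}) \<le> (real u + 1) * m ^ u"
proof -
  have fin: "finite {\<A>. \<A> \<subseteq> X \<and> card \<A> = k}" for k using assms by (rule_tac finite_subset[of _ "Pow X"]) auto
  have "{\<A>. \<A> \<subseteq> X \<and> card \<A> \<le> u} = (\<Union>k\<in>{..u}. {\<A>. \<A> \<subseteq> X \<and> card \<A> = k})" by auto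
  hence "card {\<A>. \<A> \<subseteq> X \<and> card \<A> \<le> u} \<le> (\<Sum>k\<in>{..u}. card {\<A>. \<A> \<subseteq> X \<and> card \<A> = k})"
    using fin by (simp add: card_UN_le)
  hence "real (card {\<A>. \<A> \<subseteq> X \<and> card \<A> \<le> u}) \<le> (\<Sum>k\<in>{..u}. real (card X choose k))"
    using n_subsets[OF assms(1)] by (metis (mono_tags, lifting) of_nat_le_iff of_nat_sum sum.cong)
  also have "\<dots> \<le> (\<Sum>k\<in>{..u}. m ^ u)"
  proof (intro sum_mono)
    fix k assume k: "k \<in> {..u}"
    have "real (card X choose k) \<le> real (card X) ^ k" by (rule choose_le_power)
    also have "\<dots> \<le> m ^ k" using assms by (intro power_mono) auto
    also have "\<dots> \<le> m ^ u" using assms k by (intro power_increasing) auto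
    finally show "real (card X choose k) \<le> m ^ u" .
  qed
  finally show ?thesis by (simp add: add.commute)
qed

text \<open>For fixed \<open>K\<close> and \<open>D\<close> there are only exp(O(u ln u)) families,
  and the tail exp(-c u^2) outweighs them once u is large. Sides larger than \<open>K\<close> would
  be too numerous and are treated separately.\<close>

lemma pr_small_family_le:
  assumes p: "0 < p" "p < 1" and U: "U \<subseteq> {..<n}" "card U = u" "4 \<le> u"
    and a: "1 \<le> a" "\<And>b. a < b \<Longrightarrow> real b * p ^ (b - 1) \<le> 1/32"
    and \<delta>: "\<delta> = p * (1 - p) ^ (16 * a) / 2"
  shows "pr n p (\<lambda>E. \<exists>\<A>. \<A> \<subseteq> {A. A \<subseteq> U \<and> 2 \<le> card A \<and> card A \<le> K} \<and> card \<A> \<le> u \<and>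
       (\<forall>y\<in>U. card {A\<in>\<A>. y \<in> A} \<le> D) \<and> real (uncovered_count U \<A> E) \<le> \<delta> * (real u)\<^sup>2 / 8)
    \<le> (real u + 1) * ((real K + 1) * real u ^ K) ^ u * exp (- (\<delta>\<^sup>2 / (32 * (2 + 4 * real (D * K))\<^sup>2)) * (real u)\<^sup>2)"
proof -
  define X where "X = {A. A \<subseteq> U \<and> 2 \<le> card A \<and> card A \<le> K}"
  define ex where "ex = exp (- (\<delta>\<^sup>2 / (32 * (2 + 4 * real (D * K))\<^sup>2)) * (real u)\<^sup>2)"
  let ?I = "{\<A>. \<A> \<subseteq> X \<and> card \<A> \<le> u}"
  have finU: "finite U" using U finite_subset by auto
  have finX: "finite X" unfolding X_def using finU by (rule_tac finite_subset[of _ "Pow U"]) auto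
  have cX: "real (card X) \<le> (real K + 1) * real u ^ K"
  proof -
    have "card X \<le> card (\<Union>j\<in>{..K}. {A. A \<subseteq> U \<and> card A = j})"
    proof (intro card_mono)
      show "finite (\<Union>j\<in>{..K}. {A. A \<subseteq> U \<and> card A = j})" using finU by auto
    qed (auto simp: X_def)
    also have "\<dots> \<le> (\<Sum>j\<in>{..K}. card {A. A \<subseteq> U \<and> card A = j})" by (intro card_UN_le) auto
    also have "\<dots> = (\<Sum>j\<in>{..K}. u choose j)" using n_subsets[OF finU] U by simp
    finally have "real (card X) \<le> (\<Sum>j\<in>{..K}. real (u choose j))" by (metis of_nat_le_iff of_nat_sum)
    also have "\<dots> \<le> (\<Sum>j\<in>{..K}. real u ^ K)"
    proof (intro sum_mono)
      fix j assume "j \<in> {..K}"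
      hence "real u ^ j \<le> real u ^ K" using U by (intro power_increasing) auto
      thus "real (u choose j) \<le> real u ^ K" using choose_le_power[of u j] by linarith
    qed
    finally show ?thesis by (simp add: add.commute)
  qed
  have "1 \<le> (real K + 1) * real u ^ K"
    using U mult_mono[of 1 "real K + 1" 1 "real u ^ K"] by (simp add: one_le_power)
  hence cI: "real (card ?I) \<le> (real u + 1) * ((real K + 1) * real u ^ K) ^ u"
    by (intro card_bounded_families finX cX)
  have finI: "finite ?I" using finX by (rule_tac finite_subset[of _ "Pow X"]) auto
  let ?P = "\<lambda>\<A> E. (\<forall>y\<in>U. card {A\<in>\<A>. y \<in> A} \<le> D) \<and> real (uncovered_count U \<A> E) \<le> \<delta> * (real u)\<^sup>2 / 8"
  have "pr n p (\<lambda>E. \<exists>\<A>. \<A> \<subseteq> X \<and> card \<A> \<le> u \<and> ?P \<A> E) \<le> pr n p (\<lambda>E. \<exists>\<A>\<in>?I. ?P \<A> E)"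
    using p by (intro pr_mono) auto
  also have "\<dots> \<le> (\<Sum>\<A>\<in>?I. pr n p (?P \<A>))" using p finI by (intro pr_UN_le) auto
  also have "\<dots> \<le> (\<Sum>\<A>\<in>?I. ex)"
  proof (intro sum_mono)
    fix \<A> assume \<A>: "\<A> \<in> ?I"
    show "pr n p (?P \<A>) \<le> ex"
    proof (cases "\<forall>y\<in>U. card {A\<in>\<A>. y \<in> A} \<le> D")
      case True
      have "pr n p (?P \<A>) \<le> pr n p (\<lambda>E. real (uncovered_count U \<A> E) \<le> \<delta> * (real u)\<^sup>2 / 8)"
        using p by (intro pr_mono) auto
      also have "\<dots> \<le> ex" unfolding ex_def using \<A> True
        by (intro pr_uncovered_count_small[OF p U _ _ _ _ a \<delta>]) (auto simp: X_def)
      finally show ?thesis .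
    next
      case False
      hence "pr n p (?P \<A>) = bexp (all_edges n) p (\<lambda>_. 0)" by (intro bexp_cong) auto
      thus ?thesis by (simp add: ex_def)
    qed
  qed
  also have "\<dots> = real (card ?I) * ex" by simp
  also have "\<dots> \<le> (real u + 1) * ((real K + 1) * real u ^ K) ^ u * ex"
    using cI by (intro mult_right_mono) (auto simp: ex_def)
  finally show ?thesis unfolding X_def ex_def .
qed

text \<open>Write p^|F| as the square of (sqrt p)^|F|. One copy is at most exp(-wd), since |F| >= d;
  the other is the product of weights that lets the sum over lists factor.\<close>

lemma pr_big_bicliques_le:
  assumes p: "0 < p" "p < 1" and U: "U \<subseteq> {..<n}" "card U = u"
    and w: "w = ln (1 / sqrt p)" and d: "0 \<le> d"
  shows "pr n p (\<lambda>E. \<exists>L F. length L \<le> u \<and> set L \<subseteq> biq U s \<and> is_biclique_partition n F L \<and> F \<subseteq> E \<and> d \<le> real (card F))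
    \<le> (real u + 1) * (1 + biq_weight U s (sqrt p)) ^ u * exp (- (w * d))"
proof -
  define W where "W = biq_weight U s (sqrt p)"
  have W0: "0 \<le> W" unfolding W_def using p by (intro biq_weight_nonneg) auto
  have finU: "finite U" using U finite_subset by auto
  have sp: "0 < sqrt p" "sqrt p < 1" "sqrt p = exp (- w)" using p by (auto simp: w ln_div)
  let ?T = "\<lambda>k. {L. set L \<subseteq> biq U s \<and> length L = k}"
  have finT: "finite (?T k)" for k using finite_biq[OF finU] by (intro finite_lists_length_eq)
  let ?P = "\<lambda>L E. \<exists>F. is_biclique_partition n F L \<and> F \<subseteq> E \<and> d \<le> real (card F)"
  have one: "pr n p (?P L) \<le> exp (- (w * d)) * prod_list (map (\<lambda>(A, B). sqrt p ^ (card A * card B)) L)" if L: "set L \<subseteq> biq U s" for L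
  proof (cases "\<exists>E0\<subseteq>all_edges n. ?P L E0")
    case True
    then obtain E0 F where F: "E0 \<subseteq> all_edges n" "is_biclique_partition n F L" "F \<subseteq> E0" "d \<le> real (card F)" by blast
    have Fs: "F \<subseteq> all_edges n" using F by auto
    have finF: "finite F" using Fs finite_edge_set by auto
    have cF: "card F = sum_list (map (\<lambda>(A, B). card A * card B) L)" by (rule bpart_card[OF F(2) L finU finF])
    have "pr n p (?P L) \<le> pr n p (\<lambda>E. F \<subseteq> E \<and> {} \<inter> E = {})"
    proof (rule pr_mono)
      fix E assume "?P L E"
      then obtain F' where "is_biclique_partition n F' L" "F' \<subseteq> E" by blast
      moreover have "F' = F" using bpart_Union[OF F(2)] bpart_Union[OF calculation(1)] by simp
      ultimately show "F \<subseteq> E \<and> {} \<inter> E = {}" by simp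
    qed (use p in auto)
    also have "\<dots> = p ^ card F * (1 - p) ^ card ({}::nat set set)" using Fs by (intro bexp_pattern) auto
    also have "\<dots> = sqrt p ^ card F * sqrt p ^ card F" using p by (simp add: power_mult_distrib[symmetric])
    also have "\<dots> \<le> exp (- (w * d)) * sqrt p ^ card F"
    proof (intro mult_right_mono)
      have w0: "0 < w" using p by (simp add: w)
      have "sqrt p ^ card F = exp (- (w * real (card F)))" unfolding sp(3) by (simp add: exp_of_nat_mult[symmetric] mult.commute)
      also have "\<dots> \<le> exp (- (w * d))" using F w0 by simp
      finally show "sqrt p ^ card F \<le> exp (- (w * d))" .
    qed (use p in auto)
    also have "sqrt p ^ card F = prod_list (map (\<lambda>x. sqrt p ^ (case x of (A, B) \<Rightarrow> card A * card B)) L)"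
      unfolding cF prod_list_power_map ..
    finally show ?thesis by (simp add: case_prod_beta')
  next
    case False
    hence "pr n p (?P L) = bexp (all_edges n) p (\<lambda>_. 0)" by (intro bexp_cong) auto
    moreover have "0 \<le> prod_list (map (\<lambda>(A, B). sqrt p ^ (card A * card B)) L)"
      using p by (intro prod_list_nonneg) auto
    ultimately show ?thesis by simp
  qed
  have "pr n p (\<lambda>E. \<exists>L F. length L \<le> u \<and> set L \<subseteq> biq U s \<and> is_biclique_partition n F L \<and> F \<subseteq> E \<and> d \<le> real (card F)) \<le>
     pr n p (\<lambda>E. \<exists>k\<in>{..u}. \<exists>L\<in>?T k. ?P L E)" using p by (intro pr_mono) auto
  also have "\<dots> \<le> (\<Sum>k\<in>{..u}. pr n p (\<lambda>E. \<exists>L\<in>?T k. ?P L E))" using p by (intro pr_UN_le) auto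
  also have "\<dots> \<le> (\<Sum>k\<in>{..u}. exp (- (w * d)) * (1 + W) ^ u)"
  proof (intro sum_mono)
    fix k assume k: "k \<in> {..u}"
    have "pr n p (\<lambda>E. \<exists>L\<in>?T k. ?P L E) \<le> (\<Sum>L\<in>?T k. pr n p (?P L))" using p finT by (intro pr_UN_le) auto
    also have "\<dots> \<le> (\<Sum>L\<in>?T k. exp (- (w * d)) * prod_list (map (\<lambda>(A, B). sqrt p ^ (card A * card B)) L))"
      using one by (intro sum_mono) auto
    also have "\<dots> = exp (- (w * d)) * W ^ k"
      unfolding W_def biq_weight_def by (simp add: sum_distrib_left[symmetric] sum_prod_list_lists[OF finite_biq[OF finU]])
    also have "\<dots> \<le> exp (- (w * d)) * (1 + W) ^ u"
    proof (intro mult_left_mono)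
      have "W ^ k \<le> (1 + W) ^ k" using W0 by (intro power_mono) auto
      also have "\<dots> \<le> (1 + W) ^ u" using W0 k by (intro power_increasing) auto
      finally show "W ^ k \<le> (1 + W) ^ u" .
    qed simp
    finally show "pr n p (\<lambda>E. \<exists>L\<in>?T k. ?P L E) \<le> exp (- (w * d)) * (1 + W) ^ u" .
  qed
  also have "\<dots> = (real u + 1) * (1 + W) ^ u * exp (- (w * d))" by (simp add: add.commute)
  finally show ?thesis by (simp add: W_def)
qed

lemma bpart_unique:
  assumes "is_biclique_partition n F L" "x \<in> set L" "z \<in> set L" "biclique_edges x \<inter> biclique_edges z \<noteq> {}"
  shows "x = z"
proof -
  obtain i j where "x = L ! i" "i < length L" "z = L ! j" "j < length L" using assms by (auto simp: in_set_conv_nth)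
  thus ?thesis using assms(1,4) unfolding is_biclique_partition_def by blast
qed

lemma bpart_filter:
  assumes "is_biclique_partition n F L"
  shows "is_biclique_partition n (\<Union>x\<in>set (filter P L). biclique_edges x) (filter P L)"
  using assms
proof (induction L arbitrary: F)
  case (Cons x L)
  have x: "is_biclique n F x" "is_biclique_partition n (F - biclique_edges x) L"
    using Cons.prems by (auto simp: bpart_Cons)
  define G where "G = (\<Union>x\<in>set (filter P L). biclique_edges x)"
  have G: "is_biclique_partition n G (filter P L)" unfolding G_def by (rule Cons.IH[OF x(2)])
  have "G \<subseteq> F - biclique_edges x" using bpart_Union[OF x(2)] by (auto simp: G_def)
  hence "(biclique_edges x \<union> G) - biclique_edges x = G" by auto
  thus ?case using G x by (auto simp: bpart_Cons is_biclique_def G_def)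
qed (simp add: bpart_Nil)

text \<open>Vertices lying in many small sides contribute few edges: the large sides of the
  bicliques through a fixed vertex are disjoint.\<close>

lemma big_or_small:
  fixes K D u :: nat
  assumes U: "U \<subseteq> {..<n}" "card U = u" and E: "E \<subseteq> all_edges n"
    and L: "is_biclique_partition n {e \<in> E. e \<subseteq> U} L" "set L \<subseteq> biq U 2" "length L \<le> u" and D: "1 \<le> D"
  shows "(\<exists>L' F. length L' \<le> u \<and> set L' \<subseteq> biq U (Suc K) \<and> is_biclique_partition n F L' \<and> F \<subseteq> E \<and> d \<le> real (card F)) \<or>
    (\<exists>\<A>. \<A> \<subseteq> {A. A \<subseteq> U \<and> 2 \<le> card A \<and> card A \<le> K} \<and> card \<A> \<le> u \<and> (\<forall>y\<in>U. card {A\<in>\<A>. y \<in> A} \<le> D) \<and>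
       real (uncovered_count U \<A> E) \<le> 2 * (d + (real K)\<^sup>2 * (real u)\<^sup>2 / real D))"
proof -
  define Lb where "Lb = filter (\<lambda>x. K < card (fst x)) L"
  define F where "F = (\<Union>x\<in>set Lb. biclique_edges x)"
  have EU: "(\<Union>x\<in>set L. biclique_edges x) = {e \<in> E. e \<subseteq> U}" by (rule bpart_Union[OF L(1)])
  have finU: "finite U" using U finite_subset by auto
  have Fsub: "F \<subseteq> {e \<in> E. e \<subseteq> U}" unfolding F_def EU[symmetric] Lb_def by auto
  have finE: "finite {e \<in> E. e \<subseteq> U}" using finite_edge_set[OF E] by auto
  show ?thesis
  proof (cases "d \<le> real (card F)")
    case True
    have "is_biclique_partition n F Lb" unfolding F_def Lb_def by (rule bpart_filter[OF L(1)])
    moreover have "length Lb \<le> u" unfolding Lb_def using L(3) length_filter_le order_trans by blast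
    moreover have "set Lb \<subseteq> biq U (Suc K)" using L(2) unfolding Lb_def biq_def by auto
    ultimately show ?thesis using True Fsub by blast
  next
    case False
    define X where "X = {x \<in> set L. card (fst x) \<le> K}"
    \<comment> \<open>By double counting there are at most \<open>K * u / D\<close> such vertices.
      Bicliques whose small side meets them go into \<open>G\<close>, so the small sides of the
      others have degree at most \<open>D\<close>.\<close>
    define High where "High = {y\<in>U. real D < real (card {x\<in>X. y \<in> fst x})}"
    define X' where "X' = {x\<in>X. fst x \<inter> High = {}}"
    define \<A> where "\<A> = fst ` X'"
    define Gy where "Gy y = (\<Union>x\<in>{x\<in>X. y \<in> fst x}. biclique_edges x)" for y
    define G where "G = (\<Union>y\<in>High. Gy y)"
    have finX: "finite X" "finite X'" "X' \<subseteq> X" "X \<subseteq> set L" by (auto simp: X_def X'_def)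
    have cX: "card X \<le> u" using card_mono[OF _ finX(4)] card_length[of L] L(3) by simp
    have xs: "fst x \<subseteq> U" "snd x \<subseteq> U" "2 \<le> card (fst x)" if "x \<in> set L" for x
    proof -
      have "x \<in> biq U 2" using that L(2) by blast
      thus "fst x \<subseteq> U" "snd x \<subseteq> U" "2 \<le> card (fst x)" by (auto simp: biq_def case_prod_beta)
    qed
    have finfst: "finite (fst x)" if "x \<in> set L" for x using xs(1)[OF that] finU by (rule finite_subset)
    have A1: "\<A> \<subseteq> {A. A \<subseteq> U \<and> 2 \<le> card A \<and> card A \<le> K}"
      using finX xs unfolding \<A>_def X_def by auto
    have A2: "card \<A> \<le> u"
    proof -
      have "card \<A> \<le> card X'" unfolding \<A>_def by (intro card_image_le finX)
      also have "\<dots> \<le> card X" by (intro card_mono finX)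
      finally show ?thesis using cX by simp
    qed
    have A3: "card {A\<in>\<A>. y \<in> A} \<le> D" if "y \<in> U" for y
    proof (cases "y \<in> High")
      case True
      hence "{A\<in>\<A>. y \<in> A} = {}" by (auto simp: \<A>_def X'_def)
      thus ?thesis by (simp only: card.empty)
    next
      case False
      have "card {A\<in>\<A>. y \<in> A} \<le> card (fst ` {x\<in>X. y \<in> fst x})"
        using finX by (intro card_mono) (auto simp: \<A>_def)
      also have "\<dots> \<le> card {x\<in>X. y \<in> fst x}" using finX by (intro card_image_le) auto
      also have "\<dots> \<le> D" using False that by (auto simp: High_def)
      finally show ?thesis .
    qed
    have cHigh: "real D * real (card High) \<le> real K * real u"
    proof -
      have "real D * real (card High) \<le> (\<Sum>y\<in>U. real (card {x\<in>X. y \<in> fst x}))"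
        unfolding High_def using finU by (intro card_exceed_le) auto
      also have "\<dots> = (\<Sum>y\<in>U. \<Sum>x\<in>X. of_bool (y \<in> fst x))"
      proof (intro sum.cong refl)
        fix y
        have "(\<Sum>x\<in>X. of_bool (y \<in> fst x) :: real) = (\<Sum>x\<in>{x\<in>X. y \<in> fst x}. 1)"
          using finX by (intro sum.mono_neutral_cong_right) auto
        thus "real (card {x\<in>X. y \<in> fst x}) = (\<Sum>x\<in>X. of_bool (y \<in> fst x))" by simp
      qed
      also have "\<dots> = (\<Sum>x\<in>X. \<Sum>y\<in>U. of_bool (y \<in> fst x))" by (rule sum.swap)
      also have "\<dots> \<le> (\<Sum>x\<in>X. real K)"
      proof (intro sum_mono)
        fix x assume x: "x \<in> X"
        hence "fst x \<subseteq> U" using xs finX by blast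
        hence "(\<Sum>y\<in>U. of_bool (y \<in> fst x) :: real) = (\<Sum>y\<in>fst x. 1)"
          using finU by (intro sum.mono_neutral_cong_right) auto
        thus "(\<Sum>y\<in>U. of_bool (y \<in> fst x)) \<le> real K" using x by (simp add: X_def)
      qed
      also have "\<dots> = real K * real (card X)" by simp
      also have "\<dots> \<le> real K * real u" using cX by (intro mult_left_mono) auto
      finally show ?thesis .
    qed
    have cGy: "card (Gy y) \<le> u * K" for y
    proof -
      \<comment> \<open>The edges at \<open>b\<close> of bicliques through \<open>y\<close>. The
        edge \<open>yb\<close> determines the biclique, so all of them come from a single small
        side.\<close>
      define Nb where "Nb b = (\<Union>x\<in>{x\<in>X. y \<in> fst x \<and> b \<in> snd x}. (\<lambda>a. {a, b}) ` fst x)" for b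
      have nb: "card (Nb b) \<le> K" for b
      proof (cases "{x\<in>X. y \<in> fst x \<and> b \<in> snd x} = {}")
        case True
        thus ?thesis unfolding Nb_def by (simp only: UN_empty card.empty)
      next
        case False
        then obtain x where x: "x \<in> X" "y \<in> fst x" "b \<in> snd x" by auto
        have uniq: "z = x" if z: "z \<in> X" "y \<in> fst z" "b \<in> snd z" for z
        proof (rule bpart_unique[OF L(1)])
          have "{y, b} \<in> biclique_edges z" "{y, b} \<in> biclique_edges x"
            using x z unfolding biclique_edges_def by blast+
          thus "biclique_edges z \<inter> biclique_edges x \<noteq> {}" by blast
        qed (use x z finX in auto)
        have "{x\<in>X. y \<in> fst x \<and> b \<in> snd x} = {x}"
        proof (intro equalityI subsetI)
          fix z assume "z \<in> {x\<in>X. y \<in> fst x \<and> b \<in> snd x}"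
          thus "z \<in> {x}" using uniq[of z] by blast
        next
          fix z assume "z \<in> {x}"
          thus "z \<in> {x\<in>X. y \<in> fst x \<and> b \<in> snd x}" using x by blast
        qed
        hence "Nb b = (\<lambda>a. {a, b}) ` fst x" unfolding Nb_def by simp
        moreover have "finite (fst x)" using x(1) finX(4) finfst by blast
        ultimately have "card (Nb b) \<le> card (fst x)" by (simp add: card_image_le)
        thus ?thesis using x by (simp add: X_def)
      qed
      have finNb: "finite (Nb b)" for b
        unfolding Nb_def using finX(1,4) finfst by (intro finite_UN_I finite_imageI) (simp, blast)
      have "Gy y \<subseteq> (\<Union>b\<in>U. Nb b)"
      proof
        fix e assume "e \<in> Gy y"
        then obtain x where x: "x \<in> X" "y \<in> fst x" "e \<in> biclique_edges x" by (auto simp: Gy_def)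
        then obtain a b where ab: "e = {a, b}" "a \<in> fst x" "b \<in> snd x" by (auto simp: biclique_edges_def)
        have "b \<in> U" using x ab xs finX by blast
        moreover have "e \<in> Nb b" unfolding Nb_def using x ab by blast
        ultimately show "e \<in> (\<Union>b\<in>U. Nb b)" by blast
      qed
      hence "card (Gy y) \<le> card (\<Union>b\<in>U. Nb b)" using finU finNb by (intro card_mono) auto
      also have "\<dots> \<le> (\<Sum>b\<in>U. card (Nb b))" using finU by (intro card_UN_le)
      also have "\<dots> \<le> (\<Sum>b\<in>U. K)" using nb by (intro sum_mono)
      finally show ?thesis using U by simp
    qed
    have finHigh: "finite High" using finU by (auto simp: High_def)
    have Gsub: "G \<subseteq> {e \<in> E. e \<subseteq> U}" unfolding G_def Gy_def EU[symmetric] using finX by auto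
    have "card G \<le> (\<Sum>y\<in>High. card (Gy y))" unfolding G_def using finHigh by (intro card_UN_le)
    also have "\<dots> \<le> (\<Sum>y\<in>High. u * K)" using cGy by (intro sum_mono)
    finally have "card G \<le> card High * (u * K)" by simp
    hence "real (card G) \<le> real (card High) * (real u * real K)" by (metis of_nat_le_iff of_nat_mult)
    also have "\<dots> \<le> (real K * real u / real D) * (real u * real K)"
      using cHigh D by (intro mult_right_mono) (auto simp: field_simps)
    also have "\<dots> = (real K)\<^sup>2 * (real u)\<^sup>2 / real D" by (simp add: power2_eq_square)
    finally have cG: "real (card G) \<le> (real K)\<^sup>2 * (real u)\<^sup>2 / real D" .
    have finFG: "finite (F \<union> G)" using Fsub Gsub finE finite_subset by auto
    let ?S = "{(v, w) \<in> U \<times> U. uncovered \<A> E v w}"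
    \<comment> \<open>A biclique of \<open>X'\<close> has its small side in \<open>\<A>\<close> and
      covers no uncovered edge, so every uncovered edge inside \<open>U\<close> lies in
      \<open>F\<close> or \<open>G\<close>.\<close>
    have S: "?S \<subseteq> (\<Union>e\<in>F \<union> G. {(v, w). {v, w} = e})"
    proof clarify
      fix v w assume vw: "v \<in> U" "w \<in> U" "uncovered \<A> E v w"
      hence "{v, w} \<in> {e \<in> E. e \<subseteq> U}" by (auto simp: uncovered_def)
      then obtain x where x: "x \<in> set L" "{v, w} \<in> biclique_edges x" unfolding EU[symmetric] by auto
      have bE: "biclique_edges x \<subseteq> E" using x EU by auto
      have "x \<notin> X'"
      proof
        assume "x \<in> X'"
        hence A: "fst x \<in> \<A>" by (simp add: \<A>_def)
        obtain a b where ab: "{v, w} = {a, b}" "a \<in> fst x" "b \<in> snd x" using x by (auto simp: biclique_edges_def)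
        have all: "\<forall>y\<in>fst x. {b, y} \<in> E"
        proof
          fix y assume "y \<in> fst x"
          hence "{y, b} \<in> biclique_edges x" using ab unfolding biclique_edges_def by blast
          thus "{b, y} \<in> E" using bE by (auto simp: insert_commute)
        qed
        consider "v = a" "w = b" | "v = b" "w = a" using ab(1) by (auto simp: doubleton_eq_iff)
        thus False using vw(3) A all ab by cases (auto simp: uncovered_def)
      qed
      have "{v, w} \<in> F \<union> G"
      proof (cases "x \<in> X")
        case True
        then obtain y where "y \<in> fst x" "y \<in> High" using \<open>x \<notin> X'\<close> by (auto simp: X'_def)
        thus ?thesis using True x unfolding G_def Gy_def by blast
      next
        case False
        hence "x \<in> set Lb" using x(1) by (simp add: X_def Lb_def)
        thus ?thesis using x(2) unfolding F_def by blast
      qed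
      thus "(v, w) \<in> (\<Union>e\<in>F \<union> G. {(v, w). {v, w} = e})" by blast
    qed
    have two: "finite {(v, w). {v, w} = e} \<and> card {(v, w). {v, w} = e} \<le> 2" if "e \<in> F \<union> G" for e
    proof -
      have "e \<in> all_edges n" using that Fsub Gsub E by auto
      then obtain i j where ij: "e = {i, j}" and neq: "i \<noteq> j" by (auto simp: all_edges_def)
      have "{(v, w). {v, w} = e} \<subseteq> {(i, j), (j, i)}" unfolding ij by (auto simp: doubleton_eq_iff)
      moreover have "card {(i, j), (j, i)} \<le> 2" using neq by simp
      ultimately show ?thesis by (meson card_mono finite.emptyI finite.insertI finite_subset order_trans)
    qed
    have "uncovered_count U \<A> E \<le> card (\<Union>e\<in>F \<union> G. {(v, w). {v, w} = e})"
      unfolding uncovered_count_def using S finFG two by (intro card_mono) auto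
    also have "\<dots> \<le> (\<Sum>e\<in>F \<union> G. card {(v, w). {v, w} = e})" using finFG by (intro card_UN_le)
    also have "\<dots> \<le> (\<Sum>e\<in>F \<union> G. 2)" using two by (intro sum_mono) blast
    also have "\<dots> \<le> 2 * (card F + card G)" using card_Un_le[of F G] by simp
    finally have "real (uncovered_count U \<A> E) \<le> real (2 * (card F + card G))" by (rule of_nat_mono)
    hence "real (uncovered_count U \<A> E) \<le> 2 * (real (card F) + real (card G))" by simp
    also have "\<dots> \<le> 2 * (d + (real K)\<^sup>2 * (real u)\<^sup>2 / real D)" using False cG by simp
    finally show ?thesis using A1 A2 A3 by blast
  qed
qed

text \<open>Beyond terms of order u (ln u)^2, the exponent contains only (sqrt p)^s u^2; this is why
  \<open>s\<close> must be a large constant where the lemma is applied.\<close>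

lemma biq_weight_sqrt_le:
  assumes p: "0 < p" "p < 1" and U: "finite U" "card U = u" "1 \<le> u" and s: "1 \<le> s"
    and w: "w = ln (1 / sqrt p)"
  shows "(1 + biq_weight U s (sqrt p)) ^ u \<le>
    exp (real u * (1 + sqrt p ^ s * real u + ln (real u) + (ln (real u))\<^sup>2 / w))"
proof -
  define x where "x = sqrt p ^ s"
  define t where "t = exp (x * real u) * (real u * exp ((ln (real u))\<^sup>2 / w))"
  have w0: "0 < w" using p by (simp add: w)
  have "biq_weight U s (sqrt p) \<le> (1 + x) ^ u * (\<Sum>a=s..u. ((real u)\<^sup>2 * sqrt p ^ a) ^ a)"
    using biq_weight_le[of U "sqrt p" s] p U by (simp add: x_def)
  also have "\<dots> \<le> exp x ^ u * (real u * exp ((ln (real u))\<^sup>2 / w))"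
    unfolding w using p U s
    by (intro mult_mono power_mono sum_power_gaussian_le) (auto simp: x_def intro!: sum_nonneg add_nonneg_nonneg)
  also have "\<dots> = t" by (simp add: t_def exp_of_nat2_mult)
  finally have "biq_weight U s (sqrt p) \<le> t" .
  moreover have "1 \<le> t"
  proof -
    have "1 * (1 * 1) \<le> t" unfolding t_def using U w0 p by (intro mult_mono) (auto simp: x_def)
    thus ?thesis by simp
  qed
  ultimately have "1 + biq_weight U s (sqrt p) \<le> 2 * t" by simp
  also have "\<dots> \<le> exp 1 * t" using exp_ge_add_one_self[of 1] \<open>1 \<le> t\<close> by (intro mult_right_mono) auto
  also have "\<dots> = exp (1 + x * real u + ln (real u) + (ln (real u))\<^sup>2 / w)"
    unfolding t_def using U by (simp add: exp_add)
  finally have "(1 + biq_weight U s (sqrt p)) ^ u \<le> exp (1 + x * real u + ln (real u) + (ln (real u))\<^sup>2 / w) ^ u"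
    using biq_weight_nonneg[of "sqrt p" U s] p by (intro power_mono) auto
  thus ?thesis by (simp add: exp_of_nat_mult[symmetric] x_def)
qed

text \<open>Order of choice: \<open>a\<close> and \<open>\<delta>\<close> from \<open>p\<close>,
  then \<open>K\<close> so that large bicliques cannot cover much, then \<open>D\<close> so that
  vertices in many small sides cannot either, and finally \<open>C\<close> against the number of
  choices.\<close>

lemma no_large_core:
  assumes p: "0 < p" "p < 1"
  obtains C where "0 < C" "\<forall>\<^sub>F n in sequentially. pr n p (\<lambda>E. \<exists>U L. U \<subseteq> {..<n} \<and> C * ln (real n) \<le> real (card U) \<and>
     length L \<le> card U \<and> set L \<subseteq> biq U 2 \<and> is_biclique_partition n {e \<in> E. e \<subseteq> U} L) \<le> 2 / real n"
proof -
  have "(\<lambda>b. real b * p ^ (b - 1)) \<longlonglongrightarrow> 0" 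
  proof -
    have "(\<lambda>b. real b * p ^ b / p) \<longlonglongrightarrow> 0 / p"
      using p by (intro tendsto_divide tendsto_const) (auto intro: powser_times_n_limit_0)
    moreover have "real b * p ^ b / p = real b * p ^ (b - 1)" for b using p by (cases b) auto
    ultimately show ?thesis by simp
  qed
  hence "\<forall>\<^sub>F b in sequentially. real b * p ^ (b - 1) < 1/32" by (rule order_tendstoD) simp
  then obtain a0 where a0: "real b * p ^ (b - 1) < 1/32" if "a0 \<le> b" for b unfolding eventually_sequentially by blast
  define a where "a = Suc a0"
  have a: "1 \<le> a" "\<And>b. a < b \<Longrightarrow> real b * p ^ (b - 1) \<le> 1/32" using a0 by (auto simp: a_def intro: less_imp_le)
  define \<delta> where "\<delta> = p * (1 - p) ^ (16 * a) / 2"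
  have d0: "0 < \<delta>" using p by (simp add: \<delta>_def)
  \<comment> \<open>In \<open>big_or_small\<close> large bicliques and high vertices may each take
    \<delta>/32 of u^2, and 2 (1/32 + 1/32) = 1/8 is the threshold of
    \<open>pr_small_family_le\<close>.\<close>
  define \<delta>1 where "\<delta>1 = \<delta> / 32"
  have d1: "0 < \<delta>1" using d0 by (simp add: \<delta>1_def)
  define w where "w = ln (1 / sqrt p)"
  have w0: "0 < w" using p by (simp add: w_def)
  have "(\<lambda>k. sqrt p ^ k) \<longlonglongrightarrow> 0" using p by (intro LIMSEQ_realpow_zero) auto
  hence "\<forall>\<^sub>F k in sequentially. sqrt p ^ k < w * \<delta>1 / 2" by (rule order_tendstoD) (use w0 d1 in simp)
  \<comment> \<open>The term (sqrt p)^(K+1) u^2 of \<open>biq_weight_sqrt_le\<close> then uses up at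
    most half of the gain w \<delta>1 u^2.\<close>
  then obtain K where K: "sqrt p ^ Suc K < w * \<delta>1 / 2" unfolding eventually_sequentially by (meson le_SucI order_refl)
  obtain D :: nat where "32 * (real K)\<^sup>2 / \<delta> + 1 < real D" using reals_Archimedean2 by blast
  hence D: "32 * (real K)\<^sup>2 / \<delta> \<le> real D" "1 \<le> D"
  proof -
    assume *: "32 * (real K)\<^sup>2 / \<delta> + 1 < real D"
    have "0 \<le> 32 * (real K)\<^sup>2 / \<delta>" using d0 by simp
    with * have "1 < real D" by linarith
    thus "32 * (real K)\<^sup>2 / \<delta> \<le> real D" "1 \<le> D" using * by linarith+
  qed
  define \<kappa> where "\<kappa> = \<delta>\<^sup>2 / (32 * (2 + 4 * real (D * K))\<^sup>2)"
  have k0: "0 < \<kappa>" unfolding \<kappa>_def using d0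
    by (intro divide_pos_pos mult_pos_pos zero_less_power add_pos_nonneg) auto
  \<comment> \<open>For u >= C ln n, the last two summands keep u ln n a small fraction of u^2; the
    summand 2 handles the sum over all sizes u.\<close>
  define C where "C = 2 + 2 / \<kappa> + 4 / (w * \<delta>1)"
  have Cterms: "0 < 2 / \<kappa>" "0 < 4 / (w * \<delta>1)" using k0 w0 d1 by auto
  have C: "2 \<le> C" "2 / \<kappa> \<le> C" "4 / (w * \<delta>1) \<le> C" using Cterms unfolding C_def by linarith+
  have C0: "0 < C" using C by linarith
  have Ci: "1 / C \<le> \<kappa> / 2" "1 / C \<le> w * \<delta>1 / 4"
  proof -
    have "1 / C \<le> 1 / (2 / \<kappa>)" using C Cterms C0 by (intro divide_left_mono mult_pos_pos) auto
    thus "1 / C \<le> \<kappa> / 2" by simp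
    have "1 / C \<le> 1 / (4 / (w * \<delta>1))" using C Cterms C0 by (intro divide_left_mono mult_pos_pos) auto
    thus "1 / C \<le> w * \<delta>1 / 4" by simp
  qed
  define wd where "wd = w * \<delta>1"
  have wd: "0 < wd" using w0 d1 by (simp add: wd_def)
  have "\<forall>\<^sub>F u in sequentially. ln (real u + 1) + real u * (ln (real K + 1) + real K * ln (real u)) + real u \<le> \<kappa> / 2 * (real u)\<^sup>2"
    using k0 by real_asymp
  moreover have "\<forall>\<^sub>F u in sequentially. ln (real u + 1) + real u * (1 + ln (real u) + (ln (real u))\<^sup>2 / w) + real u \<le> wd / 4 * (real u)\<^sup>2"
    using w0 wd by real_asymp
  ultimately have "\<forall>\<^sub>F u in sequentially.
     ln (real u + 1) + real u * (ln (real K + 1) + real K * ln (real u)) + real u \<le> \<kappa> / 2 * (real u)\<^sup>2 \<and>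
     ln (real u + 1) + real u * (1 + ln (real u) + (ln (real u))\<^sup>2 / w) + real u \<le> wd / 4 * (real u)\<^sup>2 \<and> 4 \<le> u"
    using eventually_ge_at_top[of 4] by eventually_elim auto
  then obtain u0 where u0: "ln (real u + 1) + real u * (ln (real K + 1) + real K * ln (real u)) + real u \<le> \<kappa> / 2 * (real u)\<^sup>2"
     "ln (real u + 1) + real u * (1 + ln (real u) + (ln (real u))\<^sup>2 / w) + real u \<le> wd / 4 * (real u)\<^sup>2" "4 \<le> u"
     if "u0 \<le> u" for u unfolding eventually_sequentially by blast
  have "\<forall>\<^sub>F n in sequentially. real u0 \<le> C * ln (real n)" using C0 by real_asymp
  hence "\<forall>\<^sub>F n in sequentially. pr n p (\<lambda>E. \<exists>U L. U \<subseteq> {..<n} \<and> C * ln (real n) \<le> real (card U) \<and>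
     length L \<le> card U \<and> set L \<subseteq> biq U 2 \<and> is_biclique_partition n {e \<in> E. e \<subseteq> U} L) \<le> 2 / real n"
    using eventually_ge_at_top[of 1]
  proof eventually_elim
    case (elim n)
    define J where "J = {u. u \<le> n \<and> C * ln (real n) \<le> real u}"
    let ?I = "\<lambda>u. {U. U \<subseteq> {..<n} \<and> card U = u}"
    let ?P = "\<lambda>U E. \<exists>L. length L \<le> card U \<and> set L \<subseteq> biq U 2 \<and> is_biclique_partition n {e \<in> E. e \<subseteq> U} L"
    have n1: "1 \<le> real n" using elim by simp
    have finI: "finite (?I u)" for u by (rule finite_subset[of _ "Pow {..<n}"]) auto
    have J: "finite J" "card J \<le> n"
    proof -
      show "finite J" by (rule finite_subset[of _ "{..n}"]) (auto simp: J_def)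
      have "4 \<le> u" if "u \<in> J" for u using u0(3)[of u] that elim by (auto simp: J_def)
      hence "J \<subseteq> {1..n}" by (fastforce simp: J_def)
      thus "card J \<le> n" using card_mono[of "{1..n}" J] by simp
    qed
    \<comment> \<open>The part u ln n of the exponent pays for the choice of \<open>U\<close>, the
      part C ln n for the sum over \<open>u\<close>.\<close>
    have perU: "pr n p (?P U) \<le> exp (- (C * ln (real n)) - real u * ln (real n)) * 2" if u: "u \<in> J" and U: "U \<in> ?I u" for u U
    proof -
      have uJ: "u \<le> n" "C * ln (real n) \<le> real u" using u by (auto simp: J_def)
      have "u0 \<le> u" using uJ elim by linarith
      note uu = u0[OF this]
      have UU: "U \<subseteq> {..<n}" "card U = u" "finite U" using U finite_subset by auto
      have lnn: "real u * ln (real n) \<le> (real u)\<^sup>2 * (1 / C)"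
      proof -
        have "ln (real n) \<le> real u / C" using uJ C0 by (simp add: field_simps)
        hence "real u * ln (real n) \<le> real u * (real u / C)" by (intro mult_left_mono) auto
        thus ?thesis by (simp add: power2_eq_square)
      qed
      let ?B = "\<lambda>E. \<exists>L' F. length L' \<le> u \<and> set L' \<subseteq> biq U (Suc K) \<and> is_biclique_partition n F L' \<and> F \<subseteq> E \<and> \<delta>1 * (real u)\<^sup>2 \<le> real (card F)"
      let ?S = "\<lambda>E. \<exists>\<A>. \<A> \<subseteq> {A. A \<subseteq> U \<and> 2 \<le> card A \<and> card A \<le> K} \<and> card \<A> \<le> u \<and> (\<forall>y\<in>U. card {A\<in>\<A>. y \<in> A} \<le> D) \<and>
          real (uncovered_count U \<A> E) \<le> \<delta> * (real u)\<^sup>2 / 8"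
      have "pr n p (?P U) \<le> pr n p (\<lambda>E. ?B E \<or> ?S E)"
      proof (rule pr_mono)
        fix E assume E: "E \<subseteq> all_edges n" and "?P U E"
        then obtain L where L: "length L \<le> card U" "set L \<subseteq> biq U 2" "is_biclique_partition n {e \<in> E. e \<subseteq> U} L" by blast
        have le: "2 * (\<delta>1 * (real u)\<^sup>2 + (real K)\<^sup>2 * (real u)\<^sup>2 / real D) \<le> \<delta> * (real u)\<^sup>2 / 8"
        proof -
          have "(real K)\<^sup>2 / real D \<le> \<delta> / 32" using D d0 by (simp add: field_simps)
          hence "(real K)\<^sup>2 / real D * (real u)\<^sup>2 \<le> \<delta> / 32 * (real u)\<^sup>2" by (intro mult_right_mono) auto
          moreover have "(real K)\<^sup>2 * (real u)\<^sup>2 / real D = (real K)\<^sup>2 / real D * (real u)\<^sup>2" by simp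
          ultimately have "(real K)\<^sup>2 * (real u)\<^sup>2 / real D \<le> \<delta> / 32 * (real u)\<^sup>2" by (simp only:)
          hence "2 * (\<delta>1 * (real u)\<^sup>2 + (real K)\<^sup>2 * (real u)\<^sup>2 / real D) \<le> 2 * (\<delta> / 32 * (real u)\<^sup>2 + \<delta> / 32 * (real u)\<^sup>2)"
            unfolding \<delta>1_def by (intro mult_left_mono add_left_mono) auto
          thus ?thesis by simp
        qed
        have "length L \<le> u" using L(1) UU(2) by simp
        from big_or_small[where K = K and d = "\<delta>1 * (real u)\<^sup>2", OF UU(1,2) E L(3,2) this D(2)]
        show "?B E \<or> ?S E"
        proof (elim disjE)
          assume "\<exists>\<A>. \<A> \<subseteq> {A. A \<subseteq> U \<and> 2 \<le> card A \<and> card A \<le> K} \<and> card \<A> \<le> u \<and> (\<forall>y\<in>U. card {A\<in>\<A>. y \<in> A} \<le> D) \<and>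
            real (uncovered_count U \<A> E) \<le> 2 * (\<delta>1 * (real u)\<^sup>2 + (real K)\<^sup>2 * (real u)\<^sup>2 / real D)"
          then obtain \<A> where A: "\<A> \<subseteq> {A. A \<subseteq> U \<and> 2 \<le> card A \<and> card A \<le> K}" "card \<A> \<le> u" "\<forall>y\<in>U. card {A\<in>\<A>. y \<in> A} \<le> D"
            "real (uncovered_count U \<A> E) \<le> 2 * (\<delta>1 * (real u)\<^sup>2 + (real K)\<^sup>2 * (real u)\<^sup>2 / real D)" by blast
          have "real (uncovered_count U \<A> E) \<le> \<delta> * (real u)\<^sup>2 / 8" using A(4) le by (rule order_trans)
          hence "?S E" using A(1-3) by blast
          thus ?thesis by (rule disjI2)
        qed (rule disjI1)
      qed (use p in auto)
      also have "\<dots> \<le> pr n p ?B + pr n p ?S" using p by (intro pr_disj) auto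
      also have "pr n p ?B \<le> exp (- (C * ln (real n)) - real u * ln (real n))"
      proof -
        have "pr n p ?B \<le> (real u + 1) * (1 + biq_weight U (Suc K) (sqrt p)) ^ u * exp (- (w * (\<delta>1 * (real u)\<^sup>2)))"
          using d1 by (intro pr_big_bicliques_le p UU w_def) auto
        also have "\<dots> \<le> exp (ln (real u + 1)) * exp (real u * (1 + sqrt p ^ Suc K * real u + ln (real u) + (ln (real u))\<^sup>2 / w)) * exp (- (w * (\<delta>1 * (real u)\<^sup>2)))"
        proof (intro mult_right_mono mult_mono)
          show "(1 + biq_weight U (Suc K) (sqrt p)) ^ u \<le> exp (real u * (1 + sqrt p ^ Suc K * real u + ln (real u) + (ln (real u))\<^sup>2 / w))"
            using uu(3) by (intro biq_weight_sqrt_le p UU w_def) auto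
          show "0 \<le> (1 + biq_weight U (Suc K) (sqrt p)) ^ u" using biq_weight_nonneg[of "sqrt p" U "Suc K"] p by simp
        qed auto
        also have "\<dots> = exp (ln (real u + 1) + real u * (1 + sqrt p ^ Suc K * real u + ln (real u) + (ln (real u))\<^sup>2 / w) - wd * (real u)\<^sup>2)"
          by (simp only: exp_add[symmetric]) (simp add: wd_def mult.assoc)
        also have "\<dots> \<le> exp (- (C * ln (real n)) - real u * ln (real n))"
        proof (subst exp_le_cancel_iff)
          have "real u * (sqrt p ^ Suc K * real u) \<le> real u * (wd / 2 * real u)"
            using K by (intro mult_left_mono mult_right_mono) (auto simp: wd_def)
          moreover have "(real u)\<^sup>2 * (1 / C) \<le> (real u)\<^sup>2 * (wd / 4)" using Ci by (intro mult_left_mono) (auto simp: wd_def)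
          moreover have "real u * (1 + sqrt p ^ Suc K * real u + ln (real u) + (ln (real u))\<^sup>2 / w) =
              real u * (sqrt p ^ Suc K * real u) + real u * (1 + ln (real u) + (ln (real u))\<^sup>2 / w)" by (simp add: algebra_simps)
          moreover have "real u * (wd / 2 * real u) = 2 * ((real u)\<^sup>2 * (wd / 4))" "wd * (real u)\<^sup>2 = 4 * ((real u)\<^sup>2 * (wd / 4))"
            "wd / 4 * (real u)\<^sup>2 = (real u)\<^sup>2 * (wd / 4)" by (simp_all add: power2_eq_square)
          ultimately show "ln (real u + 1) + real u * (1 + sqrt p ^ Suc K * real u + ln (real u) + (ln (real u))\<^sup>2 / w) - wd * (real u)\<^sup>2
              \<le> - (C * ln (real n)) - real u * ln (real n)" using uu(2) lnn uJ(2) by linarith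
        qed
        finally show ?thesis .
      qed
      also have "pr n p ?S \<le> exp (- (C * ln (real n)) - real u * ln (real n))"
      proof -
        have "pr n p ?S \<le> (real u + 1) * ((real K + 1) * real u ^ K) ^ u * exp (- \<kappa> * (real u)\<^sup>2)"
          unfolding \<kappa>_def by (rule pr_small_family_le[OF p UU(1,2) uu(3) a \<delta>_def])
        also have "real u + 1 = exp (ln (real u + 1))" by simp
        also have "(real K + 1) * real u ^ K = exp (ln (real K + 1) + real K * ln (real u))"
        proof -
          have "real u ^ K = exp (real K * ln (real u))" using uu(3) by (simp add: exp_of_nat_mult)
          thus ?thesis by (simp add: exp_add)
        qed
        also have "exp (ln (real K + 1) + real K * ln (real u)) ^ u = exp (real u * (ln (real K + 1) + real K * ln (real u)))"
          by (simp add: exp_of_nat_mult)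
        also have "exp (ln (real u + 1)) * exp (real u * (ln (real K + 1) + real K * ln (real u))) * exp (- \<kappa> * (real u)\<^sup>2) =
           exp (ln (real u + 1) + real u * (ln (real K + 1) + real K * ln (real u)) - \<kappa> * (real u)\<^sup>2)"
          by (simp only: exp_add[symmetric]) simp
        also have "\<dots> \<le> exp (- (C * ln (real n)) - real u * ln (real n))"
        proof (subst exp_le_cancel_iff)
          have "(real u)\<^sup>2 * (1 / C) \<le> (real u)\<^sup>2 * (\<kappa> / 2)" using Ci by (intro mult_left_mono) auto
          moreover have "\<kappa> * (real u)\<^sup>2 = 2 * ((real u)\<^sup>2 * (\<kappa> / 2))" "\<kappa> / 2 * (real u)\<^sup>2 = (real u)\<^sup>2 * (\<kappa> / 2)" by simp_all
          ultimately show "ln (real u + 1) + real u * (ln (real K + 1) + real K * ln (real u)) - \<kappa> * (real u)\<^sup>2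
             \<le> - (C * ln (real n)) - real u * ln (real n)" using uu(1) lnn uJ(2) by linarith
        qed
        finally show ?thesis .
      qed
      finally show ?thesis by simp
    qed
    have "pr n p (\<lambda>E. \<exists>U L. U \<subseteq> {..<n} \<and> C * ln (real n) \<le> real (card U) \<and>
       length L \<le> card U \<and> set L \<subseteq> biq U 2 \<and> is_biclique_partition n {e \<in> E. e \<subseteq> U} L) \<le>
       pr n p (\<lambda>E. \<exists>u\<in>J. \<exists>U\<in>?I u. ?P U E)"
    proof (rule pr_mono)
      fix E assume "\<exists>U L. U \<subseteq> {..<n} \<and> C * ln (real n) \<le> real (card U) \<and>
       length L \<le> card U \<and> set L \<subseteq> biq U 2 \<and> is_biclique_partition n {e \<in> E. e \<subseteq> U} L"
      then obtain U L where UL: "U \<subseteq> {..<n}" "C * ln (real n) \<le> real (card U)"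
       "length L \<le> card U" "set L \<subseteq> biq U 2" "is_biclique_partition n {e \<in> E. e \<subseteq> U} L" by blast
      have "card U \<le> n" using card_mono[OF _ UL(1)] by simp
      hence "card U \<in> J" using UL by (simp add: J_def)
      thus "\<exists>u\<in>J. \<exists>U\<in>?I u. ?P U E" using UL by blast
    qed (use p in auto)
    also have "\<dots> \<le> (\<Sum>u\<in>J. pr n p (\<lambda>E. \<exists>U\<in>?I u. ?P U E))" using p J by (intro pr_UN_le) auto
    also have "\<dots> \<le> (\<Sum>u\<in>J. 2 * exp (- (C * ln (real n))))"
    proof (intro sum_mono)
      fix u assume u: "u \<in> J"
      have "pr n p (\<lambda>E. \<exists>U\<in>?I u. ?P U E) \<le> (\<Sum>U\<in>?I u. pr n p (?P U))" using p finI by (intro pr_UN_le) auto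
      also have "\<dots> \<le> (\<Sum>U\<in>?I u. exp (- (C * ln (real n)) - real u * ln (real n)) * 2)" using perU[OF u] by (intro sum_mono)
      also have "\<dots> = real (n choose u) * (exp (- (C * ln (real n)) - real u * ln (real n)) * 2)"
        using n_subsets[of "{..<n}" u] by simp
      also have "\<dots> \<le> exp (real u * ln (real n)) * (exp (- (C * ln (real n)) - real u * ln (real n)) * 2)"
      proof (intro mult_right_mono)
        have "real (n choose u) \<le> real n ^ u" by (rule choose_le_power)
        also have "\<dots> = exp (real u * ln (real n))" using n1 by (simp add: exp_of_nat_mult)
        finally show "real (n choose u) \<le> exp (real u * ln (real n))" .
      qed simp
      also have "\<dots> = 2 * exp (- (C * ln (real n)))" by (simp add: exp_diff)
      finally show "pr n p (\<lambda>E. \<exists>U\<in>?I u. ?P U E) \<le> 2 * exp (- (C * ln (real n)))" .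
    qed
    also have "\<dots> = real (card J) * (2 * exp (- (C * ln (real n))))" by simp
    also have "\<dots> \<le> real n * (2 * exp (- (2 * ln (real n))))"
      using J C n1 by (intro mult_mono) (auto intro!: mult_right_mono)
    also have "exp (- (2 * ln (real n))) = 1 / (real n)\<^sup>2"
    proof -
      have "exp (2 * ln (real n)) = (real n)\<^sup>2" using n1 exp_of_nat_mult[of 2 "ln (real n)"] by simp
      thus ?thesis by (simp add: exp_minus divide_inverse)
    qed
    also have "real n * (2 * (1 / (real n)\<^sup>2)) = 2 / real n" using n1 by (simp add: power2_eq_square)
    finally show ?case .
  qed
  thus ?thesis using that C0 by blast
qed

lemma whp_bp_lower:
  assumes p: "0 < p" "p < 1/2"
  shows "\<exists>C>0. whp (\<lambda>_. p) (\<lambda>n E. real (bp n E) \<ge> real n - C * real (alpha n E))"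
proof -
  obtain C1 where C1: "0 < C1" and core: "\<forall>\<^sub>F n in sequentially. pr n p (\<lambda>E. \<exists>U L. U \<subseteq> {..<n} \<and> C1 * ln (real n) \<le> real (card U) \<and>
     length L \<le> card U \<and> set L \<subseteq> biq U 2 \<and> is_biclique_partition n {e \<in> E. e \<subseteq> U} L) \<le> 2 / real n"
    using no_large_core[of p] p by auto
  define ly where "ly = ln (inv_sqrt_compl p)"
  have ly: "0 < ly" unfolding ly_def using inv_sqrt_compl_bounds[of p] p by (intro ln_gt_zero) auto
  \<comment> \<open>As \<open>s\<close> is at least ln n / (2 ly), a surplus beyond
    \<open>C * s\<close> makes the core larger than C1 ln n.\<close>
  define C where "C = 2 * ly * C1"
  have C: "0 < C" using ly C1 by (simp add: C_def)
  let ?f = "\<lambda>n. (4 * real n powr (-1/9) + 48 * real n powr (-(2*(1/12)/3)) + 2 * real n powr (-(1/8))) + 2 / real n"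
  have "whp (\<lambda>_. p) (\<lambda>n E. real (bp n E) \<ge> real n - C * real (alpha n E))"
  proof (rule whpI)
    show "?f \<longlonglongrightarrow> 0" by real_asymp
    show "\<forall>\<^sub>F n in sequentially. 0 \<le> p \<and> p \<le> 1" using p by simp
    have pe: "\<forall>\<^sub>F n in sequentially. real n powr (-1/3 + 2 * (1/12)) \<le> p \<and> p \<le> 1/2"
    proof -
      have "\<forall>\<^sub>F n in sequentially. real n powr (-1/3 + 2 * (1/12)) \<le> p" using p by real_asymp
      thus ?thesis by (rule eventually_mono) (use p in auto)
    qed
    have ex: "\<forall>\<^sub>F n in sequentially. \<exists>s. alpha_window n p (1/12) (1/8) s"
      using alpha_window_exists[of "1/12" "1/8" "\<lambda>_. p"] pe by simp
    have al: "\<forall>\<^sub>F n in sequentially. \<forall>p s. alpha_window n p (1/12) (1/8) s \<longrightarrow>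
       pr n p (\<lambda>E. alpha n E < s) \<le> 4 * real n powr (-1/9) + 48 * real n powr (-(2*(1/12)/3)) + 2 * real n powr (-(1/8))"
      by (rule alpha_lower) auto
    show "\<forall>\<^sub>F n in sequentially. pr n p (\<lambda>E. \<not> real (bp n E) \<ge> real n - C * real (alpha n E)) \<le> ?f n"
      using core ex al alpha_window_log_lower[OF p, of "1/8"]
    proof eventually_elim
      case (elim n)
      then obtain s where s: "alpha_window n p (1/12) (1/8) s" by blast
      have sl: "ln (real n) / (2 * ly) \<le> real s" using elim s by (simp add: ly_def)
      let ?core = "\<lambda>E. \<exists>U L. U \<subseteq> {..<n} \<and> C1 * ln (real n) \<le> real (card U) \<and>
         length L \<le> card U \<and> set L \<subseteq> biq U 2 \<and> is_biclique_partition n {e \<in> E. e \<subseteq> U} L"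
      have "pr n p (\<lambda>E. \<not> real (bp n E) \<ge> real n - C * real (alpha n E)) \<le> pr n p (\<lambda>E. alpha n E < s \<or> ?core E)"
      proof (rule pr_mono)
        fix E assume E: "E \<subseteq> all_edges n" and neg: "\<not> real (bp n E) \<ge> real n - C * real (alpha n E)"
        show "alpha n E < s \<or> ?core E"
        proof (cases "alpha n E < s")
          case False
          define r where "r = n - bp n E"
          have "bp n E \<le> n" using bp_le_alpha[OF E] by simp
          hence r: "r + bp n E \<le> n" "real r = real n - real (bp n E)" by (auto simp: r_def of_nat_diff)
          obtain U L where UL: "U \<subseteq> {..<n}" "is_biclique_partition n {e \<in> E. e \<subseteq> U} L" "card U = r + length L"
            "set L \<subseteq> biq U 2" using starless_core[OF E r(1)] by blast
          have "C1 * ln (real n) = C * (ln (real n) / (2 * ly))" using ly by (simp add: C_def)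
          also have "\<dots> \<le> C * real s" using sl C by (intro mult_left_mono) auto
          also have "\<dots> \<le> C * real (alpha n E)" using False C by (intro mult_left_mono) auto
          also have "\<dots> \<le> real r" using neg r by linarith
          also have "\<dots> \<le> real (card U)" using UL by simp
          finally have "?core E" using UL by (intro exI[of _ U] exI[of _ L]) auto
          thus ?thesis by simp
        qed simp
      qed (use p in auto)
      also have "\<dots> \<le> pr n p (\<lambda>E. alpha n E < s) + pr n p ?core" using p by (intro pr_disj) auto
      also have "\<dots> \<le> ?f n" using elim(1,3) s by (intro add_mono) auto
      finally show ?case .
    qed
  qed
  thus ?thesis using C by blast
qed

section \<open>The upper bound above the threshold\<close>

text \<open>A configuration picks one vertex from each of \<open>a + 2 * b\<close> blocks of size \<open>N\<close>. The first \<open>a\<close> form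
  an independent set; the positions \<open>a + 2 * i\<close> and \<open>a + 2 * i + 1\<close> form the \<open>i\<close>-th pair.\<close>

definition block_vertex :: "nat \<Rightarrow> (nat \<Rightarrow> nat) \<Rightarrow> nat \<Rightarrow> nat" where
  "block_vertex N \<sigma> t = t * N + \<sigma> t"

definition configs :: "nat \<Rightarrow> nat \<Rightarrow> (nat \<Rightarrow> nat) set" where
  "configs m N = PiE {..<m} (\<lambda>_. {..<N})"

text \<open>The whole second part is independent, and not only each pair, so that all edges of the
  configuration run between the parts. The price is quadratic in \<open>b\<close> and appears as z^2
  / 2 in \<open>overlap_quadratic_le\<close>.\<close>

definition twin :: "nat \<Rightarrow> nat \<Rightarrow> nat \<Rightarrow> (nat \<Rightarrow> nat) \<Rightarrow> nat set set \<Rightarrow> bool" where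
  "twin a b N \<sigma> E \<longleftrightarrow> independent E (block_vertex N \<sigma> ` {..<a}) \<and> independent E (block_vertex N \<sigma> ` {a..<a + 2 * b}) \<and>
     (\<forall>t<a. \<forall>i<b. {block_vertex N \<sigma> t, block_vertex N \<sigma> (a + 2 * i)} \<in> E \<longleftrightarrow> {block_vertex N \<sigma> t, block_vertex N \<sigma> (a + 2 * i + 1)} \<in> E)"

lemma block_vertex_div: "\<sigma> t < N \<Longrightarrow> block_vertex N \<sigma> t div N = t"
  by (simp add: block_vertex_def)

lemma block_vertex_eq_iff: "\<sigma> s < N \<Longrightarrow> \<tau> t < N \<Longrightarrow> block_vertex N \<sigma> s = block_vertex N \<tau> t \<longleftrightarrow> s = t \<and> \<sigma> s = \<tau> t"
  by (metis block_vertex_def block_vertex_div add_left_cancel)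

lemma configs_less: "\<sigma> \<in> configs m N \<Longrightarrow> t < m \<Longrightarrow> \<sigma> t < N"
  by (auto simp: configs_def PiE_def Pi_def)

lemma block_vertex_less:
  assumes "\<sigma> t < N" "t < m" "m * N \<le> n"
  shows "block_vertex N \<sigma> t < n"
proof -
  have "block_vertex N \<sigma> t < Suc t * N" using assms by (simp add: block_vertex_def)
  also have "\<dots> \<le> m * N" using assms by (intro mult_right_mono) auto
  finally show ?thesis using assms by simp
qed

text \<open>The two vertices of a pair have the same neighbours in the first part, so each pair needs
  a single biclique although it consists of two vertices.\<close>

lemma bp_le_twin:
  assumes \<sigma>: "\<sigma> \<in> configs (a + 2 * b) N" and n: "(a + 2 * b) * N \<le> n" and E: "E \<subseteq> all_edges n"
    and tw: "twin a b N \<sigma> E"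
  shows "bp n E + a + b \<le> n"
proof -
  let ?m = "a + 2 * b" and ?v = "block_vertex N \<sigma>"
  have sl: "\<sigma> t < N" if "t < ?m" for t using configs_less[OF \<sigma> that] .
  have inj: "?v s = ?v t \<longleftrightarrow> s = t" if "s < ?m" "t < ?m" for s t
    using block_vertex_eq_iff[of \<sigma> s N \<sigma> t] sl that by auto
  define U where "U = ?v ` {..<?m}"
  have cU: "card U = ?m" unfolding U_def using inj by (subst card_image) (auto simp: inj_on_def)
  have Un: "U \<subseteq> {..<n}" unfolding U_def using block_vertex_less sl n by blast
  define A where "A i = {?v (a + 2 * i), ?v (a + 2 * i + 1)}" for i
  define B where "B i = {?v t | t. t < a \<and> {?v t, ?v (a + 2 * i)} \<in> E}" for i
  have twE: "{?v t, ?v (a + 2 * i)} \<in> E \<longleftrightarrow> {?v t, ?v (a + 2 * i + 1)} \<in> E" if "t < a" "i < b" for t i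
    using tw that by (auto simp: twin_def)
  have ABE: "biclique_edges (A i, B i) \<subseteq> E" if "i < b" for i
  proof
    fix e assume "e \<in> biclique_edges (A i, B i)"
    then obtain x t where "e = {x, ?v t}" "x \<in> A i" "t < a" "{?v t, ?v (a + 2 * i)} \<in> E"
      unfolding biclique_edges_Pair B_def by blast
    thus "e \<in> E" using twE[OF _ that, of t] by (auto simp: A_def insert_commute)
  qed
  have part: "\<exists>L. length L \<le> j \<and> is_biclique_partition n (\<Union>i<j. biclique_edges (A i, B i)) L" if "j \<le> b" for j
    using that
  proof (induction j)
    case 0
    show ?case by (intro exI[of _ "[]"]) (simp add: bpart_Nil)
  next
    case (Suc j)
    then obtain L where L: "length L \<le> j" "is_biclique_partition n (\<Union>i<j. biclique_edges (A i, B i)) L" by auto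
    let ?G = "\<Union>i<j. biclique_edges (A i, B i)"
    have UN: "(\<Union>i<Suc j. biclique_edges (A i, B i)) = biclique_edges (A j, B j) \<union> ?G"
      by (auto simp: lessThan_Suc)
    show ?case
    \<comment> \<open>A pair without neighbours in the first part yields no biclique, since sides
      must be nonempty; hence \<open>length L \<le> j\<close> and not equality.\<close>
    proof (cases "B j = {}")
      case True
      hence "biclique_edges (A j, B j) = {}" by (simp add: biclique_edges_Pair)
      thus ?thesis using L UN by (intro exI[of _ L]) auto
    next
      case False
      have jb: "j < b" using Suc by simp
      have "biclique_edges (A j, B j) \<inter> ?G = {}"
      proof (rule ccontr)
        assume "biclique_edges (A j, B j) \<inter> ?G \<noteq> {}"
        then obtain e i where i: "i < j" "e \<in> biclique_edges (A j, B j)" "e \<in> biclique_edges (A i, B i)" by auto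
        obtain s t where 1: "e = {?v s, ?v t}" "s = a + 2 * j \<or> s = a + 2 * j + 1" "t < a"
          using i(2) unfolding biclique_edges_Pair A_def B_def by auto
        obtain s' t' where 2: "e = {?v s', ?v t'}" "s' = a + 2 * i \<or> s' = a + 2 * i + 1" "t' < a"
          using i(3) unfolding biclique_edges_Pair A_def B_def by auto
        have "?v s = ?v s' \<or> ?v s = ?v t'" using 1 2 by (auto simp: doubleton_eq_iff)
        hence "s = s' \<or> s = t'" using inj 1 2 i jb by auto
        moreover have "(s - a) div 2 = j" "(s' - a) div 2 = i" using 1(2) 2(2) by auto
        moreover have "a \<le> s" using 1(2) by auto
        ultimately show False using 2(3) i(1) by auto
      qed
      hence "biclique_edges (A j, B j) \<union> ?G - biclique_edges (A j, B j) = ?G" by auto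
      moreover have "is_biclique n (biclique_edges (A j, B j) \<union> ?G) (A j, B j)"
      proof -
        have "A j \<subseteq> U" "B j \<subseteq> U" unfolding A_def B_def U_def using jb by auto
        moreover have "A j \<inter> B j = {}" unfolding A_def B_def using inj jb by auto
        moreover have "A j \<noteq> {}" by (simp add: A_def)
        ultimately show ?thesis using Un False by (auto simp: is_biclique_def)
      qed
      ultimately have "is_biclique_partition n (\<Union>i<Suc j. biclique_edges (A i, B i)) ((A j, B j) # L)"
        unfolding UN bpart_Cons using L by simp
      thus ?thesis using L by (intro exI[of _ "(A j, B j) # L"]) auto
    qed
  qed
  obtain L where L: "length L \<le> b" "is_biclique_partition n (\<Union>i<b. biclique_edges (A i, B i)) L" using part[of b] by auto
  have "(\<Union>i<b. biclique_edges (A i, B i)) = {e \<in> E. e \<subseteq> U}"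
  proof (intro equalityI subsetI)
    fix e assume "e \<in> (\<Union>i<b. biclique_edges (A i, B i))"
    then obtain i where i: "i < b" "e \<in> biclique_edges (A i, B i)" by auto
    moreover have "A i \<subseteq> U" "B i \<subseteq> U" unfolding A_def B_def U_def using i by auto
    hence "e \<subseteq> U" using i(2) unfolding biclique_edges_Pair by auto
    ultimately show "e \<in> {e \<in> E. e \<subseteq> U}" using ABE by auto
  next
    fix e assume e: "e \<in> {e \<in> E. e \<subseteq> U}"
    hence "e \<in> all_edges n" using E by auto
    then obtain x y where xy: "e = {x, y}" "x \<noteq> y" by (auto simp: all_edges_def)
    then obtain s t where st: "e = {?v s, ?v t}" "s < ?m" "t < ?m" "?v s \<noteq> ?v t" using e unfolding U_def by auto
    have ind: "{x, y} \<notin> E" if "independent E S" "x \<in> S" "y \<in> S" "x \<noteq> y" for S x y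
      using that unfolding independent_def by blast
    have tw1: "independent E (?v ` {..<a})" and tw2: "independent E (?v ` {a..<a + 2 * b})" using tw by (auto simp: twin_def)
    have eE: "{?v s, ?v t} \<in> E" using e st(1) by simp
    have i1: "\<not> (s < a \<and> t < a)"
    proof
      assume "s < a \<and> t < a"
      hence "?v s \<in> ?v ` {..<a}" "?v t \<in> ?v ` {..<a}" by auto
      thus False using ind[OF tw1 _ _ st(4)] eE by blast
    qed
    have i2: "\<not> (a \<le> s \<and> a \<le> t)"
    proof
      assume "a \<le> s \<and> a \<le> t"
      hence "?v s \<in> ?v ` {a..<a + 2 * b}" "?v t \<in> ?v ` {a..<a + 2 * b}" using st by auto
      thus False using ind[OF tw2 _ _ st(4)] eE by blast
    qed
    have key: "e \<in> (\<Union>i<b. biclique_edges (A i, B i))" if "e = {?v s, ?v t}" "s < a" "a \<le> t" "t < ?m" for s t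
    proof -
      define i where "i = (t - a) div 2"
      have "t - a = 2 * i + (t - a) mod 2" by (simp add: i_def)
      moreover have "(t - a) mod 2 < 2" by simp
      ultimately have i: "i < b" "t = a + 2 * i \<or> t = a + 2 * i + 1" using that by linarith+
      have "{?v s, ?v t} \<in> E" using that e by auto
      hence "{?v s, ?v (a + 2 * i)} \<in> E" using i twE[of s i] that by auto
      hence "?v s \<in> B i" using that by (auto simp: B_def)
      moreover have "?v t \<in> A i" using i by (auto simp: A_def)
      ultimately have "e \<in> biclique_edges (A i, B i)" unfolding biclique_edges_Pair that(1)
        by (auto simp: insert_commute)
      thus ?thesis using i by auto
    qed
    show "e \<in> (\<Union>i<b. biclique_edges (A i, B i))"
    proof (cases "s < a")
      case True
      thus ?thesis using key[of s t] st i1 by auto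
    next
      case False
      thus ?thesis using key[of t s] st i2 by (auto simp: insert_commute)
    qed
  qed
  hence "is_biclique_partition n {e \<in> E. e \<subseteq> U} L" using L by simp
  from bp_le_delete[OF Un E this] show ?thesis using cU L by simp
qed

text \<open>\<open>x1\<close>, \<open>x2\<close> join a vertex of the first part to the two vertices
  of a pair, and \<open>y1\<close>, \<open>y2\<close> do the same in a second configuration. Without
  shared edges the probability is q^2, and every shared edge gains at most a factor 1/sqrt q; this
  makes the overlap factor multiplicative.\<close>

lemma bexp_pair_eq:
  fixes x1 x2 y1 y2 :: 'a
  assumes A: "finite A" "{x1, x2, y1, y2} \<subseteq> A" and d: "x1 \<noteq> x2" "y1 \<noteq> y2" "x1 \<noteq> y2" "x2 \<noteq> y1"
    and p: "0 \<le> p" "p \<le> 1" and q: "q = 1 - 2 * p + 2 * p\<^sup>2"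
  defines "P \<equiv> bexp A p (\<lambda>E. of_bool ((x1 \<in> E \<longleftrightarrow> x2 \<in> E) \<and> (y1 \<in> E \<longleftrightarrow> y2 \<in> E)))"
  shows "x1 = y1 \<Longrightarrow> x2 = y2 \<Longrightarrow> P = q"
    and "P \<le> sqrt q ^ (4 - (of_bool (x1 = y1) + of_bool (x2 = y2)))"
proof -
  have pat: "bexp A p (\<lambda>E. of_bool (F1 \<subseteq> E \<and> F0 \<inter> E = {})) = p ^ card F1 * (1 - p) ^ card F0"
    if "F1 \<subseteq> {x1, x2, y1, y2}" "F0 \<subseteq> {x1, x2, y1, y2}" "F1 \<inter> F0 = {}" for F1 F0
    using that A by (intro bexp_pattern) auto
  have q1: "q = p\<^sup>2 + (1 - p)\<^sup>2" unfolding q by (simp add: power2_eq_square algebra_simps)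
  have q0: "0 \<le> q" unfolding q1 by simp
  have sq: "sqrt q ^ 2 = q" "sqrt q ^ 4 = q\<^sup>2" "sqrt q ^ 3 = q * sqrt q"
    using q0 by (simp_all add: power2_eq_square power3_eq_cube power4_eq_xxxx)
  have both: "P = q" if "x1 = y1" "x2 = y2"
  proof -
    have "P = bexp A p (\<lambda>E. of_bool ({x1, x2} \<subseteq> E \<and> {} \<inter> E = {}) + of_bool ({} \<subseteq> E \<and> {x1, x2} \<inter> E = {}))"
      unfolding P_def using that by (intro bexp_cong) auto
    also have "\<dots> = p ^ card {x1, x2} + (1 - p) ^ card {x1, x2}"
      using pat[of "{x1, x2}" "{}"] pat[of "{}" "{x1, x2}"] unfolding bexp_add by simp
    finally show ?thesis using d by (simp add: q1 power2_eq_square)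
  qed
  have triple: "P = p ^ 3 + (1 - p) ^ 3" if "card {x1, x2, y1, y2} = 3" "x1 = y1 \<or> x2 = y2"
  proof -
    let ?S = "{x1, x2, y1, y2}"
    have "P = bexp A p (\<lambda>E. of_bool (?S \<subseteq> E \<and> {} \<inter> E = {}) + of_bool ({} \<subseteq> E \<and> ?S \<inter> E = {}))"
      unfolding P_def using that(2) by (intro bexp_cong) auto
    also have "\<dots> = p ^ card ?S + (1 - p) ^ card ?S"
      using pat[of ?S "{}"] pat[of "{}" ?S] unfolding bexp_add by simp
    finally show ?thesis unfolding that(1) .
  qed
  \<comment> \<open>With r = p(1-p) the squared inequality reads (1-3r)^2 <= (1-2r)^3.\<close>
  have t3: "p ^ 3 + (1 - p) ^ 3 \<le> sqrt q ^ 3"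
  proof (rule power2_le_imp_le)
    define r where "r = p * (1 - p)"
    have r: "0 \<le> r" "r \<le> 1/4"
    proof -
      show "0 \<le> r" using p by (simp add: r_def)
      have "0 \<le> (p - 1/2)\<^sup>2" by simp
      thus "r \<le> 1/4" by (simp add: r_def power2_eq_square algebra_simps)
    qed
    have "p ^ 3 + (1 - p) ^ 3 = 1 - 3 * r" by (simp add: r_def power3_eq_cube algebra_simps)
    moreover have "q = 1 - 2 * r" unfolding q by (simp add: r_def power2_eq_square algebra_simps)
    moreover have "(sqrt q ^ 3)\<^sup>2 = (sqrt q ^ 2) ^ 3" unfolding power_mult[symmetric] by simp
    hence "(sqrt q ^ 3)\<^sup>2 = q ^ 3" unfolding sq(1) .
    moreover have "(1 - 2 * r) ^ 3 - (1 - 3 * r)\<^sup>2 = r\<^sup>2 * (3 - 8 * r)"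
      by (simp add: power2_eq_square power3_eq_cube algebra_simps)
    moreover have "0 \<le> r\<^sup>2 * (3 - 8 * r)" using r by (intro mult_nonneg_nonneg) auto
    ultimately show "(p ^ 3 + (1 - p) ^ 3)\<^sup>2 \<le> (sqrt q ^ 3)\<^sup>2" by simp
  qed (use q0 in simp)
  show "x1 = y1 \<Longrightarrow> x2 = y2 \<Longrightarrow> P = q" by (rule both)
  show "P \<le> sqrt q ^ (4 - (of_bool (x1 = y1) + of_bool (x2 = y2)))"
  proof (cases "x1 = y1")
    case c1: True
    show ?thesis
    proof (cases "x2 = y2")
      case True
      thus ?thesis using both c1 sq by simp
    next
      case False
      have "{x1, x2, y1, y2} = {x1, x2, y2}" using c1 by auto
      hence "card {x1, x2, y1, y2} = 3" using False d by (simp only:) simp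
      thus ?thesis using triple t3 c1 False by simp
    qed
  next
    case c1: False
    show ?thesis
    proof (cases "x2 = y2")
      case True
      have "{x1, x2, y1, y2} = {x1, x2, y1}" using True by auto
      hence "card {x1, x2, y1, y2} = 3" using c1 d by (simp only:) simp
      thus ?thesis using triple t3 c1 True by simp
    next
      case False
      have "P = bexp A p (\<lambda>E. of_bool ({x1, x2, y1, y2} \<subseteq> E \<and> {} \<inter> E = {}) + of_bool ({x1, x2} \<subseteq> E \<and> {y1, y2} \<inter> E = {}) +
          of_bool ({y1, y2} \<subseteq> E \<and> {x1, x2} \<inter> E = {}) + of_bool ({} \<subseteq> E \<and> {x1, x2, y1, y2} \<inter> E = {}))"
        unfolding P_def using d c1 False by (intro bexp_cong) auto
      also have "\<dots> = p ^ 4 + p\<^sup>2 * (1 - p)\<^sup>2 + p\<^sup>2 * (1 - p)\<^sup>2 + (1 - p) ^ 4"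
      proof -
        have cs: "card {x1, x2, y1, y2} = 4" "card {x1, x2} = 2" "card {y1, y2} = 2" using d c1 False by auto
        have ds: "{x1, x2} \<inter> {y1, y2} = {}" "{y1, y2} \<inter> {x1, x2} = {}" using d c1 False by auto
        have 1: "bexp A p (\<lambda>E. of_bool ({x1, x2, y1, y2} \<subseteq> E \<and> {} \<inter> E = {})) = p ^ 4" 
          using pat[of "{x1, x2, y1, y2}" "{}"] cs by simp
        have 2: "bexp A p (\<lambda>E. of_bool ({x1, x2} \<subseteq> E \<and> {y1, y2} \<inter> E = {})) = p\<^sup>2 * (1 - p)\<^sup>2"
          using pat[of "{x1, x2}" "{y1, y2}", unfolded cs] ds by blast
        have 3: "bexp A p (\<lambda>E. of_bool ({y1, y2} \<subseteq> E \<and> {x1, x2} \<inter> E = {})) = p\<^sup>2 * (1 - p)\<^sup>2"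
          using pat[of "{y1, y2}" "{x1, x2}", unfolded cs] ds by blast
        have 4: "bexp A p (\<lambda>E. of_bool ({} \<subseteq> E \<and> {x1, x2, y1, y2} \<inter> E = {})) = (1 - p) ^ 4"
          using pat[of "{}" "{x1, x2, y1, y2}"] cs by simp
        show ?thesis unfolding bexp_add 1 2 3 4 ..
      qed
      also have "\<dots> = q\<^sup>2" unfolding q1 by (simp add: power2_eq_square power4_eq_xxxx algebra_simps)
      finally show ?thesis using c1 False sq by simp
    qed
  qed
qed

section \<open>Probability of one and of two twin configurations\<close>

lemma prod_of_bool: "finite S \<Longrightarrow> (\<Prod>x\<in>S. of_bool (P x) :: real) = of_bool (\<forall>x\<in>S. P x)"
  by (induction S rule: finite_induct) auto

lemma sum_pairs_eq: "(\<Sum>c\<in>{a..<a + 2 * b}. f c) = (\<Sum>i<b. f (a + 2 * i) + f (a + 2 * i + 1 :: nat) :: nat)"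
proof (induction b)
  case (Suc b)
  have "{a..<a + 2 * Suc b} = insert (a + 2 * b + 1) (insert (a + 2 * b) {a..<a + 2 * b})" by auto
  thus ?case using Suc by simp
qed simp

abbreviation agree :: "nat \<Rightarrow> (nat \<Rightarrow> nat) \<Rightarrow> (nat \<Rightarrow> nat) \<Rightarrow> nat set" where
  "agree m \<sigma> \<tau> \<equiv> {t. t < m \<and> \<sigma> t = \<tau> t}"

text \<open>Bounds the ratio of the joint probability to the product of the single ones when two
  configurations agree exactly on \<open>J\<close>: a factor 1/(1-p) for each shared pair inside a
  part, and (1-2p+2p^2)^(-1/2) for each shared pair across.\<close>

definition overlap_weight :: "nat \<Rightarrow> nat \<Rightarrow> real \<Rightarrow> nat set \<Rightarrow> real" where
  "overlap_weight a b p J = 1 / ((1 - p) ^ ((card (J \<inter> {..<a}) choose 2) + (card (J \<inter> {a..<a + 2 * b}) choose 2)) *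
     sqrt (1 - 2 * p + 2 * p\<^sup>2) ^ (card (J \<inter> {..<a}) * card (J \<inter> {a..<a + 2 * b})))"

lemma overlap_weight_nonneg:
  assumes "p \<le> 1"
  shows "0 \<le> overlap_weight a b p J"
proof -
  have "1 - 2 * p + 2 * p\<^sup>2 = p\<^sup>2 + (1 - p)\<^sup>2" by (simp add: power2_eq_square algebra_simps)
  moreover have "0 \<le> p\<^sup>2 + (1 - p)\<^sup>2" by simp
  ultimately have "0 \<le> sqrt (1 - 2 * p + 2 * p\<^sup>2)" by (simp only: real_sqrt_ge_0_iff)
  thus ?thesis unfolding overlap_weight_def using assms
    by (intro divide_nonneg_nonneg mult_nonneg_nonneg zero_le_power) auto
qed

text \<open>The relevant edges fall into independent groups: the pairs inside the parts, and, for
  each first-part index and each pair index, the edges joining them in either configuration. The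
  single probability is the case of two equal configurations.\<close>

lemma pr_twin:
  assumes p: "0 < p" "p < 1" and n: "(a + 2 * b) * N \<le> n"
    and \<sigma>: "\<sigma> \<in> configs (a + 2 * b) N" and \<tau>: "\<tau> \<in> configs (a + 2 * b) N"
  defines "P0 \<equiv> (1 - p) ^ ((a choose 2) + (2 * b choose 2)) * (1 - 2 * p + 2 * p\<^sup>2) ^ (a * b)"
  shows "pr n p (twin a b N \<sigma>) = P0"
    and "pr n p (\<lambda>E. twin a b N \<sigma> E \<and> twin a b N \<tau> E) \<le> P0\<^sup>2 * overlap_weight a b p (agree (a + 2 * b) \<sigma> \<tau>)"
proof -
  define m where "m = a + 2 * b"
  define q where "q = 1 - 2 * p + 2 * p\<^sup>2"
  define g where "g = sqrt q"
  have q0: "0 < q"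
  proof -
    have "q = p\<^sup>2 + (1 - p)\<^sup>2" unfolding q_def by (simp add: power2_eq_square algebra_simps)
    thus ?thesis using p by (simp add: add_pos_pos)
  qed
  have g0: "0 < g" "g\<^sup>2 = q" using q0 by (auto simp: g_def)
  define V1 where "V1 \<sigma> = block_vertex N \<sigma> ` {..<a}" for \<sigma>
  define V2 where "V2 \<sigma> = block_vertex N \<sigma> ` {a..<a + 2 * b}" for \<sigma>
  define F0 where "F0 \<sigma> = {e \<in> all_edges n. e \<subseteq> V1 \<sigma>} \<union> {e \<in> all_edges n. e \<subseteq> V2 \<sigma>}" for \<sigma>
  define x1 where "x1 \<sigma> z = {block_vertex N \<sigma> (fst z), block_vertex N \<sigma> (a + 2 * snd z)}" for \<sigma> and z :: "nat \<times> nat"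
  define x2 where "x2 \<sigma> z = {block_vertex N \<sigma> (fst z), block_vertex N \<sigma> (a + 2 * snd z + 1)}" for \<sigma> and z :: "nat \<times> nat"
  define S where "S = {..<a} \<times> {..<b}"
  \<comment> \<open>The blocks that contain the ends of an edge. They tell the groups apart,
    whichever configuration the edge comes from.\<close>
  define cd where "cd e = (\<lambda>x. x div N) ` e" for e
  have sl: "\<sigma> t < N" if "\<sigma> \<in> configs m N" "t < m" for \<sigma> t using configs_less that by blast
  have vn: "block_vertex N \<sigma> t < n" if "\<sigma> \<in> configs m N" "t < m" for \<sigma> t
    using sl[OF that] that(2) n unfolding m_def by (rule block_vertex_less)
  have vd: "block_vertex N \<sigma> t div N = t" if "\<sigma> \<in> configs m N" "t < m" for \<sigma> t using block_vertex_div sl[OF that] by blast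
  have veq: "block_vertex N \<sigma> s = block_vertex N \<tau> t \<longleftrightarrow> s = t \<and> \<sigma> s = \<tau> t" if "\<sigma> \<in> configs m N" "\<tau> \<in> configs m N" "s < m" "t < m" for \<sigma> \<tau> s t
    using block_vertex_eq_iff sl that by blast
  have Sm: "fst z < a" "fst z < m" "snd z < b" "a + 2 * snd z < m" "a + 2 * snd z + 1 < m" if "z \<in> S" for z
    using that by (auto simp: S_def m_def)
  have cd1: "cd (x1 \<sigma> z) = {fst z, a + 2 * snd z}" "cd (x2 \<sigma> z) = {fst z, a + 2 * snd z + 1}"
    if "\<sigma> \<in> configs m N" "z \<in> S" for \<sigma> z
    using vd[OF that(1)] Sm[OF that(2)] by (simp_all add: cd_def x1_def x2_def)
  have cdF: "cd e \<subseteq> {..<a} \<or> cd e \<subseteq> {a..<m}" if "\<sigma> \<in> configs m N" "e \<in> F0 \<sigma>" for \<sigma> e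
  proof -
    have "cd (V1 \<sigma>) \<subseteq> {..<a}" "cd (V2 \<sigma>) \<subseteq> {a..<m}"
      using vd[OF that(1)] by (auto simp: cd_def V1_def V2_def m_def)
    thus ?thesis using that(2) unfolding F0_def cd_def by (auto dest: image_mono)
  qed
  have xe: "x1 \<sigma> z \<in> all_edges n" "x2 \<sigma> z \<in> all_edges n" if "\<sigma> \<in> configs m N" "z \<in> S" for \<sigma> z
  proof -
    have "block_vertex N \<sigma> (fst z) \<noteq> block_vertex N \<sigma> (a + 2 * snd z)" "block_vertex N \<sigma> (fst z) \<noteq> block_vertex N \<sigma> (a + 2 * snd z + 1)"
      using veq[OF that(1,1)] Sm[OF that(2)] by auto
    thus "x1 \<sigma> z \<in> all_edges n" "x2 \<sigma> z \<in> all_edges n"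
      unfolding x1_def x2_def all_edges_eq using vn[OF that(1)] Sm[OF that(2)] by auto
  qed
  have factor: "pr n p (\<lambda>E. twin a b N \<sigma> E \<and> twin a b N \<tau> E) = (1 - p) ^ card (F0 \<sigma> \<union> F0 \<tau>) *
     (\<Prod>z\<in>S. pr n p (\<lambda>E. (x1 \<sigma> z \<in> E \<longleftrightarrow> x2 \<sigma> z \<in> E) \<and> (x1 \<tau> z \<in> E \<longleftrightarrow> x2 \<tau> z \<in> E)))"
    if st: "\<sigma> \<in> configs m N" "\<tau> \<in> configs m N" for \<sigma> \<tau>
  proof -
    \<comment> \<open>\<open>None\<close> stands for the forbidden edges of both configurations,
      \<open>Some z\<close> for the group of a first-part index and a pair index.\<close>
    define Q where "Q k = (case k of None \<Rightarrow> F0 \<sigma> \<union> F0 \<tau> | Some z \<Rightarrow> {x1 \<sigma> z, x2 \<sigma> z, x1 \<tau> z, x2 \<tau> z})" for k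
    define f :: "(nat \<times> nat) option \<Rightarrow> nat set set \<Rightarrow> real" where "f k X = (case k of None \<Rightarrow> of_bool ((F0 \<sigma> \<union> F0 \<tau>) \<inter> X = {}) |
       Some z \<Rightarrow> of_bool ((x1 \<sigma> z \<in> X \<longleftrightarrow> x2 \<sigma> z \<in> X) \<and> (x1 \<tau> z \<in> X \<longleftrightarrow> x2 \<tau> z \<in> X)))" for k X
    define I where "I = insert None (Some ` S)"
    have finS: "finite S" by (simp add: S_def)
    have prodI: "(\<Prod>k\<in>I. h k) = h None * (\<Prod>z\<in>S. h (Some z))" for h :: "_ \<Rightarrow> real"
      unfolding I_def using finS by (subst prod.insert) (auto simp: prod.reindex)
    have Qsub: "Q k \<subseteq> all_edges n" if "k \<in> I" for k
      using that xe st unfolding I_def Q_def F0_def by auto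
    have Qcd: "\<exists>c\<in>{a + 2 * snd z, a + 2 * snd z + 1}. cd e = {fst z, c}" if "z \<in> S" "e \<in> Q (Some z)" for z e
      using that cd1[OF st(1) that(1)] cd1[OF st(2) that(1)] unfolding Q_def by auto
    have disj: "disjoint_family_on Q I"
    proof -
      have d1: "Q None \<inter> Q (Some z) = {}" if z: "z \<in> S" for z
      proof (rule ccontr)
        assume "Q None \<inter> Q (Some z) \<noteq> {}"
        then obtain e where e: "e \<in> F0 \<sigma> \<or> e \<in> F0 \<tau>" "e \<in> Q (Some z)" by (auto simp: Q_def)
        obtain c where c: "c \<in> {a + 2 * snd z, a + 2 * snd z + 1}" and "cd e = {fst z, c}" using Qcd[OF z e(2)] by blast
        moreover have "a \<le> c" using c by auto
        moreover have "cd e \<subseteq> {..<a} \<or> cd e \<subseteq> {a..<m}" using e(1) cdF st by blast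
        ultimately show False using Sm(1)[OF z] by auto
      qed
      have d2: "Q (Some z) \<inter> Q (Some z') = {}" if z: "z \<in> S" "z' \<in> S" "z \<noteq> z'" for z z'
      proof (rule ccontr)
        assume "Q (Some z) \<inter> Q (Some z') \<noteq> {}"
        then obtain e where e: "e \<in> Q (Some z)" "e \<in> Q (Some z')" by auto
        obtain c where c: "c \<in> {a + 2 * snd z, a + 2 * snd z + 1}" "cd e = {fst z, c}" using Qcd[OF z(1) e(1)] by blast
        obtain c' where c': "c' \<in> {a + 2 * snd z', a + 2 * snd z' + 1}" "cd e = {fst z', c'}" using Qcd[OF z(2) e(2)] by blast
        have "fst z < a" "fst z' < a" "a \<le> c" "a \<le> c'" using Sm(1) z c(1) c'(1) by auto
        hence "fst z = fst z'" "c = c'" using c(2) c'(2) by (auto simp: doubleton_eq_iff)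
        moreover have "(c - a) div 2 = snd z" "(c' - a) div 2 = snd z'" using c(1) c'(1) by auto
        ultimately show False using z(3) by (metis prod.collapse)
      qed
      show ?thesis unfolding disjoint_family_on_def I_def using d1 d2 by (auto simp: Int_commute)
    qed
    have "pr n p (\<lambda>E. twin a b N \<sigma> E \<and> twin a b N \<tau> E) = bexp (all_edges n) p (\<lambda>E. \<Prod>k\<in>I. f k (E \<inter> Q k))"
    proof (rule bexp_cong)
      fix E assume E: "E \<subseteq> all_edges n"
      have F0i: "F0 \<rho> \<inter> E = {} \<longleftrightarrow> independent E (V1 \<rho>) \<and> independent E (V2 \<rho>)" for \<rho>
        using independent_iff[OF E] E unfolding F0_def by blast
      have tw: "twin a b N \<rho> E \<longleftrightarrow> F0 \<rho> \<inter> E = {} \<and> (\<forall>z\<in>S. x1 \<rho> z \<in> E \<longleftrightarrow> x2 \<rho> z \<in> E)" for \<rho>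
        unfolding F0i twin_def V1_def V2_def S_def x1_def x2_def by auto
      have fn: "f None (E \<inter> Q None) = of_bool (F0 \<sigma> \<inter> E = {} \<and> F0 \<tau> \<inter> E = {})"
        unfolding f_def Q_def option.case by (rule arg_cong[where f = of_bool]) auto
      have fs: "f (Some z) (E \<inter> Q (Some z)) = of_bool ((x1 \<sigma> z \<in> E \<longleftrightarrow> x2 \<sigma> z \<in> E) \<and> (x1 \<tau> z \<in> E \<longleftrightarrow> x2 \<tau> z \<in> E))" for z
        unfolding f_def Q_def by simp
      have "(\<Prod>k\<in>I. f k (E \<inter> Q k)) = of_bool (F0 \<sigma> \<inter> E = {} \<and> F0 \<tau> \<inter> E = {}) *
          of_bool (\<forall>z\<in>S. (x1 \<sigma> z \<in> E \<longleftrightarrow> x2 \<sigma> z \<in> E) \<and> (x1 \<tau> z \<in> E \<longleftrightarrow> x2 \<tau> z \<in> E))"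
        unfolding prodI fn fs prod_of_bool[OF finS] ..
      also have "\<dots> = of_bool (twin a b N \<sigma> E \<and> twin a b N \<tau> E)" 
        unfolding tw of_bool_conj[symmetric] by (rule arg_cong[where f = of_bool]) blast
      finally show "of_bool (twin a b N \<sigma> E \<and> twin a b N \<tau> E) = (\<Prod>k\<in>I. f k (E \<inter> Q k))" by simp
    qed simp
    also have "\<dots> = (\<Prod>k\<in>I. bexp (all_edges n) p (\<lambda>E. f k (E \<inter> Q k)))"
      using Qsub disj finS by (intro bexp_prod_indep) (auto simp: I_def)
    also have "\<dots> = bexp (all_edges n) p (\<lambda>E. f None (E \<inter> Q None)) * (\<Prod>z\<in>S. bexp (all_edges n) p (\<lambda>E. f (Some z) (E \<inter> Q (Some z))))"
      by (rule prodI)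
    also have "bexp (all_edges n) p (\<lambda>E. f None (E \<inter> Q None)) = pr n p (\<lambda>E. {} \<subseteq> E \<and> (F0 \<sigma> \<union> F0 \<tau>) \<inter> E = {})"
      unfolding f_def Q_def option.case by (intro bexp_cong refl arg_cong[where f = of_bool]) auto
    also have "\<dots> = (1 - p) ^ card (F0 \<sigma> \<union> F0 \<tau>)"
      by (subst bexp_pattern) (auto simp: F0_def)
    also have "(\<Prod>z\<in>S. bexp (all_edges n) p (\<lambda>E. f (Some z) (E \<inter> Q (Some z)))) =
        (\<Prod>z\<in>S. pr n p (\<lambda>E. (x1 \<sigma> z \<in> E \<longleftrightarrow> x2 \<sigma> z \<in> E) \<and> (x1 \<tau> z \<in> E \<longleftrightarrow> x2 \<tau> z \<in> E)))"
      unfolding f_def Q_def by simp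
    finally show ?thesis .
  qed
  have xd: "x1 \<sigma> z \<noteq> x2 \<tau> z" if "\<sigma> \<in> configs m N" "\<tau> \<in> configs m N" "z \<in> S" for \<sigma> \<tau> z
  proof
    assume "x1 \<sigma> z = x2 \<tau> z"
    hence "{fst z, a + 2 * snd z} = {fst z, a + 2 * snd z + 1}" using cd1 that by metis
    thus False by (auto simp: doubleton_eq_iff)
  qed
  have blk: "x1 \<sigma> z = x1 \<tau> z \<Longrightarrow> x2 \<sigma> z = x2 \<tau> z \<Longrightarrow>
       pr n p (\<lambda>E. (x1 \<sigma> z \<in> E \<longleftrightarrow> x2 \<sigma> z \<in> E) \<and> (x1 \<tau> z \<in> E \<longleftrightarrow> x2 \<tau> z \<in> E)) = q"
      "pr n p (\<lambda>E. (x1 \<sigma> z \<in> E \<longleftrightarrow> x2 \<sigma> z \<in> E) \<and> (x1 \<tau> z \<in> E \<longleftrightarrow> x2 \<tau> z \<in> E)) \<le>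
        g ^ (4 - (of_bool (x1 \<sigma> z = x1 \<tau> z) + of_bool (x2 \<sigma> z = x2 \<tau> z)))"
    if "\<sigma> \<in> configs m N" "\<tau> \<in> configs m N" "z \<in> S" for \<sigma> \<tau> z
  proof -
    have c: "{x1 \<sigma> z, x2 \<sigma> z, x1 \<tau> z, x2 \<tau> z} \<subseteq> all_edges n" using xe that by auto
    have d: "x1 \<sigma> z \<noteq> x2 \<sigma> z" "x1 \<tau> z \<noteq> x2 \<tau> z" "x1 \<sigma> z \<noteq> x2 \<tau> z" "x2 \<sigma> z \<noteq> x1 \<tau> z"
      using xd that by metis+
    note * = bexp_pair_eq[OF finite_all_edges c d less_imp_le[OF p(1)] less_imp_le[OF p(2)] q_def]
    show "x1 \<sigma> z = x1 \<tau> z \<Longrightarrow> x2 \<sigma> z = x2 \<tau> z \<Longrightarrow>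
       pr n p (\<lambda>E. (x1 \<sigma> z \<in> E \<longleftrightarrow> x2 \<sigma> z \<in> E) \<and> (x1 \<tau> z \<in> E \<longleftrightarrow> x2 \<tau> z \<in> E)) = q" by (rule *(1))
    show "pr n p (\<lambda>E. (x1 \<sigma> z \<in> E \<longleftrightarrow> x2 \<sigma> z \<in> E) \<and> (x1 \<tau> z \<in> E \<longleftrightarrow> x2 \<tau> z \<in> E)) \<le>
        g ^ (4 - (of_bool (x1 \<sigma> z = x1 \<tau> z) + of_bool (x2 \<sigma> z = x2 \<tau> z)))" unfolding g_def by (rule *(2))
  qed
  define C0 where "C0 = (a choose 2) + (2 * b choose 2)"
  have V12: "V1 \<sigma> \<subseteq> {..<n}" "V2 \<sigma> \<subseteq> {..<n}" if "\<sigma> \<in> configs m N" for \<sigma>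
    using vn[OF that] by (auto simp: V1_def V2_def m_def)
  have cF0: "card (F0 \<sigma>) = C0" if \<sigma>: "\<sigma> \<in> configs m N" for \<sigma>
  proof -
    have "{e \<in> all_edges n. e \<subseteq> V1 \<sigma>} \<inter> {e \<in> all_edges n. e \<subseteq> V2 \<sigma>} = {}"
    proof (rule ccontr)
      assume "{e \<in> all_edges n. e \<subseteq> V1 \<sigma>} \<inter> {e \<in> all_edges n. e \<subseteq> V2 \<sigma>} \<noteq> {}"
      then obtain e where "e \<in> all_edges n" "e \<subseteq> V1 \<sigma>" "e \<subseteq> V2 \<sigma>" by auto
      moreover then obtain x where "x \<in> e" by (auto simp: all_edges_def)
      ultimately have x: "x \<in> V1 \<sigma>" "x \<in> V2 \<sigma>" by auto
      obtain s where s: "s < a" "x = block_vertex N \<sigma> s" using x(1) by (auto simp: V1_def)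
      obtain t where t: "a \<le> t" "t < m" "x = block_vertex N \<sigma> t" using x(2) by (auto simp: V2_def m_def)
      show False using veq[OF \<sigma> \<sigma>, of s t] s t by auto
    qed
    hence "card (F0 \<sigma>) = (card (V1 \<sigma>) choose 2) + (card (V2 \<sigma>) choose 2)"
      unfolding F0_def using card_pairs_in V12[OF \<sigma>] by (subst card_Un_disjoint) auto
    moreover have "card (V1 \<sigma>) = a"
      unfolding V1_def using veq[OF \<sigma> \<sigma>] by (subst card_image) (auto simp: inj_on_def m_def)
    moreover have "card (V2 \<sigma>) = 2 * b"
      unfolding V2_def using veq[OF \<sigma> \<sigma>] by (subst card_image) (auto simp: inj_on_def m_def)
    ultimately show ?thesis by (simp add: C0_def)
  qed
  have P0: "P0 = (1 - p) ^ C0 * q ^ (a * b)" by (simp add: P0_def C0_def q_def)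
  have \<sigma>': "\<sigma> \<in> configs m N" and \<tau>': "\<tau> \<in> configs m N" using \<sigma> \<tau> by (auto simp: m_def)
  show "pr n p (twin a b N \<sigma>) = P0"
  proof -
    have "pr n p (twin a b N \<sigma>) = pr n p (\<lambda>E. twin a b N \<sigma> E \<and> twin a b N \<sigma> E)" by simp
    also have "\<dots> = (1 - p) ^ C0 * (\<Prod>z\<in>S. q)"
      unfolding factor[OF \<sigma>' \<sigma>'] using cF0[OF \<sigma>'] blk(1)[OF \<sigma>' \<sigma>'] by simp
    finally show ?thesis by (simp add: P0 S_def card_cartesian_product)
  qed
  define J where "J = agree (a + 2 * b) \<sigma> \<tau>"
  define j where "j = card (J \<inter> {..<a})"
  define h where "h = card (J \<inter> {a..<a + 2 * b})"
  have inter: "card (F0 \<sigma> \<inter> F0 \<tau>) \<le> (j choose 2) + (h choose 2)"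
  proof -
    have v1: "V1 \<sigma> \<inter> V1 \<tau> = block_vertex N \<sigma> ` (J \<inter> {..<a})" "V2 \<sigma> \<inter> V2 \<tau> = block_vertex N \<sigma> ` (J \<inter> {a..<a + 2 * b})"
      unfolding V1_def V2_def J_def using veq[OF \<sigma>' \<tau>'] by (auto simp: m_def image_iff; metis)+
    have v2: "V1 \<sigma> \<inter> V2 \<tau> = {}" "V2 \<sigma> \<inter> V1 \<tau> = {}"
      unfolding V1_def V2_def using veq[OF \<sigma>' \<tau>'] by (auto simp: m_def)
    have ne: "e \<noteq> {}" if "e \<in> all_edges n" for e using that by (auto simp: all_edges_def)
    have "F0 \<sigma> \<inter> F0 \<tau> \<subseteq> {e \<in> all_edges n. e \<subseteq> V1 \<sigma> \<inter> V1 \<tau>} \<union> {e \<in> all_edges n. e \<subseteq> V2 \<sigma> \<inter> V2 \<tau>}"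
    proof
      fix e assume e: "e \<in> F0 \<sigma> \<inter> F0 \<tau>"
      hence "e \<in> all_edges n" by (auto simp: F0_def)
      moreover have "\<not> e \<subseteq> V1 \<sigma> \<inter> V2 \<tau>" "\<not> e \<subseteq> V2 \<sigma> \<inter> V1 \<tau>" unfolding v2 using ne[OF \<open>e \<in> all_edges n\<close>] by auto
      ultimately show "e \<in> {e \<in> all_edges n. e \<subseteq> V1 \<sigma> \<inter> V1 \<tau>} \<union> {e \<in> all_edges n. e \<subseteq> V2 \<sigma> \<inter> V2 \<tau>}"
        using e unfolding F0_def by auto
    qed
    hence "card (F0 \<sigma> \<inter> F0 \<tau>) \<le> card ({e \<in> all_edges n. e \<subseteq> V1 \<sigma> \<inter> V1 \<tau>} \<union> {e \<in> all_edges n. e \<subseteq> V2 \<sigma> \<inter> V2 \<tau>})"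
      by (intro card_mono) auto
    also have "\<dots> \<le> card {e \<in> all_edges n. e \<subseteq> V1 \<sigma> \<inter> V1 \<tau>} + card {e \<in> all_edges n. e \<subseteq> V2 \<sigma> \<inter> V2 \<tau>}" by (rule card_Un_le)
    also have "\<dots> = (card (V1 \<sigma> \<inter> V1 \<tau>) choose 2) + (card (V2 \<sigma> \<inter> V2 \<tau>) choose 2)"
      using V12[OF \<sigma>'] by (intro arg_cong2[where f = "(+)"] card_pairs_in) auto
    also have "card (V1 \<sigma> \<inter> V1 \<tau>) = j" unfolding v1 j_def using veq[OF \<sigma>' \<sigma>']
      by (intro card_image) (auto simp: inj_on_def m_def J_def)
    also have "card (V2 \<sigma> \<inter> V2 \<tau>) = h" unfolding v1 h_def using veq[OF \<sigma>' \<sigma>']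
      by (intro card_image) (auto simp: inj_on_def m_def J_def)
    finally show ?thesis .
  qed
  have edge_part: "(1 - p) ^ card (F0 \<sigma> \<union> F0 \<tau>) \<le> ((1 - p) ^ C0)\<^sup>2 / (1 - p) ^ ((j choose 2) + (h choose 2))"
  proof -
    have fin: "finite (F0 \<sigma>)" "finite (F0 \<tau>)" by (auto simp: F0_def)
    have "card (F0 \<sigma> \<union> F0 \<tau>) + card (F0 \<sigma> \<inter> F0 \<tau>) = 2 * C0"
      using card_Un_Int[OF fin] cF0[OF \<sigma>'] cF0[OF \<tau>'] by simp
    hence le: "2 * C0 \<le> card (F0 \<sigma> \<union> F0 \<tau>) + ((j choose 2) + (h choose 2))" using inter by linarith
    have "(1 - p) ^ card (F0 \<sigma> \<union> F0 \<tau>) * (1 - p) ^ ((j choose 2) + (h choose 2)) \<le> (1 - p) ^ (2 * C0)"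
      unfolding power_add[symmetric] using p le by (intro power_decreasing) auto
    also have "\<dots> = ((1 - p) ^ C0)\<^sup>2" by (simp add: power_mult[symmetric] mult.commute)
    finally show ?thesis using p by (simp add: pos_le_divide_eq)
  qed
  \<comment> \<open>The number of edges that the two configurations share in group \<open>z\<close>.
    It is a product, so the total is \<open>j * h\<close>.\<close>
  define H where "H z = (of_bool (fst z \<in> J) * (of_bool (a + 2 * snd z \<in> J) + of_bool (a + 2 * snd z + 1 \<in> J)) :: nat)" for z
  have sumH: "(\<Sum>z\<in>S. H z) = j * h"
  proof -
    have finJ: "finite J" by (simp add: J_def)
    have "j = (\<Sum>t<a. of_bool (t \<in> J))" unfolding j_def using finJ by (simp add: sum.If_cases of_bool_def Int_commute)
    moreover have "h = (\<Sum>c\<in>{a..<a + 2 * b}. of_bool (c \<in> J))" unfolding h_def by (simp add: sum.If_cases of_bool_def Int_commute)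
    hence "h = (\<Sum>i<b. of_bool (a + 2 * i \<in> J) + of_bool (a + 2 * i + 1 \<in> J))" unfolding sum_pairs_eq .
    ultimately have "j * h = (\<Sum>t<a. \<Sum>i<b. of_bool (t \<in> J) * (of_bool (a + 2 * i \<in> J) + of_bool (a + 2 * i + 1 \<in> J)))"
      by (simp only: sum_product)
    also have "\<dots> = (\<Sum>z\<in>S. H z)" unfolding S_def H_def sum.cartesian_product by (simp only: case_prod_beta')
    finally show ?thesis by simp
  qed
  have pair_part: "(\<Prod>z\<in>S. pr n p (\<lambda>E. (x1 \<sigma> z \<in> E \<longleftrightarrow> x2 \<sigma> z \<in> E) \<and> (x1 \<tau> z \<in> E \<longleftrightarrow> x2 \<tau> z \<in> E))) \<le> (q ^ (a * b))\<^sup>2 / g ^ (j * h)"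
  proof -
    have "(\<Prod>z\<in>S. pr n p (\<lambda>E. (x1 \<sigma> z \<in> E \<longleftrightarrow> x2 \<sigma> z \<in> E) \<and> (x1 \<tau> z \<in> E \<longleftrightarrow> x2 \<tau> z \<in> E))) \<le> (\<Prod>z\<in>S. g ^ 4 / g ^ H z)"
    proof (intro prod_mono conjI)
      fix z assume z: "z \<in> S"
      note zz = Sm[OF z]
      have dbl: "{block_vertex N \<sigma> f, block_vertex N \<sigma> c} = {block_vertex N \<tau> f, block_vertex N \<tau> c} \<longleftrightarrow> f \<in> J \<and> c \<in> J" if "f < m" "c < m" "f \<noteq> c" for f c
      proof -
        have "block_vertex N \<sigma> f \<noteq> block_vertex N \<tau> c" using veq[OF \<sigma>' \<tau>' that(1,2)] that(3) by simp
        thus ?thesis unfolding doubleton_eq_iff veq[OF \<sigma>' \<tau>' that(1,1)] veq[OF \<sigma>' \<tau>' that(2,2)]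
          using that by (simp add: J_def m_def)
      qed
      have e1: "x1 \<sigma> z = x1 \<tau> z \<longleftrightarrow> fst z \<in> J \<and> a + 2 * snd z \<in> J"
        unfolding x1_def using zz by (intro dbl) auto
      have e2: "x2 \<sigma> z = x2 \<tau> z \<longleftrightarrow> fst z \<in> J \<and> a + 2 * snd z + 1 \<in> J"
        unfolding x2_def using zz by (intro dbl) auto
      have Hz: "of_bool (x1 \<sigma> z = x1 \<tau> z) + of_bool (x2 \<sigma> z = x2 \<tau> z) = H z" unfolding e1 e2 H_def by auto
      have "H z \<le> 4" by (simp add: H_def of_bool_def)
      hence "g ^ (4 - H z) = g ^ 4 / g ^ H z" using g0 by (simp add: power_diff)
      thus "pr n p (\<lambda>E. (x1 \<sigma> z \<in> E \<longleftrightarrow> x2 \<sigma> z \<in> E) \<and> (x1 \<tau> z \<in> E \<longleftrightarrow> x2 \<tau> z \<in> E)) \<le> g ^ 4 / g ^ H z"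
        using blk(2)[OF \<sigma>' \<tau>' z] unfolding Hz by simp
    qed (use p in \<open>auto intro!: pr_nonneg\<close>)
    also have "\<dots> = (\<Prod>z\<in>S. g ^ 4) / g ^ (\<Sum>z\<in>S. H z)" by (simp add: prod_dividef power_sum)
    also have "(\<Prod>z\<in>S. g ^ 4) = (q ^ (a * b))\<^sup>2"
    proof -
      have "g ^ 4 = q\<^sup>2" unfolding g0(2)[symmetric] by simp
      thus ?thesis by (simp add: S_def card_cartesian_product power_mult[symmetric] mult.commute)
    qed
    finally show ?thesis unfolding sumH .
  qed
  have "pr n p (\<lambda>E. twin a b N \<sigma> E \<and> twin a b N \<tau> E) \<le>
      ((1 - p) ^ C0)\<^sup>2 / (1 - p) ^ ((j choose 2) + (h choose 2)) * ((q ^ (a * b))\<^sup>2 / g ^ (j * h))"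
    unfolding factor[OF \<sigma>' \<tau>'] using p g0 by (intro mult_mono edge_part pair_part prod_nonneg) (auto intro!: pr_nonneg)
  also have "\<dots> = P0\<^sup>2 * overlap_weight a b p J"
    unfolding P0 overlap_weight_def j_def h_def q_def[symmetric] g_def by (simp add: power_mult_distrib)
  finally show "pr n p (\<lambda>E. twin a b N \<sigma> E \<and> twin a b N \<tau> E) \<le> P0\<^sup>2 * overlap_weight a b p (agree (a + 2 * b) \<sigma> \<tau>)"
    unfolding J_def .
qed

text \<open>As positions use disjoint blocks, two configurations can share a vertex only at the same
  position. For a given agreement set \<open>J\<close> there are at most N^(m-|J|) second
  configurations with m = a + 2b, each of weight at most (N x)^|J|; summing over \<open>J\<close>
  gives N^m (1+x)^m.\<close>

lemma pr_no_twin_le: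
  assumes p: "0 < p" "p < 1" and n: "(a + 2 * b) * N \<le> n" and N: "1 \<le> N" and x: "0 \<le> x"
    and W: "\<And>J. J \<subseteq> {..<a + 2 * b} \<Longrightarrow> overlap_weight a b p J \<le> (real N * x) ^ card J"
  shows "pr n p (\<lambda>E. \<forall>\<sigma>\<in>configs (a + 2 * b) N. \<not> twin a b N \<sigma> E) \<le> (1 + x) ^ (a + 2 * b) - 1"
proof -
  define m where "m = a + 2 * b"
  define P0 where "P0 = (1 - p) ^ ((a choose 2) + (2 * b choose 2)) * (1 - 2 * p + 2 * p\<^sup>2) ^ (a * b)"
  define I where "I = configs m N"
  have P0: "0 < P0"
  proof -
    have "1 - 2 * p + 2 * p\<^sup>2 = p\<^sup>2 + (1 - p)\<^sup>2" by (simp add: power2_eq_square algebra_simps)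
    moreover have "0 < p\<^sup>2 + (1 - p)\<^sup>2" using p by (simp add: add_pos_pos)
    ultimately show ?thesis unfolding P0_def using p by simp
  qed
  have finI: "finite I" unfolding I_def configs_def by (intro finite_PiE) auto
  have cI: "real (card I) = real N ^ m" unfolding I_def configs_def by (simp add: card_PiE)
  have tw1: "pr n p (twin a b N \<sigma>) = P0" if "\<sigma> \<in> I" for \<sigma>
    unfolding P0_def using that n p by (intro pr_twin) (auto simp: I_def m_def)
  have tw2: "pr n p (\<lambda>E. twin a b N \<sigma> E \<and> twin a b N \<tau> E) \<le> P0\<^sup>2 * overlap_weight a b p (agree m \<sigma> \<tau>)"
    if "\<sigma> \<in> I" "\<tau> \<in> I" for \<sigma> \<tau>
    unfolding P0_def m_def using that n p by (intro pr_twin) (auto simp: I_def m_def)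
  have sumw: "(\<Sum>\<tau>\<in>I. overlap_weight a b p (agree m \<sigma> \<tau>)) \<le> real N ^ m * (1 + x) ^ m" if \<sigma>: "\<sigma> \<in> I" for \<sigma>
  proof -
    have "(\<Sum>\<tau>\<in>I. overlap_weight a b p (agree m \<sigma> \<tau>)) =
       (\<Sum>J\<in>Pow {..<m}. \<Sum>\<tau>\<in>{\<tau>. \<tau> \<in> I \<and> agree m \<sigma> \<tau> = J}. overlap_weight a b p (agree m \<sigma> \<tau>))"
      using finI by (intro sum.group[symmetric]) auto
    also have "\<dots> \<le> (\<Sum>J\<in>Pow {..<m}. real N ^ m * x ^ card J)"
    proof (intro sum_mono)
      fix J assume J: "J \<in> Pow {..<m}"
      have finJ: "finite J" using J finite_subset by auto
      have cJ: "card J \<le> m" using card_mono[of "{..<m}" J] J by simp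
      have "{\<tau>. \<tau> \<in> I \<and> agree m \<sigma> \<tau> = J} \<subseteq> PiE {..<m} (\<lambda>t. if t \<in> J then {\<sigma> t} else {..<N})"
      proof
        fix \<tau> assume "\<tau> \<in> {\<tau>. \<tau> \<in> I \<and> agree m \<sigma> \<tau> = J}"
        hence \<tau>: "\<tau> \<in> PiE {..<m} (\<lambda>_. {..<N})" "agree m \<sigma> \<tau> = J" by (auto simp: I_def configs_def)
        show "\<tau> \<in> PiE {..<m} (\<lambda>t. if t \<in> J then {\<sigma> t} else {..<N})"
        proof (rule PiE_I)
          fix t assume "t \<in> {..<m}"
          thus "\<tau> t \<in> (if t \<in> J then {\<sigma> t} else {..<N})" using \<tau>(2) PiE_mem[OF \<tau>(1)] by auto
        next
          fix t assume "t \<notin> {..<m}"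
          thus "\<tau> t = undefined" by (rule PiE_arb[OF \<tau>(1)])
        qed
      qed
      hence "card {\<tau>. \<tau> \<in> I \<and> agree m \<sigma> \<tau> = J} \<le> card (PiE {..<m} (\<lambda>t. if t \<in> J then {\<sigma> t} else {..<N}))"
        by (intro card_mono finite_PiE) auto
      also have "\<dots> = (\<Prod>t\<in>{..<m}. if t \<in> J then 1 else N)" by (subst card_PiE) (auto intro!: prod.cong)
      also have "\<dots> = N ^ (m - card J)"
      proof -
        have "{..<m} \<inter> J = J" "{..<m} \<inter> - J = {..<m} - J" using J by auto
        thus ?thesis using finJ J by (subst prod.If_cases) (auto simp: card_Diff_subset)
      qed
      finally have cc: "real (card {\<tau>. \<tau> \<in> I \<and> agree m \<sigma> \<tau> = J}) \<le> real N ^ (m - card J)"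
        unfolding of_nat_power[symmetric] by (rule of_nat_mono)
      have "(\<Sum>\<tau>\<in>{\<tau>. \<tau> \<in> I \<and> agree m \<sigma> \<tau> = J}. overlap_weight a b p (agree m \<sigma> \<tau>)) =
          real (card {\<tau>. \<tau> \<in> I \<and> agree m \<sigma> \<tau> = J}) * overlap_weight a b p J" by simp
      also have "\<dots> \<le> real N ^ (m - card J) * (real N * x) ^ card J"
        using W[of J] J cc overlap_weight_nonneg p by (intro mult_mono) (auto simp: m_def)
      also have "\<dots> = real N ^ (m - card J + card J) * x ^ card J" by (simp add: power_mult_distrib power_add)
      also have "\<dots> = real N ^ m * x ^ card J" using cJ by simp
      finally show "(\<Sum>\<tau>\<in>{\<tau>. \<tau> \<in> I \<and> agree m \<sigma> \<tau> = J}. overlap_weight a b p (agree m \<sigma> \<tau>)) \<le> real N ^ m * x ^ card J" .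
    qed
    also have "\<dots> = real N ^ m * (\<Sum>J\<in>Pow {..<m}. x ^ card J)" by (simp add: sum_distrib_left)
    also have "(\<Sum>J\<in>Pow {..<m}. x ^ card J) = (\<Sum>k\<le>m. real (m choose k) * x ^ k)"
      using sum_Pow_card[of "{..<m}" "\<lambda>k. x ^ k"] by simp
    also have "\<dots> = (1 + x) ^ m" by (subst add.commute) (simp add: binomial_ring)
    finally show ?thesis .
  qed
  have expected_indep: "real N ^ m * P0 = (\<Sum>\<sigma>\<in>I. pr n p (twin a b N \<sigma>))" using tw1 cI by simp
  have pos: "0 < real N ^ m * P0" using P0 N by simp
  have "pr n p (\<lambda>E. \<forall>\<sigma>\<in>I. \<not> twin a b N \<sigma> E) \<le>
     (\<Sum>\<sigma>\<in>I. \<Sum>\<tau>\<in>I. pr n p (\<lambda>E. twin a b N \<sigma> E \<and> twin a b N \<tau> E)) / (real N ^ m * P0)\<^sup>2 - 1"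
    using p finI pos by (intro second_moment_none expected_indep) auto
  also have "\<dots> \<le> (\<Sum>\<sigma>\<in>I. P0\<^sup>2 * (real N ^ m * (1 + x) ^ m)) / (real N ^ m * P0)\<^sup>2 - 1"
  proof (intro diff_right_mono divide_right_mono sum_mono)
    fix \<sigma> assume \<sigma>: "\<sigma> \<in> I"
    have "(\<Sum>\<tau>\<in>I. pr n p (\<lambda>E. twin a b N \<sigma> E \<and> twin a b N \<tau> E)) \<le> (\<Sum>\<tau>\<in>I. P0\<^sup>2 * overlap_weight a b p (agree m \<sigma> \<tau>))"
      using tw2[OF \<sigma>] by (intro sum_mono)
    also have "\<dots> = P0\<^sup>2 * (\<Sum>\<tau>\<in>I. overlap_weight a b p (agree m \<sigma> \<tau>))" by (simp add: sum_distrib_left)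
    also have "\<dots> \<le> P0\<^sup>2 * (real N ^ m * (1 + x) ^ m)" using sumw[OF \<sigma>] by (intro mult_left_mono) auto
    finally show "(\<Sum>\<tau>\<in>I. pr n p (\<lambda>E. twin a b N \<sigma> E \<and> twin a b N \<tau> E)) \<le> P0\<^sup>2 * (real N ^ m * (1 + x) ^ m)" .
  qed auto
  also have "\<dots> = (1 + x) ^ m - 1"
  proof -
    have eq: "(\<Sum>\<sigma>\<in>I. P0\<^sup>2 * (real N ^ m * (1 + x) ^ m)) = (real N ^ m * P0)\<^sup>2 * (1 + x) ^ m"
      by (simp add: cI power2_eq_square)
    show ?thesis unfolding eq using P0 N by simp
  qed
  finally show ?thesis by (simp add: I_def m_def)
qed

text \<open>\<open>x\<close> and \<open>z\<close> are the overlaps in the two parts in units of ln n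
  / (- ln (1-p)). The difference of the sides is convex in \<open>x\<close>, so x = 0 and x = 2 -
  \<eta> suffice. At the latter the main terms are -\<eta> + (1/2 - 2\<kappa>) z, and for \<kappa>
  <= 1/4 the bound on \<open>z\<close> makes them at most -3 \<kappa> \<eta>; the choices of \<eta>
  and \<delta> keep all corrections below this.\<close>

lemma overlap_quadratic_le:
  fixes x z \<kappa> \<eta> \<delta> :: real
  assumes k: "0 < \<kappa>" "\<kappa> < 3/4" and e: "\<eta> = \<kappa> / 40" "\<delta> = \<kappa> * \<eta> / 3"
    and x: "0 \<le> x" "x \<le> 2 - \<eta>" and z: "0 \<le> z" "z \<le> 2 * \<eta> * (1 + \<kappa>)"
  shows "x\<^sup>2 / 2 + z\<^sup>2 / 2 + (3/4 - \<kappa>) * x * z \<le> (1 - \<delta>) * (x + z)"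
proof -
  define X where "X = 2 - \<eta>"
  define f where "f x = x\<^sup>2 / 2 + z\<^sup>2 / 2 + (3/4 - \<kappa>) * x * z - (1 - \<delta>) * (x + z)" for x
  have eta: "0 < \<eta>" "\<eta> \<le> 1/50" using k e by auto
  have del: "0 < \<delta>" "\<delta> \<le> 1/100"
  proof -
    show "0 < \<delta>" using k eta by (simp add: e(2))
    have "\<kappa> * \<eta> \<le> 1 * (1/50)" using k eta by (intro mult_mono) auto
    thus "\<delta> \<le> 1/100" by (simp add: e(2))
  qed
  have z1: "z \<le> 1/10"
  proof -
    have "2 * \<eta> * (1 + \<kappa>) \<le> 2 * (1/50) * 2" using k eta by (intro mult_mono) auto
    thus ?thesis using z by linarith
  qed
  have f0: "f 0 \<le> 0"
  proof -
    have "f 0 = z * (z / 2 - (1 - \<delta>))" by (simp add: f_def power2_eq_square algebra_simps)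
    moreover have "z / 2 - (1 - \<delta>) \<le> 0" using z1 del by linarith
    ultimately show ?thesis using z by (simp add: mult_nonneg_nonpos)
  qed
  have z2: "z\<^sup>2 / 2 \<le> 7 * \<eta>\<^sup>2"
  proof -
    have "z\<^sup>2 \<le> (2 * \<eta> * (1 + \<kappa>))\<^sup>2" using z by (intro power_mono) auto
    also have "\<dots> = \<eta>\<^sup>2 * (4 * (1 + \<kappa>)\<^sup>2)" by (simp add: power2_eq_square algebra_simps)
    also have "\<dots> \<le> \<eta>\<^sup>2 * 14"
    proof (intro mult_left_mono)
      have "(1 + \<kappa>)\<^sup>2 \<le> (7/4)\<^sup>2" using k by (intro power_mono) auto
      thus "4 * (1 + \<kappa>)\<^sup>2 \<le> 14" by (simp add: power2_eq_square)
    qed simp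
    finally show ?thesis by simp
  qed
  have fX: "f X \<le> 0"
  proof -
    have "(3/4 - \<kappa>) * X * z \<le> (3/4 - \<kappa>) * 2 * z"
      using k eta z by (intro mult_right_mono mult_left_mono) (auto simp: X_def)
    moreover have "\<delta> * (X + z) \<le> \<delta> * 3" using del eta z1 by (intro mult_left_mono) (auto simp: X_def)
    moreover have "X\<^sup>2 / 2 - X = - \<eta> + \<eta>\<^sup>2 / 2" by (simp add: X_def power2_eq_square field_simps)
    moreover have "f X = (X\<^sup>2 / 2 - X) + z\<^sup>2 / 2 + ((3/4 - \<kappa>) * X * z - z) + \<delta> * (X + z)"
      by (simp add: f_def algebra_simps)
    moreover have "(3/4 - \<kappa>) * 2 * z = (1/2 - 2 * \<kappa>) * z + z" by (simp add: algebra_simps)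
    moreover have "\<delta> * 3 = \<kappa> * \<eta>" by (simp add: e(2))
    ultimately have up: "f X \<le> - \<eta> + \<eta>\<^sup>2 / 2 + 7 * \<eta>\<^sup>2 + (1/2 - 2 * \<kappa>) * z + \<kappa> * \<eta>"
      using z2 by linarith
    have eta2: "\<eta>\<^sup>2 = \<eta> * \<eta>" "0 \<le> \<eta> * \<eta>" by (simp_all add: power2_eq_square)
    show ?thesis
    \<comment> \<open>Here the coefficient 1/2 - 2\<kappa> of \<open>z\<close> changes sign. When it
      is negative, its term is bounded by 0.\<close>
    proof (cases "\<kappa> \<le> 1/4")
      case True
      have "(1/2 - 2 * \<kappa>) * z \<le> (1/2 - 2 * \<kappa>) * (2 * \<eta> * (1 + \<kappa>))" using True z by (intro mult_left_mono) auto
      also have "\<dots> = \<eta> * (1 - 3 * \<kappa>) - 4 * \<eta> * \<kappa>\<^sup>2" by (simp add: power2_eq_square algebra_simps)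
      also have "\<dots> \<le> \<eta> * (1 - 3 * \<kappa>)" using eta by simp
      also have "\<dots> = \<eta> - 3 * (\<kappa> * \<eta>)" by (simp add: algebra_simps)
      finally have "f X \<le> 8 * (\<eta> * \<eta>) - 2 * (\<kappa> * \<eta>)" using up eta2 by linarith
      also have "\<dots> = \<eta> * (8 * \<eta> - 2 * \<kappa>)" by (simp add: algebra_simps)
      also have "\<dots> \<le> 0" using eta e k by (intro mult_nonneg_nonpos) auto
      finally show ?thesis .
    next
      case False
      have "(1/2 - 2 * \<kappa>) * z \<le> 0" using False z by (intro mult_nonpos_nonneg) auto
      hence "f X \<le> 8 * (\<eta> * \<eta>) - \<eta> + \<kappa> * \<eta>" using up eta2 by linarith
      also have "\<dots> = \<eta> * (8 * \<eta> - 1 + \<kappa>)" by (simp add: algebra_simps)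
      also have "\<dots> \<le> 0" using eta k by (intro mult_nonneg_nonpos) auto
      finally show ?thesis .
    qed
  qed
  \<comment> \<open>Convexity written out, with x as a convex combination of 0 and
    \<open>X\<close>.\<close>
  define \<theta> where "\<theta> = x / X"
  have X0: "0 < X" using eta by (simp add: X_def)
  have t: "0 \<le> \<theta>" "\<theta> \<le> 1" "x = \<theta> * X" using x X0 by (auto simp: \<theta>_def X_def)
  have "f x = \<theta> * f X + (1 - \<theta>) * f 0 - \<theta> * (1 - \<theta>) * X\<^sup>2 / 2"
    unfolding t(3) f_def by (simp add: power2_eq_square field_simps)
  also have "\<dots> \<le> \<theta> * f X + (1 - \<theta>) * f 0" using t by simp
  also have "\<dots> \<le> 0" using t f0 fX by (intro add_nonpos_nonpos mult_nonneg_nonpos) auto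
  finally show ?thesis by (simp add: f_def)
qed

text \<open>In units of \<open>L\<close> the logarithm of the weight is bounded by the quadratic
  form of \<open>overlap_quadratic_le\<close>. Half of the slack \<delta> covers the ratio between
  \<open>N\<close> and \<open>n\<close>; the other half remains as n^(-\<delta>/2).\<close>

lemma overlap_weight_le:
  fixes a b N n :: nat
  assumes p: "0 < p" "p < 1" and l: "l = - ln (1 - p)" and k: "0 < \<kappa>" "\<kappa> < 3/4"
    and q: "ln (sqrt (1 - 2 * p + 2 * p\<^sup>2)) = - ((3/4 - \<kappa>) * l)"
    and e: "\<eta> = \<kappa> / 40" "\<delta> = \<kappa> * \<eta> / 3"
    and L: "L = ln (real n) / l" "0 < L"
    and ab: "real a \<le> (2 - \<eta>) * L" "real b \<le> \<eta> * (1 + \<kappa>) * L"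
    and N: "1 \<le> N" "(1 - \<delta> / 2) * ln (real n) \<le> ln (real N)" and n: "1 < n"
    and J: "J \<subseteq> {..<a + 2 * b}"
  shows "overlap_weight a b p J \<le> (real N * real n powr (- (\<delta> / 2))) ^ card J"
proof -
  define j where "j = card (J \<inter> {..<a})"
  define h where "h = card (J \<inter> {a..<a + 2 * b})"
  have l0: "0 < l" using p by (simp add: l)
  have ja: "real j \<le> real a" "real h \<le> real (2 * b)"
    using card_mono[of "{..<a}" "J \<inter> {..<a}"] card_mono[of "{a..<a + 2 * b}" "J \<inter> {a..<a + 2 * b}"]
    by (auto simp: j_def h_def)
  have finJ: "finite J" using J finite_subset by auto
  have cJ: "card J = j + h"
  proof -
    have "J = (J \<inter> {..<a}) \<union> (J \<inter> {a..<a + 2 * b})" using J by auto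
    hence "card J = card ((J \<inter> {..<a}) \<union> (J \<inter> {a..<a + 2 * b}))" by simp
    also have "\<dots> = j + h" unfolding j_def h_def using finJ by (intro card_Un_disjoint) auto
    finally show ?thesis .
  qed
  define x where "x = real j / L"
  define z where "z = real h / L"
  have xj: "real j = x * L" "real h = z * L" using L by (auto simp: x_def z_def)
  have Q: "x\<^sup>2 / 2 + z\<^sup>2 / 2 + (3/4 - \<kappa>) * x * z \<le> (1 - \<delta>) * (x + z)"
  proof (rule overlap_quadratic_le[OF k e])
    show "x \<le> 2 - \<eta>" unfolding x_def using ab(1) ja(1) L(2) by (simp add: pos_divide_le_eq)
    have "real h \<le> 2 * \<eta> * (1 + \<kappa>) * L" using ab(2) ja(2) by simp
    thus "z \<le> 2 * \<eta> * (1 + \<kappa>)" unfolding z_def using L(2) by (simp add: pos_divide_le_eq)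
  qed (use L(2) in \<open>auto simp: x_def z_def\<close>)
  have q0: "0 < sqrt (1 - 2 * p + 2 * p\<^sup>2)"
  proof -
    have "1 - 2 * p + 2 * p\<^sup>2 = p\<^sup>2 + (1 - p)\<^sup>2" by (simp add: power2_eq_square algebra_simps)
    moreover have "0 < p\<^sup>2 + (1 - p)\<^sup>2" using p by (simp add: add_pos_pos)
    ultimately show ?thesis by simp
  qed
  have ch: "real (i choose 2) \<le> (real i)\<^sup>2 / 2" for i
  proof -
    have "2 * (i choose 2) \<le> i * i" unfolding two_times_choose_two by simp
    hence "real (2 * (i choose 2)) \<le> real (i * i)" by (rule of_nat_mono)
    thus ?thesis by (simp add: power2_eq_square)
  qed
  have "overlap_weight a b p J = exp (l * real ((j choose 2) + (h choose 2)) + (3/4 - \<kappa>) * l * (real j * real h))"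
  proof -
    have e1: "(1 - p) ^ ((j choose 2) + (h choose 2)) = exp (- l * real ((j choose 2) + (h choose 2)))"
      using p by (simp add: l powr_realpow[symmetric] powr_def mult.commute)
    have e2: "sqrt (1 - 2 * p + 2 * p\<^sup>2) ^ (j * h) = exp (- ((3/4 - \<kappa>) * l * (real j * real h)))"
    proof -
      have "sqrt (1 - 2 * p + 2 * p\<^sup>2) ^ (j * h) = exp (real (j * h) * ln (sqrt (1 - 2 * p + 2 * p\<^sup>2)))"
        using q0 by (simp only: exp_of_nat_mult exp_ln)
      thus ?thesis unfolding q by simp
    qed
    have "1 / exp u = exp (- u)" for u :: real by (simp add: exp_minus inverse_eq_divide)
    thus ?thesis unfolding overlap_weight_def j_def[symmetric] h_def[symmetric] e1 e2 exp_add[symmetric] by simp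
  qed
  also have "\<dots> \<le> exp ((real j + real h) * (ln (real N) - \<delta> / 2 * ln (real n)))"
  proof (subst exp_le_cancel_iff)
    have "l * real ((j choose 2) + (h choose 2)) \<le> l * ((real j)\<^sup>2 / 2 + (real h)\<^sup>2 / 2)"
      using l0 ch[of j] ch[of h] by (intro mult_left_mono) auto
    hence "l * real ((j choose 2) + (h choose 2)) + (3/4 - \<kappa>) * l * (real j * real h) \<le>
        l * L\<^sup>2 * (x\<^sup>2 / 2 + z\<^sup>2 / 2 + (3/4 - \<kappa>) * x * z)"
      unfolding xj by (simp add: power2_eq_square algebra_simps)
    also have "\<dots> \<le> l * L\<^sup>2 * ((1 - \<delta>) * (x + z))" using Q l0 by (intro mult_left_mono) auto
    also have "\<dots> = (real j + real h) * ((1 - \<delta>) * (l * L))" unfolding xj by (simp add: power2_eq_square algebra_simps)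
    also have "l * L = ln (real n)" using l0 by (simp add: L(1))
    also have "(real j + real h) * ((1 - \<delta>) * ln (real n)) \<le> (real j + real h) * (ln (real N) - \<delta> / 2 * ln (real n))"
      using N(2) by (intro mult_left_mono) (auto simp: algebra_simps)
    finally show "l * real ((j choose 2) + (h choose 2)) + (3/4 - \<kappa>) * l * (real j * real h) \<le>
        (real j + real h) * (ln (real N) - \<delta> / 2 * ln (real n))" .
  qed
  also have "\<dots> = exp (ln (real N) - \<delta> / 2 * ln (real n)) ^ card J"
    unfolding cJ by (simp add: exp_of_nat_mult[symmetric])
  also have "exp (ln (real N) - \<delta> / 2 * ln (real n)) = real N * real n powr (- (\<delta> / 2))"
  proof -
    have "real n powr (- (\<delta> / 2)) = exp (- (\<delta> / 2 * ln (real n)))" using n by (simp add: powr_def)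
    moreover have "exp (ln (real N) - \<delta> / 2 * ln (real n)) = exp (ln (real N)) * exp (- (\<delta> / 2 * ln (real n)))"
      unfolding exp_add[symmetric] by simp
    moreover have "exp (ln (real N)) = real N" using N(1) by simp
    ultimately show ?thesis by (simp only:)
  qed
  finally show ?thesis .
qed

text \<open>First moment: the expected number is at most (n (1-p)^((r-1)/2))^r. The 2 added to 2 ln
  n / l brings the base down to at most exp(-l/2), and the power r >= 2 ln n / l then gives
  1/n.\<close>

lemma pr_alpha_large_le:
  assumes p: "0 < p" "p < 1" and l: "l = - ln (1 - p)" and n: "1 < n" and r: "2 * (ln (real n) / l) + 2 \<le> real r"
  shows "pr n p (\<lambda>E. r \<le> alpha n E) \<le> 1 / real n"
proof -
  have l0: "0 < l" using p by (simp add: l)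
  have lnn: "0 < ln (real n)" using n by simp
  have "pr n p (\<lambda>E. r \<le> alpha n E) \<le> expected_indep n p r" using p by (intro pr_alpha_ge_le) auto
  also have "\<dots> \<le> real n ^ r * (1 - p) ^ (r choose 2)"
    unfolding expected_indep_def using p by (intro mult_right_mono choose_le_power) auto
  also have "\<dots> = exp (real r * ln (real n)) * exp (- l * real (r choose 2))"
  proof -
    have "real n ^ r = exp (real r * ln (real n))" using n by (simp add: exp_of_nat_mult)
    moreover have "(1 - p) ^ (r choose 2) = exp (- l * real (r choose 2))"
      using p by (simp add: l powr_realpow[symmetric] powr_def mult.commute)
    ultimately show ?thesis by simp
  qed
  also have "\<dots> = exp (real r * (ln (real n) - l * (real r - 1) / 2))"
  proof -
    have r1: "1 \<le> r"
    proof -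
      have "0 < 2 * (ln (real n) / l) + 2" using l0 lnn by (intro add_pos_pos mult_pos_pos divide_pos_pos) auto
      hence "0 < real r" using r by linarith
      thus ?thesis by simp
    qed
    have "real (2 * (r choose 2)) = real r * (real r - 1)" unfolding two_times_choose_two using r1 by (simp add: of_nat_diff)
    hence c: "real (r choose 2) = real r * (real r - 1) / 2" by simp
    show ?thesis unfolding c exp_add[symmetric] by (rule arg_cong[where f = exp]) (simp add: field_simps)
  qed
  also have "\<dots> \<le> exp (- ln (real n))"
  proof (subst exp_le_cancel_iff)
    have "2 * (ln (real n) / l) * l = 2 * ln (real n)" using l0 by simp
    moreover have "(2 * (ln (real n) / l) + 1) * l \<le> (real r - 1) * l" using r l0 by (intro mult_right_mono) auto
    ultimately have "2 * ln (real n) + l \<le> l * (real r - 1)" by (simp add: algebra_simps)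
    hence "ln (real n) - l * (real r - 1) / 2 \<le> - (l / 2)" by simp
    hence "real r * (ln (real n) - l * (real r - 1) / 2) \<le> real r * (- (l / 2))" by (intro mult_left_mono) auto
    also have "\<dots> \<le> (2 * (ln (real n) / l)) * (- (l / 2))" using r l0 by (intro mult_right_mono_neg) auto
    also have "\<dots> = - ln (real n)" using l0 by simp
    finally show "real r * (ln (real n) - l * (real r - 1) / 2) \<le> - ln (real n)" .
  qed
  also have "\<dots> = 1 / real n" using n by (simp add: exp_minus divide_inverse)
  finally show ?thesis .
qed

lemma whp_bp_upper:
  assumes p: "p0 < p" "p < 1/2"
  shows "\<exists>c>0. whp (\<lambda>_. p) (\<lambda>n E. real (bp n E) \<le> real n - (1 + c) * real (alpha n E))"
proof -
  have p01: "0 < p" "p < 1" using p p0_bounds by linarith+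
  define l where "l = - ln (1 - p)"
  have l0: "0 < l" using p01 by (simp add: l_def)
  define q where "q = 1 - 2 * p + 2 * p\<^sup>2"
  have q: "0 < q" "q < 1"
  proof -
    have "q = p\<^sup>2 + (1 - p)\<^sup>2" unfolding q_def by (simp add: power2_eq_square algebra_simps)
    thus "0 < q" using p01 by (simp add: add_pos_pos)
    have "q = 1 - 2 * (p * (1 - p))" unfolding q_def by (simp add: power2_eq_square algebra_simps)
    moreover have "0 < p * (1 - p)" using p01 by simp
    ultimately show "q < 1" by linarith
  qed
  \<comment> \<open>Distance from the threshold: - ln q = 2 (3/4 - \<kappa>) l, and \<kappa> > 0
    says that (1-p)^3 < q^2, which \<open>p0_quartic\<close> provides above
    \<open>p0\<close>.\<close>
  define \<kappa> where "\<kappa> = 3/4 - (- ln q / 2) / l"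
  have k: "0 < \<kappa>" "\<kappa> < 3/4"
  proof -
    have "0 < 4 * p ^ 3 - 7 * p\<^sup>2 + 5 * p - 1" using p0_cubic_mono[OF p(1)] p0_root by simp
    hence "0 < p * (4 * p ^ 3 - 7 * p\<^sup>2 + 5 * p - 1)" using p01 by simp
    hence "(1 - p) ^ 3 < q\<^sup>2" unfolding q_def p0_quartic[symmetric] by simp
    hence "ln ((1 - p) ^ 3) < ln (q\<^sup>2)" using p01 q by (intro ln_less_cancel_iff[THEN iffD2]) auto
    hence "3 * ln (1 - p) < 2 * ln q" using p01 q by (simp add: ln_realpow)
    hence "- ln q / 2 < 3/4 * l" by (simp add: l_def)
    hence "(- ln q / 2) / l < 3/4" using l0 by (subst pos_divide_less_eq) auto
    thus "0 < \<kappa>" unfolding \<kappa>_def by linarith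
    have "0 < - ln q / 2 / l" using q l0 by (intro divide_pos_pos) auto
    thus "\<kappa> < 3/4" by (simp add: \<kappa>_def)
  qed
  have lq: "ln (sqrt (1 - 2 * p + 2 * p\<^sup>2)) = - ((3/4 - \<kappa>) * l)"
    unfolding q_def[symmetric] using q l0 by (simp add: ln_sqrt \<kappa>_def)
  define \<eta> where "\<eta> = \<kappa> / 40"
  define \<delta> where "\<delta> = \<kappa> * \<eta> / 3"
  have eta: "0 < \<eta>" "\<eta> < 1/50" using k by (auto simp: \<eta>_def)
  have del: "0 < \<delta>" "\<delta> < 1"
  proof -
    show "0 < \<delta>" using k eta by (simp add: \<delta>_def)
    have "\<kappa> * \<eta> \<le> 1 * 1" using k eta by (intro mult_mono) auto
    thus "\<delta> < 1" by (simp add: \<delta>_def)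
  qed
  \<comment> \<open>a + b is about (2 + \<eta> \<kappa>) L, while \<open>alpha\<close> is at most 2
    L + 3. Half of the surplus \<eta> \<kappa> goes into c, the rest absorbs constants and
    rounding.\<close>
  define c where "c = \<eta> * \<kappa> / 4"
  have c: "0 < c" using eta k by (simp add: c_def)
  define L where "L n = ln (real n) / l" for n
  \<comment> \<open>Gives up \<eta> L vertices of an independent set of size about 2 L and buys
    \<eta> (1 + \<kappa>) L pairs, each of which saves one biclique.\<close>
  define a where "a n = nat \<lfloor>(2 - \<eta>) * L n\<rfloor>" for n
  define b where "b n = nat \<lfloor>\<eta> * (1 + \<kappa>) * L n\<rfloor>" for n
  \<comment> \<open>Splitting the vertices into blocks costs only a logarithmic factor:
    \<open>N\<close> stays above n^(1 - \<delta>/2).\<close>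
  define N where "N n = n div (a n + 2 * b n)" for n
  define r where "r n = nat \<lceil>2 * L n + 2\<rceil>" for n
  let ?f = "\<lambda>n. (exp (3 * (ln (real n) / l) * real n powr (- (\<delta> / 2))) - 1) + 1 / real n"
  have e1: "\<forall>\<^sub>F n in sequentially. (1 + c) * (2 * (ln (real n) / l) + 3) \<le> (2 + \<eta> * \<kappa>) * (ln (real n) / l) - 2"
  proof -
    have "\<forall>\<^sub>F n in sequentially. 2 + 3 * (1 + c) \<le> \<eta> * \<kappa> / 2 * (ln (real n) / l)"
      using eta k l0 by real_asymp
    thus ?thesis by (rule eventually_mono) (simp add: c_def algebra_simps)
  qed
  have e2: "\<forall>\<^sub>F n in sequentially. real n powr (1 - \<delta> / 2) \<le> real n / (3 * (ln (real n) / l)) - 1"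
    using l0 del by real_asymp
  have e3: "\<forall>\<^sub>F n in sequentially. 2 \<le> ln (real n) / l" using l0 by real_asymp
  have "whp (\<lambda>_. p) (\<lambda>n E. real (bp n E) \<le> real n - (1 + c) * real (alpha n E))"
  proof (rule whpI)
    show "?f \<longlonglongrightarrow> 0" using l0 del by real_asymp
    show "\<forall>\<^sub>F n in sequentially. 0 \<le> p \<and> p \<le> 1" using p01 by simp
    show "\<forall>\<^sub>F n in sequentially. pr n p (\<lambda>E. \<not> real (bp n E) \<le> real n - (1 + c) * real (alpha n E)) \<le> ?f n"
      using e1 e2 e3 eventually_ge_at_top[of 2]
    proof eventually_elim
      case (elim n)
      have n: "1 < n" "2 \<le> real n" using elim by auto
      have L2: "2 \<le> L n" using elim by (simp add: L_def)
      have a1: "real (a n) \<le> (2 - \<eta>) * L n" "(2 - \<eta>) * L n - 1 \<le> real (a n)"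
      proof -
        have "0 \<le> (2 - \<eta>) * L n" using L2 eta by (intro mult_nonneg_nonneg) auto
        thus "real (a n) \<le> (2 - \<eta>) * L n" "(2 - \<eta>) * L n - 1 \<le> real (a n)" unfolding a_def by linarith+
      qed
      have b1: "real (b n) \<le> \<eta> * (1 + \<kappa>) * L n" "\<eta> * (1 + \<kappa>) * L n - 1 \<le> real (b n)"
      proof -
        have "0 \<le> \<eta> * (1 + \<kappa>) * L n" using L2 eta k by (intro mult_nonneg_nonneg) auto
        thus "real (b n) \<le> \<eta> * (1 + \<kappa>) * L n" "\<eta> * (1 + \<kappa>) * L n - 1 \<le> real (b n)" unfolding b_def by linarith+
      qed
      define m where "m = a n + 2 * b n"
      have m3: "real m \<le> 3 * L n"
      proof -
        have "\<eta> * (1 + \<kappa>) * L n \<le> 1/50 * 2 * L n" using eta k L2 by (intro mult_right_mono mult_mono) auto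
        moreover have "(2 - \<eta>) * L n \<le> 2 * L n" using eta L2 by (intro mult_right_mono) auto
        moreover have "real m = real (a n) + 2 * real (b n)" by (simp add: m_def)
        ultimately show ?thesis using a1(1) b1(1) L2 by linarith
      qed
      have m1: "1 \<le> m"
      proof -
        have "L n \<le> (2 - \<eta>) * L n" using mult_right_mono[of 1 "2 - \<eta>" "L n"] eta L2 by simp
        hence "1 \<le> real (a n)" using a1(2) L2 by linarith
        thus ?thesis by (simp add: m_def)
      qed
      have mN: "m * N n \<le> n" unfolding N_def m_def by (simp add: mult.commute)
      have Nbig: "real n powr (1 - \<delta> / 2) \<le> real (N n)"
      proof -
        have "real n powr (1 - \<delta> / 2) \<le> real n / (3 * L n) - 1" using elim by (simp add: L_def)
        also have "\<dots> \<le> real n / real m - 1"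
          using m3 m1 n L2 by (intro diff_right_mono divide_left_mono) auto
        also have "\<dots> \<le> real (N n)"
        proof -
          have "n < Suc (n div m) * m" using m1 by (simp add: dividend_less_div_times)
          hence "real n < real (Suc (n div m) * m)" by (rule of_nat_less_iff[THEN iffD2])
          hence "real n < (real (n div m) + 1) * real m" by (simp add: algebra_simps)
          hence "real n / real m < real (n div m) + 1" using m1 by (simp add: pos_divide_less_eq)
          thus ?thesis by (simp add: N_def m_def)
        qed
        finally show ?thesis .
      qed
      have Npos: "0 < real n powr (1 - \<delta> / 2)" using n by simp
      have N1: "1 \<le> N n"
      proof -
        have "0 < real (N n)" using Nbig Npos by linarith
        thus ?thesis by simp
      qed
      have lnN: "(1 - \<delta> / 2) * ln (real n) \<le> ln (real (N n))"
      proof -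
        have "ln (real n powr (1 - \<delta> / 2)) \<le> ln (real (N n))" using Nbig Npos by (intro ln_mono) auto
        thus ?thesis using n by (simp add: ln_powr)
      qed
      define x where "x = real n powr (- (\<delta> / 2))"
      have x0: "0 \<le> x" by (simp add: x_def)
      have notwin: "pr n p (\<lambda>E. \<forall>\<sigma>\<in>configs m (N n). \<not> twin (a n) (b n) (N n) \<sigma> E) \<le> (1 + x) ^ m - 1"
        unfolding m_def
      proof (rule pr_no_twin_le[OF p01 _ N1 x0])
        show "(a n + 2 * b n) * N n \<le> n" using mN by (simp add: m_def)
        fix J assume J: "J \<subseteq> {..<a n + 2 * b n}"
        show "overlap_weight (a n) (b n) p J \<le> (real (N n) * x) ^ card J"
          unfolding x_def
          by (rule overlap_weight_le[OF p01 l_def k lq \<eta>_def \<delta>_def L_def _ a1(1) b1(1) N1 lnN n(1) J]) (use L2 in simp)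
      qed
      have "(1 + x) ^ m \<le> exp x ^ m" using x0 by (intro power_mono) auto
      also have "\<dots> = exp (real m * x)" by (simp add: exp_of_nat_mult)
      also have "\<dots> \<le> exp (3 * L n * x)" using m3 x0 by (simp add: mult_right_mono)
      finally have mx: "(1 + x) ^ m - 1 \<le> exp (3 * (ln (real n) / l) * real n powr (- (\<delta> / 2))) - 1"
        by (simp add: x_def L_def)
      have rr: "2 * (ln (real n) / l) + 2 \<le> real (r n)" "real (r n) \<le> 2 * L n + 3"
        using L2 unfolding r_def L_def[symmetric] by linarith+
      have "pr n p (\<lambda>E. \<not> real (bp n E) \<le> real n - (1 + c) * real (alpha n E)) \<le>
         pr n p (\<lambda>E. (\<forall>\<sigma>\<in>configs m (N n). \<not> twin (a n) (b n) (N n) \<sigma> E) \<or> r n \<le> alpha n E)"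
      proof (rule pr_mono)
        fix E assume E: "E \<subseteq> all_edges n" and neg: "\<not> real (bp n E) \<le> real n - (1 + c) * real (alpha n E)"
        show "(\<forall>\<sigma>\<in>configs m (N n). \<not> twin (a n) (b n) (N n) \<sigma> E) \<or> r n \<le> alpha n E"
        proof (rule ccontr)
          assume "\<not> ((\<forall>\<sigma>\<in>configs m (N n). \<not> twin (a n) (b n) (N n) \<sigma> E) \<or> r n \<le> alpha n E)"
          then obtain \<sigma> where s: "\<sigma> \<in> configs m (N n)" "twin (a n) (b n) (N n) \<sigma> E" and al: "alpha n E < r n" by auto
          have "bp n E + a n + b n \<le> n"
            using bp_le_twin[of \<sigma> "a n" "b n" "N n" n E] s mN E by (simp add: m_def)
          hence bpb: "real (bp n E) + real (a n) + real (b n) \<le> real n" by linarith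
          have "real (alpha n E) \<le> 2 * L n + 3" using al rr by linarith
          hence "(1 + c) * real (alpha n E) \<le> (1 + c) * (2 * L n + 3)" using c by (intro mult_left_mono) auto
          also have "\<dots> \<le> (2 + \<eta> * \<kappa>) * L n - 2" using elim by (simp add: L_def)
          also have "\<dots> = ((2 - \<eta>) * L n - 1) + (\<eta> * (1 + \<kappa>) * L n - 1)" by (simp add: algebra_simps)
          also have "\<dots> \<le> real (a n) + real (b n)" using a1 b1 by (intro add_mono) auto
          finally show False using neg bpb by linarith
        qed
      qed (use p01 in auto)
      also have "\<dots> \<le> pr n p (\<lambda>E. \<forall>\<sigma>\<in>configs m (N n). \<not> twin (a n) (b n) (N n) \<sigma> E) + pr n p (\<lambda>E. r n \<le> alpha n E)"
        using p01 by (intro pr_disj) auto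
      also have "\<dots> \<le> ?f n"
        using notwin mx pr_alpha_large_le[OF p01 l_def n(1) rr(1)] by (intro add_mono) linarith+
      finally show ?case .
    qed
  qed
  thus ?thesis using c by blast
qed

theorem theorem1:
  shows
   "(\<forall>p::real. 0 < p \<and> p < p0 \<longrightarrow>
       whp (\<lambda>_. p) (\<lambda>n E. bp n E = n - alpha n E))
  \<and> (\<forall>\<gamma>::real. -1/3 < \<gamma> \<and> \<gamma> < 0 \<longrightarrow>
       whp (\<lambda>n. real n powr \<gamma>) (\<lambda>n E. bp n E = n - alpha n E))
  \<and> (\<forall>p::real. p0 \<le> p \<and> p < 1/2 \<longrightarrow>
       (\<exists>C>0. whp (\<lambda>_. p) (\<lambda>n E. real (bp n E) \<ge> real n - C * real (alpha n E))))
  \<and> (\<forall>p::real. p0 < p \<and> p < 1/2 \<longrightarrow>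
       (\<exists>c>0. whp (\<lambda>_. p) (\<lambda>n E. real (bp n E) \<le> real n - (1 + c) * real (alpha n E))))"
  using whp_bp_eq_const whp_bp_eq_sparse whp_bp_lower whp_bp_upper p0_bounds(1)
  by (meson less_le_trans)

end
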